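(* Let $\gamma\in\mathbb{R}$, $\tau>0$ and the nonlinearity $Q$ be fixed as in the context. Fix $M>0$. Then there are $\varepsilon_0>0$ and $K>0$, with $K$ independent of $\varepsilon$, such that for every $0<\varepsilon<\varepsilon_0$ the following holds. For any given $\boldsymbol{\phi}\in C_b^0(\mathbb{R},\mathbb{R}^4)$, $\boldsymbol{\phi}=\boldsymbol{\phi}(\zeta_1)$, with $\|\boldsymbol{\phi}\|\le M$, there exists a unique solution $\boldsymbol{\psi}\in C_b^0(\mathbb{R},\mathcal{D})$, $\boldsymbol{\psi}=\boldsymbol{\psi}(\zeta)$, with values in the complementary subspace $\mathcal{P}_h\mathcal{H}$, of the system $$\frac{d}{d\zeta}\boldsymbol{\psi}-\mathcal{L}_{1,0}\boldsymbol{\psi}=\sqrt{\varepsilon}\,g\,\mathbf{F}_0(p)$$ (where in $g$ the function $\boldsymbol{\phi}$ is evaluated at $\zeta_1=\sqrt{\varepsilon}\,\zeta$), such that $\|\boldsymbol{\psi}\|\le\sqrt{\varepsilon}\,K$. Moreover, when $\boldsymbol{\phi}$ is anti-reversible with respect to $\mathcal{S}_0$, i.e. $\mathcal{S}_0\boldsymbol{\phi}(-\zeta_1)=-\boldsymbol{\phi}(\zeta_1)$, then $\boldsymbol{\psi}$ is anti-reversible with respect to $\mathcal{S}$, i.e. $\mathcal{S}\boldsymbol{\psi}(-\zeta)=-\boldsymbol{\psi}(\zeta)$. If $\boldsymbol{\phi}(\zeta_1)$ tends towards a $T$-periodic orbit as $\zeta_1\to\pm\infty$, then $\boldsymbol{\psi}(\zeta)$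 tends towards a $T/\sqrt{\varepsilon}$-periodic orbit of the system $\frac{d}{d\zeta}\boldsymbol{\psi}-\mathcal{L}_{1,0}\boldsymbol{\psi}=\sqrt{\varepsilon}\,g\,\mathbf{F}_0(p)$ as $\zeta\to\pm\infty$.
   Context: **Spaces.** $C_b^0(\mathbb{R},\mathcal{E})$ is the Banach space (sup norm) of bounded continuous functions on $\mathbb{R}$ with values in the Banach space $\mathcal{E}$. With $\mathbf{U}=(U_1,U_2,U_3(p))^T$, $p\in[-1,1]$, $$\mathcal{D}=\{(U_1,U_2)\in\mathbb{R}^2,\ U_3\in C^1([-1,1],\mathbb{R}),\ U_3(0)=U_1\},\qquad \mathcal{H}=\{(U_1,U_2)\in\mathbb{R}^2,\ U_3\in C^0([-1,1],\mathbb{R})\},$$ with the usual supremum norms. Write $\delta^{\pm}U_3=U_3(\pm1)$. **Linear operator.** $\mathcal{L}_{1,0}:\mathcal{D}\to\mathcal{H}$ is $$\mathcal{L}_{1,0}\mathbf{U}=\left(U_2,\ -2U_1+\delta^+U_3+\delta^-U_3,\ \partial_pU_3\right)^T.$$ Its spectrum consists of isolated eigenvalues, the roots of $2(\cosh\Lambda-1)-\Lambda^2=0$. Zero is a quadruple eigenvalue, with generalized eigenspace spanned by $(1,0,1)^T$, $(0,1,p)^T$, $(0,0,\tfrac12p^2)^T$, $(0,0,\tfrac16p^3)^T$, and there are no other eigenvalues on the imaginary axis. $\mathcal{P}_h$ denotes the spectral projection of $\mathcal{H}$ onto the invariant subspace of $\mathcal{L}_{1,0}$ complementary to this four-dimensional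 generalized eigenspace, and $$\mathbf{F}_0(p)=\mathcal{P}_h(0,-1,0)^T=\left(0,\ -\tfrac35,\ \tfrac25p(1-5p^2)\right)^T.$$ **Reversibility operators.** $\mathcal{S}(U_1,U_2,U_3(p))^T=(U_1,-U_2,U_3(-p))^T$ and $\mathcal{S}_0=\mathrm{diag}(1,-1,1,-1)$ on $\mathbb{R}^4$. **Nonlinearity.** $Q:\mathbb{R}^3\to\mathbb{R}$ is smooth and analytic near the origin. It contains no linear terms, and it is symmetric, $Q(v,u,w)=Q(w,u,v)$, and odd, $Q(-v,-u,-w)=-Q(v,u,w)$. Setting $F(u)=u+Q(u,u,u)$, the function $F$ is odd with $F(0)=0$, $F'(0)=1$, and there are $u_+=-u_->0$ with $F(u_\pm)=0$, $F'(u_\pm)<0$ and no zeros of $F$ in $[u_-,u_+]$ other than $u_-,0,u_+$. **The function $g$.** With $\boldsymbol{\phi}=(\phi_1,\phi_2,\phi_3,\phi_4)^T$ evaluated at $\zeta_1=\sqrt{\varepsilon}\,\zeta$ and $\boldsymbol{\psi}=(\psi_1,\psi_2,\psi_3(\cdot,p))^T$ evaluated at $\zeta$, $$g=\gamma\left(\phi_3-2\sqrt{\varepsilon}\,\psi_1+\sqrt{\varepsilon}(\delta^++\delta^-)\psi_3\right)-\tau\left(\phi_1+Q+\varepsilon^{3/2}\psi_1\right),$$ where $Q=Q(v_-,v_0,v_+)$ with $v_0=\phi_1+\varepsilon^{3/2}\psi_1$ and $$v_\pm=\phi_1\pm\sqrt{\varepsilon}\,\phi_2+\tfrac12\varepsilon\phi_3\pm\tfrac16\varepsilon^{3/2}\phi_4+\varepsilon^{3/2}\delta^\pm\psi_3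 .$$ *)

theory Defs
  imports "HOL-Analysis.Analysis" "HOL-Complex_Analysis.Complex_Analysis"
begin

no_notation fps_nth (infixl "$" 75)

section \<open>The spaces\<close>

text \<open>The interval \<open>[-1,1]\<close> as a metric space, so that \<open>C\<^sup>0([-1,1])\<close> with the supremum norm is
  a type of bounded continuous functions.\<close>

typedef pint = "{-1..1::real}"
  morphisms pval Pint
  by (rule exI[of _ 0]) simp

instantiation pint :: metric_space
begin

definition dist_pint :: "pint \<Rightarrow> pint \<Rightarrow> real"
  where "dist_pint x y = dist (pval x) (pval y)"

definition uniformity_pint :: "(pint \<times> pint) filter"
  where "uniformity_pint = (INF e\<in>{0<..}. principal {(x, y). dist x y < e})"

definition open_pint :: "pint set \<Rightarrow> bool"
  where "open_pint S \<longleftrightarrow> (\<forall>x\<in>S. \<forall>\<^sub>F (x', y) in uniformity. x' = x \<longrightarrow> y \<in> S)"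

instance
proof
  show "(dist x y = 0) = (x = y)" for x y :: pint
    by (simp add: dist_pint_def pval_inject)
  show "dist x y \<le> dist x z + dist y z" for x y z :: pint
    by (simp add: dist_pint_def dist_triangle2)
qed (simp_all only: uniformity_pint_def open_pint_def)

end

lemma compact_UNIV_pint: "compact (UNIV :: pint set)"
proof -
  have "continuous_on {-1..1} Pint"
    unfolding continuous_on_iff by (auto simp: dist_pint_def Pint_inverse)
  then have "compact (Pint ` {-1..1})"
    by (intro compact_continuous_image) auto
  moreover have "Pint ` {-1..1} = UNIV"
    by (metis UNIV_eq_I imageI pval pval_inverse)
  ultimately show ?thesis by simp
qed

lemma continuous_pint_bcontfun:
  fixes f :: "pint \<Rightarrow> 'a::metric_space"
  shows "continuous_on UNIV f \<Longrightarrow> f \<in> bcontfun"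
  using compact_continuous_image[OF _ compact_UNIV_pint, of f]
  by (auto simp: bcontfun_def intro: compact_imp_bounded)

text \<open>The space \<open>\<H>\<close>, over a general scalar field because the spectral projection
  is defined through the resolvent on the complexification. The product norm is equivalent to the
  maximum norm; for \<open>\<H>\<close> only the topology is used below.\<close>

type_synonym 'a hspace = "'a \<times> 'a \<times> (pint \<Rightarrow>\<^sub>C 'a)"

abbreviation ev :: "(pint \<Rightarrow>\<^sub>C 'a::metric_space) \<Rightarrow> real \<Rightarrow> 'a"
  where "ev f x \<equiv> apply_bcontfun f (Pint x)"

definition has_dp :: "(pint \<Rightarrow>\<^sub>C 'a::real_normed_vector) \<Rightarrow> (pint \<Rightarrow>\<^sub>C 'a) \<Rightarrow> bool"
  where "has_dp f f' \<longleftrightarrow>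
    (\<forall>p. ((\<lambda>x. ev f x) has_vector_derivative f' p) (at (pval p) within {-1..1}))"

definition dp :: "(pint \<Rightarrow>\<^sub>C 'a::real_normed_vector) \<Rightarrow> (pint \<Rightarrow>\<^sub>C 'a)"
  where "dp f = (THE f'. has_dp f f')"

lemma has_dp_unique: "has_dp f f' \<Longrightarrow> has_dp f f'' \<Longrightarrow> f' = f''"
proof (rule bcontfun_eqI)
  fix p assume f: "has_dp f f'" "has_dp f f''"
  show "f' p = f'' p"
    by (rule vector_derivative_unique_within_closed_interval
          [of "-1" 1 "pval p" "\<lambda>x. ev f x"])
       (use f pval[of p] in \<open>auto simp: has_dp_def\<close>)
qed

lemma dp_eq: "has_dp f f' \<Longrightarrow> dp f = f'"
  unfolding dp_def by (blast intro: has_dp_unique)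

lemma has_dp_zero: "has_dp 0 0"
  by (simp add: has_dp_def)

lemma has_dp_add: "has_dp f f' \<Longrightarrow> has_dp g g' \<Longrightarrow> has_dp (f + g) (f' + g')"
  by (auto simp: has_dp_def plus_bcontfun.rep_eq intro: has_vector_derivative_add)

lemma has_dp_scaleR: "has_dp f f' \<Longrightarrow> has_dp (c *\<^sub>R f) (c *\<^sub>R f')"
  using bounded_linear.has_vector_derivative[OF bounded_linear_scaleR_right[of c], of "ev f"]
  by (simp add: has_dp_def scaleR_bcontfun.rep_eq)

definition dom_L :: "'a::real_normed_field hspace set"
  where "dom_L = {(U1, U2, U3). (\<exists>U3'. has_dp U3 U3') \<and> ev U3 0 = U1}"

definition L_op :: "'a::real_normed_field hspace \<Rightarrow> 'a hspace"
  where "L_op = (\<lambda>(U1, U2, U3). (U2, - 2 * U1 + ev U3 1 + ev U3 (- 1), dp U3))"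

text \<open>The real space \<open>\<D>\<close> with its \<open>C\<^sup>1\<close> norm.\<close>

typedef dspace = "dom_L :: real hspace set"
  morphisms of_D D_of
  by (rule exI[of _ 0]) (auto simp: dom_L_def zero_prod_def intro: has_dp_zero)

setup_lifting type_definition_dspace

definition third :: "'a hspace \<Rightarrow> (pint \<Rightarrow>\<^sub>C 'a)"
  where "third U = snd (snd U)"

lemma has_dp_of_D: "has_dp (third (of_D U)) (dp (third (of_D U)))"
proof -
  obtain W where "has_dp (third (of_D U)) W"
    using of_D[of U] by (auto simp: dom_L_def third_def split_beta)
  then show ?thesis using dp_eq by metis
qed

instantiation dspace :: real_normed_vector
begin

lift_definition zero_dspace :: dspace is 0
  by (auto simp: dom_L_def zero_prod_def intro: has_dp_zero)

lift_definition plus_dspace :: "dspace \<Rightarrow> dspace \<Rightarrow> dspace" is "(+)"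
  by (auto simp: dom_L_def plus_bcontfun.rep_eq intro!: exI has_dp_add)

lift_definition scaleR_dspace :: "real \<Rightarrow> dspace \<Rightarrow> dspace" is "scaleR"
  by (auto simp: dom_L_def scaleR_bcontfun.rep_eq intro!: exI has_dp_scaleR)

definition uminus_dspace :: "dspace \<Rightarrow> dspace"
  where "uminus_dspace U = (- 1) *\<^sub>R U"

definition minus_dspace :: "dspace \<Rightarrow> dspace \<Rightarrow> dspace"
  where "minus_dspace U V = U + (- V)"

definition norm_dspace :: "dspace \<Rightarrow> real"
  where "norm_dspace U = (case of_D U of (U1, U2, U3) \<Rightarrow>
    Max {\<bar>U1\<bar>, \<bar>U2\<bar>, norm U3, norm (dp U3)})"

definition dist_dspace :: "dspace \<Rightarrow> dspace \<Rightarrow> real"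
  where "dist_dspace U V = norm (U - V)"

definition sgn_dspace :: "dspace \<Rightarrow> dspace"
  where "sgn_dspace U = inverse (norm U) *\<^sub>R U"

definition uniformity_dspace :: "(dspace \<times> dspace) filter"
  where "uniformity_dspace = (INF e\<in>{0<..}. principal {(x, y). dist x y < e})"

definition open_dspace :: "dspace set \<Rightarrow> bool"
  where "open_dspace S \<longleftrightarrow> (\<forall>x\<in>S. \<forall>\<^sub>F (x', y) in uniformity. x' = x \<longrightarrow> y \<in> S)"

lemma of_D_uminus: "of_D (- U) = - of_D U"
  by (simp add: uminus_dspace_def scaleR_dspace.rep_eq)

lemma norm_dspace_max:
  "norm (U::dspace) = max \<bar>fst (of_D U)\<bar> (max \<bar>fst (snd (of_D U))\<bar>
     (max (norm (third (of_D U))) (norm (dp (third (of_D U))))))"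
  by (simp add: norm_dspace_def third_def split_beta)

lemma norm_dspace_ge:
  fixes U :: dspace
  shows "\<bar>fst (of_D U)\<bar> \<le> norm U" "\<bar>fst (snd (of_D U))\<bar> \<le> norm U"
    "norm (third (of_D U)) \<le> norm U" "norm (dp (third (of_D U))) \<le> norm U"
  by (simp_all add: norm_dspace_max le_max_iff_disj)

lemma dp_third_plus:
  "dp (third (of_D (U + V))) = dp (third (of_D U)) + dp (third (of_D V))"
  using has_dp_add[OF has_dp_of_D has_dp_of_D, of U V]
  by (intro dp_eq) (simp add: third_def plus_dspace.rep_eq)

lemma dp_third_scaleR:
  "dp (third (of_D (c *\<^sub>R U))) = c *\<^sub>R dp (third (of_D U))"
  using has_dp_scaleR[OF has_dp_of_D, of c U]
  by (intro dp_eq) (simp add: third_def scaleR_dspace.rep_eq)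

instance
proof
  fix U V W :: dspace and a b :: real
  show "U + V + W = U + (V + W)" "U + V = V + U" "0 + U = U"
    "a *\<^sub>R (U + V) = a *\<^sub>R U + a *\<^sub>R V" "(a + b) *\<^sub>R U = a *\<^sub>R U + b *\<^sub>R U"
    "a *\<^sub>R b *\<^sub>R U = (a * b) *\<^sub>R U" "1 *\<^sub>R U = U"
    by (transfer, simp add: algebra_simps)+
  show "- U + U = 0"
    unfolding of_D_inject[symmetric] plus_dspace.rep_eq of_D_uminus zero_dspace.rep_eq by simp
  show "U - V = U + - V" by (simp add: minus_dspace_def)
  show "sgn U = inverse (norm U) *\<^sub>R U" by (simp add: sgn_dspace_def)
  show "dist U V = norm (U - V)" by (simp add: dist_dspace_def)
  have d0: "dp (0 :: pint \<Rightarrow>\<^sub>C real) = 0" by (rule dp_eq[OF has_dp_zero])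
  show "(norm U = 0) = (U = 0)"
  proof
    assume "norm U = 0"
    then have "\<bar>fst (of_D U)\<bar> \<le> 0" "\<bar>fst (snd (of_D U))\<bar> \<le> 0" "norm (third (of_D U)) \<le> 0"
      using norm_dspace_ge[of U] by linarith+
    then show "U = 0"
      by (simp add: of_D_inject[symmetric] zero_dspace.rep_eq third_def prod_eq_iff)
  next
    assume "U = 0"
    then show "norm U = 0"
      by (simp add: norm_dspace_max zero_dspace.rep_eq third_def d0)
  qed
  show "norm (U + V) \<le> norm U + norm V"
  proof -
    have "\<bar>fst (of_D (U + V))\<bar> \<le> \<bar>fst (of_D U)\<bar> + \<bar>fst (of_D V)\<bar>"
      "\<bar>fst (snd (of_D (U + V)))\<bar> \<le> \<bar>fst (snd (of_D U))\<bar> + \<bar>fst (snd (of_D V))\<bar>"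
      "norm (third (of_D (U + V))) \<le> norm (third (of_D U)) + norm (third (of_D V))"
      by (auto simp: plus_dspace.rep_eq third_def norm_triangle_ineq)
    moreover have "norm (dp (third (of_D (U + V))))
        \<le> norm (dp (third (of_D U))) + norm (dp (third (of_D V)))"
      unfolding dp_third_plus by (rule norm_triangle_ineq)
    ultimately show ?thesis
      unfolding norm_dspace_max[of "U + V"]
      using norm_dspace_ge[of U] norm_dspace_ge[of V]
      by (intro max.boundedI) linarith+
  qed
  show "norm (a *\<^sub>R U) = \<bar>a\<bar> * norm U"
    unfolding norm_dspace_max dp_third_scaleR
    by (simp add: scaleR_dspace.rep_eq third_def abs_mult max_mult_distrib_left)
qed (simp_all only: uniformity_dspace_def open_dspace_def)

end

section \<open>The linear operator and its spectral projection\<close>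

definition L10 :: "dspace \<Rightarrow> real hspace"
  where "L10 U = L_op (of_D U)"

definition cscale :: "complex \<Rightarrow> complex hspace \<Rightarrow> complex hspace"
  where "cscale c = (\<lambda>(U1, U2, U3). (c * U1, c * U2, Bcontfun (\<lambda>p. c * apply_bcontfun U3 p)))"

definition complexify :: "real hspace \<Rightarrow> complex hspace"
  where "complexify = (\<lambda>(U1, U2, U3).
    (complex_of_real U1, complex_of_real U2, Bcontfun (\<lambda>p. complex_of_real (apply_bcontfun U3 p))))"

definition resolvent :: "complex \<Rightarrow> complex hspace \<Rightarrow> complex hspace"
  where "resolvent l U = (THE V. V \<in> dom_L \<and> cscale l V - L_op V = U)"

text \<open>The Riesz projection \<open>(2\<pi>i)\<^sup>-\<^sup>1 \<ointegral> (\<lambda> - L)\<^sup>-\<^sup>1 d\<lambda>\<close> over a small circle around the eigenvalue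
  \<open>0\<close>, that is, the residue of the resolvent at \<open>0\<close>. It is computed in each scalar coordinate,
  the function component being evaluated pointwise in \<open>p\<close>; since \<open>L\<close> is real, it maps real
  elements to real ones. Its range is the generalized eigenspace of \<open>0\<close>.\<close>

definition P_center :: "real hspace \<Rightarrow> real hspace"
  where "P_center U =
    (Re (residue (\<lambda>l. fst (resolvent l (complexify U))) 0),
     Re (residue (\<lambda>l. fst (snd (resolvent l (complexify U)))) 0),
     Bcontfun (\<lambda>p. Re (residue (\<lambda>l. third (resolvent l (complexify U)) p) 0)))"

definition P_h :: "real hspace \<Rightarrow> real hspace"
  where "P_h U = U - P_center U"

text \<open>Evaluating the residues gives \<open>F0 = (0, -3/5, 2/5 * p * (1 - 5 * p\<^sup>2))\<close>.\<close>

definition F0 :: "real hspace"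
  where "F0 = P_h (0, - 1, 0)"

section \<open>Reversibility operators\<close>

definition S_rev :: "real hspace \<Rightarrow> real hspace"
  where "S_rev = (\<lambda>(U1, U2, U3). (U1, - U2, Bcontfun (\<lambda>p. ev U3 (- pval p))))"

definition S0_rev :: "real^4 \<Rightarrow> real^4"
  where "S0_rev x = vector [x $ 1, - x $ 2, x $ 3, - x $ 4]"

section \<open>The nonlinearity\<close>

primrec Ck :: "nat \<Rightarrow> ('a::euclidean_space \<Rightarrow> real) \<Rightarrow> bool"
  where
    "Ck 0 f \<longleftrightarrow> continuous_on UNIV f"
  | "Ck (Suc k) f \<longleftrightarrow>
      (\<forall>x. f differentiable (at x)) \<and> (\<forall>b\<in>Basis. Ck k (\<lambda>x. frechet_derivative f (at x) b))"

definition analytic_near_0 :: "(real \<Rightarrow> real \<Rightarrow> real \<Rightarrow> real) \<Rightarrow> bool"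
  where "analytic_near_0 Q \<longleftrightarrow> (\<exists>r>0. \<exists>a :: nat \<Rightarrow> nat \<Rightarrow> nat \<Rightarrow> real.
    \<forall>v u w. \<bar>v\<bar> < r \<and> \<bar>u\<bar> < r \<and> \<bar>w\<bar> < r \<longrightarrow>
      ((\<lambda>(i, j, k). a i j k * v ^ i * u ^ j * w ^ k) has_sum Q v u w) UNIV)"

text \<open>In the hypotheses on \<open>F(u) = u + Q(u,u,u)\<close>, only the existence of the zeros \<open>\<plusminus>u\<^sub>+\<close> with its
  properties is independent of the preceding hypotheses on \<open>Q\<close>.\<close>

definition admissible_Q :: "(real \<Rightarrow> real \<Rightarrow> real \<Rightarrow> real) \<Rightarrow> bool"
  where "admissible_Q Q \<longleftrightarrow>
    (\<forall>k. Ck k (\<lambda>(v, u, w). Q v u w)) \<and>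
    analytic_near_0 Q \<and>
    ((\<lambda>(v, u, w). Q v u w) has_derivative (\<lambda>_. 0)) (at 0) \<and>
    (\<forall>v u w. Q v u w = Q w u v) \<and>
    (\<forall>v u w. Q (- v) (- u) (- w) = - Q v u w) \<and>
    (let F = (\<lambda>u. u + Q u u u) in
      (\<forall>u. F (- u) = - F u) \<and> F 0 = 0 \<and> deriv F 0 = 1 \<and>
      (\<exists>up um. up > 0 \<and> up = - um \<and>
        F up = 0 \<and> F um = 0 \<and> deriv F up < 0 \<and> deriv F um < 0 \<and>
        (\<forall>u\<in>{um..up}. F u = 0 \<longrightarrow> u \<in> {um, 0, up})))"

definition g_fun ::
  "real \<Rightarrow> real \<Rightarrow> (real \<Rightarrow> real \<Rightarrow> real \<Rightarrow> real) \<Rightarrow> real \<Rightarrow> real^4 \<Rightarrow> real hspace \<Rightarrow> real"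
  where "g_fun \<gamma> \<tau> Q \<epsilon> = (\<lambda>\<phi> (\<psi>1, \<psi>2, \<psi>3).
    let v0 = \<phi> $ 1 + \<epsilon> powr (3/2) * \<psi>1;
        vp = \<phi> $ 1 + sqrt \<epsilon> * \<phi> $ 2 + 1/2 * \<epsilon> * \<phi> $ 3 + 1/6 * \<epsilon> powr (3/2) * \<phi> $ 4
               + \<epsilon> powr (3/2) * ev \<psi>3 1;
        vm = \<phi> $ 1 - sqrt \<epsilon> * \<phi> $ 2 + 1/2 * \<epsilon> * \<phi> $ 3 - 1/6 * \<epsilon> powr (3/2) * \<phi> $ 4
               + \<epsilon> powr (3/2) * ev \<psi>3 (- 1)
    in \<gamma> * (\<phi> $ 3 - 2 * sqrt \<epsilon> * \<psi>1 + sqrt \<epsilon> * (ev \<psi>3 1 + ev \<psi>3 (- 1)))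
       - \<tau> * (\<phi> $ 1 + Q vm v0 vp + \<epsilon> powr (3/2) * \<psi>1))"

section \<open>Solutions and asymptotically periodic functions\<close>

text \<open>A curve in \<open>\<D> \<inter> P\<^sub>h \<H>\<close>, continuous and bounded in \<open>\<D>\<close> and differentiable in \<open>\<H>\<close>, that
  satisfies the system for the given \<open>\<phi>\<close>.\<close>

definition solution ::
  "real \<Rightarrow> real \<Rightarrow> (real \<Rightarrow> real \<Rightarrow> real \<Rightarrow> real) \<Rightarrow> real \<Rightarrow>
    (real \<Rightarrow>\<^sub>C (real^4)) \<Rightarrow> (real \<Rightarrow>\<^sub>C dspace) \<Rightarrow> bool"
  where "solution \<gamma> \<tau> Q \<epsilon> \<phi> \<psi> \<longleftrightarrow>
    (\<forall>\<zeta>. of_D (\<psi> \<zeta>) \<in> range P_h) \<and>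
    (\<forall>\<zeta>. \<exists>d. ((\<lambda>z. of_D (\<psi> z)) has_vector_derivative d) (at \<zeta>) \<and>
      d - L10 (\<psi> \<zeta>) = (sqrt \<epsilon> * g_fun \<gamma> \<tau> Q \<epsilon> (\<phi> (sqrt \<epsilon> * \<zeta>)) (of_D (\<psi> \<zeta>))) *\<^sub>R F0)"

definition periodic :: "real \<Rightarrow> (real \<Rightarrow>\<^sub>C 'a::metric_space) \<Rightarrow> bool"
  where "periodic T f \<longleftrightarrow> T > 0 \<and> (\<forall>t. f (t + T) = f t)"

text \<open>Convergence to the orbit of a periodic function \<open>P\<close>, with asymptotic phase \<open>\<theta>\<close>; the phases
  at \<open>+\<infinity>\<close> and \<open>-\<infinity>\<close> may differ.\<close>

definition tends_to_orbit ::
  "real filter \<Rightarrow> (real \<Rightarrow>\<^sub>C 'a::real_normed_vector) \<Rightarrow> (real \<Rightarrow>\<^sub>C 'a) \<Rightarrow> real \<Rightarrow> bool"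
  where "tends_to_orbit X f P \<theta> \<longleftrightarrow> ((\<lambda>t. f t - P (t + \<theta>)) \<longlongrightarrow> 0) X"

end

(*
  Idea. Since the residue of the resolvent at 0 can be computed explicitly, the range of P_h is
  the common kernel of four moment functionals N0, ..., N3. Integrating the transport equation
  for psi3 along characteristics expresses psi3 by psi1 and the scalar right-hand side f, and the
  combination N1 - N3 = 0 then turns the linear problem into psi1 = B psi1 + (terms in f), where
  B is an averaging operator with norm at most 11/12. Hence the linear problem has at most one
  bounded solution, bounded by 56 * sup |f|; conversely the fixed point of this equation solves
  the problem, because N3 satisfies Z'' = Z along it and is bounded, so N3 = 0 and the other
  moments follow. The nonlinear problem is a contraction in f since f carries the factor
  sqrt eps. All estimates hold along any filter that is stable under bounded shifts of time, which
  yields uniqueness (filter top) and the asymptotics (at_top, at_bot) together; reversibility and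
  periodicity follow from uniqueness.
*)
theory Submission
  imports Defs
begin

section \<open>Functions on the interval\<close>

text \<open>Moment 1 alone expresses \<psi>1 as an average of \<psi>3 against \<open>1 - q\<close>
  of total mass exactly 1, because moment 1 vanishes on (1, 0, 1); this is borderline for a
  contraction. The kernel \<open>(1 - q)^3 / 6\<close> of moment 3 has total mass 1/12, and
  subtracting it leaves a nonnegative kernel of mass 11/12. The sign of this correction counts
  twice: for \<open>x = E1 - c * E3\<close>, where \<open>En\<close> is the average belonging to
  moment \<open>n\<close>, the defect \<open>Z = E3\<close> satisfies \<open>Z'' = c * Z\<close>,
  which excludes nonzero bounded solutions for \<open>c > 0\<close> but would allow oscillations for
  \<open>c < 0\<close>.

  The other obstacle is regularity: the source \<open>f\<close> is merely continuous, whereas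
  \<psi>3 must be C^1 in \<open>p\<close>. Since \<open>h0\<close> and the averaging kernel are
  cubic polynomials, four integrations by parts replace the integrals by iterated antiderivatives,
  which are differentiable; the same device shows that the fixed point is C^1. In the estimates the
  derivative in \<open>p\<close> is bounded through difference quotients. The nonlinear iteration
  runs on the scalar source, so only completeness of a space of bounded real functions is
  used.\<close>

definition bcf :: "(real \<Rightarrow> 'a::metric_space) \<Rightarrow> (pint \<Rightarrow>\<^sub>C 'a)"
  where "bcf g = Bcontfun (\<lambda>p. g (pval p))"

lemma continuous_on_pval: "continuous_on A pval"
  unfolding continuous_on_iff by (auto simp: dist_pint_def)

lemma continuous_on_Pint: "continuous_on {-1..1} Pint"
  unfolding continuous_on_iff by (auto simp: dist_pint_def Pint_inverse)

lemma pval_bounds [simp]: "-1 \<le> pval p" "pval p \<le> 1"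
  using pval[of p] by auto

lemma continuous_on_ev: "continuous_on {-1..1} (ev f)"
  by (rule continuous_on_compose2[OF _ continuous_on_Pint, of UNIV])
     (auto intro: continuous_on_apply_bcontfun)

lemma apply_bcf:
  assumes "continuous_on {-1..1} g"
  shows "apply_bcontfun (bcf g) p = g (pval p)"
proof -
  have "continuous_on UNIV (\<lambda>p. g (pval p))"
    by (rule continuous_on_compose2[OF assms continuous_on_pval]) auto
  then show ?thesis
    unfolding bcf_def by (simp add: Bcontfun_inverse continuous_pint_bcontfun)
qed

lemma ev_bcf:
  "continuous_on {-1..1} g \<Longrightarrow> -1 \<le> x \<Longrightarrow> x \<le> 1 \<Longrightarrow> ev (bcf g) x = g x"
  by (simp add: apply_bcf Pint_inverse)

lemma bcf_ev: "bcf (ev f) = f"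
  by (rule bcontfun_eqI) (simp add: apply_bcf[OF continuous_on_ev] pval_inverse)

lemma bcf_cong: "(\<And>x. -1 \<le> x \<Longrightarrow> x \<le> 1 \<Longrightarrow> g x = h x) \<Longrightarrow> bcf g = bcf h"
  unfolding bcf_def by (metis pval_bounds)

lemma has_dp_bcf:
  assumes d: "\<And>x. -1 \<le> x \<Longrightarrow> x \<le> 1 \<Longrightarrow> (g has_vector_derivative g' x) (at x within {-1..1})"
    and c: "continuous_on {-1..1} g'"
  shows "has_dp (bcf g) (bcf g')"
  unfolding has_dp_def
proof
  fix p
  have g: "continuous_on {-1..1} g"
    unfolding continuous_on_eq_continuous_within
    using d has_vector_derivative_continuous by fastforce
  show "(ev (bcf g) has_vector_derivative (bcf g') p) (at (pval p) within {-1..1})"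
    unfolding apply_bcf[OF c]
    by (rule has_vector_derivative_transform[OF _ _ d]) (auto simp: ev_bcf[OF g])
qed

lemma has_dp_ev:
  assumes "has_dp f f'" "-1 \<le> x" "x \<le> 1"
  shows "(ev f has_vector_derivative ev f' x) (at x within {-1..1})"
  using assms(1)[unfolded has_dp_def, rule_format, of "Pint x"] assms(2,3)
  by (simp add: Pint_inverse)

section \<open>The spectral projection\<close>

text \<open>Eliminating the other components, \<open>(l - L) V = U\<close> becomes the scalar equation
  \<open>dchar l * V1 = U2 + l * U1 - transf U3 0 l\<close>.\<close>

definition dchar :: "complex \<Rightarrow> complex"
  where "dchar l = l^2 + 2 - exp l - exp (- l)"

definition transf :: "(real \<Rightarrow> complex) \<Rightarrow> nat \<Rightarrow> complex \<Rightarrow> complex"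
  where "transf c n l = integral {0..1} (\<lambda>q. of_real ((1 - q)^n) *
    (exp (l * of_real (1 - q)) * c q - (-1)^n * (exp (- (l * of_real (1 - q))) * c (- q))))"

text \<open>Each derivative in \<open>l\<close> brings down \<open>1 - q\<close> from one
  exponential and \<open>- (1 - q)\<close> from the reflected one; the index \<open>n\<close> counts
  these factors.\<close>

lemma transf_deriv:
  assumes c: "continuous_on {-1..1} c"
  shows "(transf c n has_field_derivative transf c (Suc n) l) (at l)"
proof -
  have c1: "continuous_on {0..1} c" "continuous_on {0..1} (\<lambda>q. c (- q))"
    by (rule continuous_on_subset[OF c], simp)
       (rule continuous_on_compose2[OF c]; auto intro!: continuous_intros)
  have c2: "continuous_on (UNIV \<times> {0..1}) (\<lambda>x. c (snd x))"
    "continuous_on (UNIV \<times> {0..1}) (\<lambda>x. c (- snd x))"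
    by (rule continuous_on_compose2[OF c1(1)]; auto intro!: continuous_intros)
       (rule continuous_on_compose2[OF c1(2)]; auto intro!: continuous_intros)
  have "(transf c n has_field_derivative transf c (Suc n) l) (at l within UNIV)"
    unfolding transf_def cbox_interval[symmetric]
  proof (rule leibniz_rule_field_derivative[where U = UNIV])
    fix l :: complex and q :: real
    show "((\<lambda>l. of_real ((1 - q)^n) *
        (exp (l * of_real (1 - q)) * c q - (-1)^n * (exp (- (l * of_real (1 - q))) * c (- q))))
      has_field_derivative of_real ((1 - q) ^ Suc n) *
        (exp (l * of_real (1 - q)) * c q - (-1)^Suc n * (exp (- (l * of_real (1 - q))) * c (- q))))
      (at l within UNIV)"
      by (rule DERIV_cmult [THEN DERIV_cong]) (rule derivative_eq_intros refl | simp add: algebra_simps)+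
  next
    fix l :: complex
    show "(\<lambda>q. of_real ((1 - q)^n) *
        (exp (l * of_real (1 - q)) * c q - (-1)^n * (exp (- (l * of_real (1 - q))) * c (- q))))
        integrable_on cbox 0 1"
      unfolding cbox_interval
      by (intro integrable_continuous_real continuous_intros c1)
  next
    show "continuous_on (UNIV \<times> cbox 0 1) (\<lambda>(l::complex, q). of_real ((1 - q) ^ Suc n) *
        (exp (l * of_real (1 - q)) * c q - (-1)^Suc n * (exp (- (l * of_real (1 - q))) * c (- q))))"
      unfolding cbox_interval split_beta
      by (intro continuous_intros c2)
  qed auto
  then show ?thesis by simp
qed

text \<open>At \<open>l = 0\<close> the exponentials disappear and integrals of \<open>c\<close>
  against powers of \<open>1 - q\<close> remain; for real data these are the integral parts of the
  moments.\<close>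

lemma transf_expansion:
  assumes c: "continuous_on {-1..1} c"
  shows "transf c 0 has_fps_expansion Abs_fps (\<lambda>n. transf c n 0 / fact n)"
proof -
  have "(deriv ^^ n) (transf c 0) = transf c n" for n
    by (induction n) (auto intro!: ext DERIV_imp_deriv transf_deriv[OF c])
  then have "fps_expansion (transf c 0) 0 = Abs_fps (\<lambda>n. transf c n 0 / fact n)"
    by (simp add: fps_expansion_def)
  moreover have "transf c 0 has_fps_expansion fps_expansion (transf c 0) 0"
    using transf_deriv[OF c, of 0]
    by (intro has_fps_expansion_fps_expansion[of UNIV])
       (auto simp: holomorphic_on_def field_differentiable_def)
  ultimately show ?thesis by simp
qed

text \<open>The oriented integral from \<open>0\<close> to \<open>p\<close>, written as a difference
  of integrals from \<open>-1\<close> so that one formula serves both signs of \<open>p\<close>. The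
  base point is \<open>0\<close> because the domain prescribes the third component there.\<close>

definition prim :: "(real \<Rightarrow> complex) \<Rightarrow> complex \<Rightarrow> real \<Rightarrow> complex"
  where "prim c l p = integral {-1..p} (\<lambda>q. exp (- (l * of_real q)) * c q)
     - integral {-1..0} (\<lambda>q. exp (- (l * of_real q)) * c q)"

lemma prim_0 [simp]: "prim c l 0 = 0"
  by (simp add: prim_def)

lemma prim_deriv:
  assumes c: "continuous_on {-1..1} c" and "-1 \<le> p" "p \<le> 1"
  shows "(prim c l has_vector_derivative exp (- (l * of_real p)) * c p) (at p within {-1..1})"
  unfolding prim_def
  by (rule derivative_eq_intros integral_has_vector_derivative continuous_intros c refl)+
     (use assms in auto)

text \<open>Holomorphy in \<open>l\<close> is all that the residue requires of this term: next to
  the fourth order pole it carries a factor \<open>l^4\<close> and contributes nothing.\<close>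

lemma prim_holomorphic:
  assumes c: "continuous_on {-1..1} c" and "-1 \<le> p" "p \<le> 1"
  shows "(\<lambda>l. prim c l p) holomorphic_on UNIV"
proof -
  have *: "(\<lambda>l. integral {-1..r} (\<lambda>q. exp (- (l * of_real q)) * c q)) holomorphic_on UNIV"
    if "r \<le> 1" for r
    unfolding cbox_interval[symmetric]
  proof (rule leibniz_rule_holomorphic
      [where fx = "\<lambda>l q. - of_real q * (exp (- (l * of_real q)) * c q)"])
    have c1: "continuous_on {-1..r} c"
      using that by (intro continuous_on_subset[OF c]) auto
    have c2: "continuous_on (UNIV \<times> {-1..r}) (\<lambda>x. c (snd x))"
      by (rule continuous_on_compose2[OF c1]) (auto intro!: continuous_intros)
    show "(\<lambda>q. exp (- (l * of_real q)) * c q) integrable_on cbox (-1) r" for l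
      unfolding cbox_interval by (intro integrable_continuous_real continuous_intros c1)
    show "continuous_on (UNIV \<times> cbox (-1) r)
        (\<lambda>(l, q). - of_real q * (exp (- (l * of_real q)) * c q))"
      unfolding cbox_interval split_beta by (intro continuous_intros c2)
    show "((\<lambda>l. exp (- (l * of_real q)) * c q) has_field_derivative
       - of_real q * (exp (- (l * of_real q)) * c q)) (at l within UNIV)" for l q
      by (auto intro!: derivative_eq_intros)
  qed auto
  show ?thesis
    unfolding prim_def using *[of p] *[of 0] assms by (intro holomorphic_intros) auto
qed

text \<open>The second equation of \<open>(l - L) V = U\<close> contains
  \<open>V3(1) + V3(-1)\<close>. With \<open>V3(p) = exp (l * p) * (V1 - prim c l p)\<close>, the
  part of this that depends on \<open>U3\<close> is minus the present sum.\<close>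

lemma prim_ends:
  assumes c: "continuous_on {-1..1} c"
  shows "exp l * prim c l 1 + exp (- l) * prim c l (-1) = transf c 0 l"
proof -
  let ?f = "\<lambda>q. exp (- (l * of_real q)) * c q"
  have c1: "continuous_on {-1..1} ?f" by (intro continuous_intros c)
  have c0: "continuous_on {0..1} c" "continuous_on {0..1} (\<lambda>q. c (- q))"
    by (rule continuous_on_subset[OF c], simp)
       (rule continuous_on_compose2[OF c]; auto intro!: continuous_intros)
  have i: "integral {-1..0} ?f + integral {0..1} ?f = integral {-1..1} ?f"
    by (rule Henstock_Kurzweil_Integration.integral_combine)
       (auto intro: integrable_continuous_real c1)
  have "integral {0..1} (\<lambda>q. ?f (- q)) = integral {-1..0} ?f"
    using Henstock_Kurzweil_Integration.integral_reflect_real[of 0 "-1" ?f] by simp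
  then have p: "prim c l 1 = integral {0..1} ?f" "prim c l (-1) = - integral {0..1} (\<lambda>q. ?f (- q))"
    using i by (auto simp: prim_def algebra_simps)
  have "transf c 0 l = integral {0..1} (\<lambda>q. exp l * ?f q - exp (- l) * ?f (- q))"
    unfolding transf_def
    by (intro integral_cong) (simp add: algebra_simps exp_diff exp_add exp_minus divide_simps)
  also have "\<dots> = exp l * integral {0..1} ?f - exp (- l) * integral {0..1} (\<lambda>q. ?f (- q))"
    by (subst Henstock_Kurzweil_Integration.integral_diff)
       (auto intro!: integrable_continuous_real continuous_intros c0)
  finally show ?thesis by (simp add: p)
qed

text \<open>The third component comes from variation of constants with value \<open>V1\<close> at
  \<open>p = 0\<close>. As \<open>resolvent\<close> is a definite description, the candidate has to
  be checked and its uniqueness proved as well.\<close>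

lemma resolvent_eq:
  fixes U3 :: "pint \<Rightarrow>\<^sub>C complex" and a b l :: complex
  assumes d: "dchar l \<noteq> 0"
  defines "V1 \<equiv> (b + l * a - transf (ev U3) 0 l) / dchar l"
  shows "resolvent l (a, b, U3) =
    (V1, l * V1 - a, bcf (\<lambda>p. exp (l * of_real p) * (V1 - prim (ev U3) l p)))"
proof -
  let ?c = "ev U3"
  note c = continuous_on_ev[of U3]
  define g where "g = (\<lambda>p. exp (l * of_real p) * (V1 - prim ?c l p))"
  have gd: "(g has_vector_derivative l * g p - ?c p) (at p within {-1..1})"
    if "-1 \<le> p" "p \<le> 1" for p
  proof -
    have "((\<lambda>p. exp (l * of_real p)) has_vector_derivative l * exp (l * of_real p)) (at p within {-1..1})"
      by (auto intro!: derivative_eq_intros has_vector_derivative_real_field)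
    from has_vector_derivative_mult[OF this
        has_vector_derivative_diff[OF has_vector_derivative_const[of V1] prim_deriv[OF c that, of l]]]
    show ?thesis unfolding g_def
      by (rule has_vector_derivative_eq_rhs) (simp add: algebra_simps flip: exp_add)
  qed
  have gc: "continuous_on {-1..1} g"
    unfolding continuous_on_eq_continuous_within
    using gd has_vector_derivative_continuous by fastforce
  have hd: "has_dp (bcf g) (bcf (\<lambda>p. l * g p - ?c p))"
    by (intro has_dp_bcf gd continuous_intros gc c)
  have cs: "cscale l (x, y, f) = (l * x, l * y, bcf (\<lambda>p. l * ev f p))" for x y f
    by (simp add: cscale_def bcf_def pval_inverse)
  have ends: "exp l * prim ?c l 1 + exp (- l) * prim ?c l (-1) = transf ?c 0 l"
    by (rule prim_ends[OF c])
  have V1: "V1 * dchar l = b + l * a - transf ?c 0 l"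
    using d by (simp add: V1_def)
  have "(THE V. V \<in> dom_L \<and> cscale l V - L_op V = (a, b, U3)) = (V1, l * V1 - a, bcf g)"
  proof (rule the_equality)
    have "bcf (\<lambda>p. l * ev (bcf g) p) - bcf (\<lambda>p. l * g p - ?c p) = U3"
    proof (rule bcontfun_eqI)
      fix p
      have "continuous_on {-1..1} (\<lambda>p. l * ev (bcf g) p)"
        by (intro continuous_intros continuous_on_ev)
      then show "(bcf (\<lambda>p. l * ev (bcf g) p) - bcf (\<lambda>p. l * g p - ?c p)) p = U3 p"
        by (simp add: apply_bcf gc c continuous_intros minus_bcontfun.rep_eq pval_inverse)
    qed
    moreover have "l * (l * V1 - a) - (- 2 * V1 + g 1 + g (- 1)) = b"
      using V1 ends by (simp add: g_def dchar_def algebra_simps power2_eq_square)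
    moreover have "g 0 = V1" by (simp add: g_def)
    ultimately show "(V1, l * V1 - a, bcf g) \<in> dom_L \<and>
        cscale l (V1, l * V1 - a, bcf g) - L_op (V1, l * V1 - a, bcf g) = (a, b, U3)"
      using hd by (auto simp: dom_L_def L_op_def cs ev_bcf[OF gc] dp_eq[OF hd])
  next
    fix V assume V: "V \<in> dom_L \<and> cscale l V - L_op V = (a, b, U3)"
    obtain W1 W2 W3 where W: "V = (W1, W2, W3)" by (cases V)
    obtain W' where W': "has_dp W3 W'" and W0: "ev W3 0 = W1"
      using V by (auto simp: W dom_L_def)
    have e: "l * W1 - W2 = a" "l * W2 - (- 2 * W1 + ev W3 1 + ev W3 (-1)) = b"
        "bcf (\<lambda>p. l * ev W3 p) - W' = U3"
      using V by (auto simp: W L_op_def cs dp_eq[OF W'])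
    have W'_eq: "ev W' p = l * ev W3 p - ?c p" if "-1 \<le> p" "p \<le> 1" for p
    proof -
      have "continuous_on {-1..1} (\<lambda>p. l * ev W3 p)"
        by (intro continuous_intros continuous_on_ev)
      then have "ev U3 p = l * ev W3 p - ev W' p"
        unfolding e(3)[symmetric] using that by (simp add: minus_bcontfun.rep_eq ev_bcf)
      then show ?thesis by simp
    qed
    \<comment> \<open>The integrating factor: \<open>k\<close> is constant along a solution of the
      linear equation for \<open>W3\<close>, so \<open>W3\<close> is determined by its value at
      \<open>0\<close>.\<close>
    define k where "k = (\<lambda>p. exp (- (l * of_real p)) * ev W3 p + prim ?c l p)"
    have "(k has_vector_derivative 0) (at p within {-1..1})" if "p \<in> {-1..1}" for p
    proof -
      have p: "-1 \<le> p" "p \<le> 1" using that by auto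
      have "((\<lambda>p. exp (- (l * of_real p))) has_vector_derivative - l * exp (- (l * of_real p)))
          (at p within {-1..1})"
        by (auto intro!: derivative_eq_intros has_vector_derivative_real_field)
      from has_vector_derivative_add[OF has_vector_derivative_mult[OF this has_dp_ev[OF W' p]]
          prim_deriv[OF c p, of l]]
      show ?thesis unfolding k_def W'_eq[OF p]
        by (rule has_vector_derivative_eq_rhs) (simp add: algebra_simps)
    qed
    then obtain k0 where "\<And>p. p \<in> {-1..1} \<Longrightarrow> k p = k0"
      using has_vector_derivative_zero_constant[of "{-1..1}" k] by (metis convex_real_interval(5))
    then have "k p = k 0" if "-1 \<le> p" "p \<le> 1" for p using that by simp
    then have W3: "ev W3 p = exp (l * of_real p) * (W1 - prim ?c l p)" if "-1 \<le> p" "p \<le> 1" for p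
      using that W0 unfolding k_def by (simp add: exp_minus field_simps)
    have "W1 * dchar l = b + l * a - transf ?c 0 l"
    proof -
      have "W2 = l * W1 - a" using e(1) by (simp add: algebra_simps)
      from e(2)[unfolded this] show ?thesis using ends W3[of 1] W3[of "-1"]
        by (simp add: dchar_def algebra_simps power2_eq_square)
    qed
    then have "W1 = V1" using V1 d by (metis mult_right_cancel)
    moreover from this have "bcf (ev W3) = bcf g"
      by (intro bcf_cong) (simp add: W3 g_def)
    ultimately show "V = (V1, l * V1 - a, bcf g)"
      using e(1) by (auto simp: W bcf_ev)
  qed
  then show ?thesis by (simp add: resolvent_def g_def)
qed

text \<open>The \<open>n\<close>-th Taylor coefficient at \<open>l = 0\<close> of the numerator
  \<open>U2 + l * U1 - transf U3 0 l\<close> of the resolvent. Its denominator \<open>dchar\<close>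
  vanishes to order 4, so only \<open>n < 4\<close> influences the pole.\<close>

definition moment :: "nat \<Rightarrow> real hspace \<Rightarrow> real"
  where "moment n U = (if n = 0 then fst (snd U) else if n = 1 then fst U else 0) -
    integral {0..1} (\<lambda>q. (1 - q)^n / fact n * (ev (third U) q - (-1)^n * ev (third U) (- q)))"

lemma continuous_on_ev01 [continuous_intros]:
  "continuous_on {0..1} (ev f)" "continuous_on {0..1} (\<lambda>q. ev f (- q))"
  by (rule continuous_on_subset[OF continuous_on_ev], simp)
     (rule continuous_on_compose2[OF continuous_on_ev]; auto intro!: continuous_intros)

lemma complexify_eq:
  "complexify U = (of_real (fst U), of_real (fst (snd U)), bcf (\<lambda>p. of_real (ev (third U) p)))"
  by (simp add: complexify_def bcf_def third_def split_beta pval_inverse)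

lemma continuous_on_of_real_ev: "continuous_on {-1..1} (\<lambda>p. of_real (ev f p) :: complex)"
  by (intro continuous_intros continuous_on_ev)

lemma transf_complexify:
  "transf (ev (bcf (\<lambda>p. of_real (ev (third U) p)))) n 0 / fact n =
    of_real ((if n = 0 then fst (snd U) else if n = 1 then fst U else 0) - moment n U)"
proof -
  let ?u = "ev (third U)"
  have "transf (ev (bcf (\<lambda>p. of_real (?u p)))) n 0
      = integral {0..1} (\<lambda>q. of_real ((1 - q)^n * (?u q - (-1)^n * ?u (- q))))"
    unfolding transf_def
    by (intro integral_cong) (simp add: ev_bcf[OF continuous_on_of_real_ev])
  also have "\<dots> = of_real (integral {0..1} (\<lambda>q. (1 - q)^n * (?u q - (-1)^n * ?u (- q))))"
    by (intro integral_unique has_integral_of_real integrable_integral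
        integrable_continuous_real continuous_intros)
  also have "integral {0..1} (\<lambda>q. (1 - q)^n * (?u q - (-1)^n * ?u (- q)))
      = fact n * integral {0..1} (\<lambda>q. (1 - q)^n / fact n * (?u q - (-1)^n * ?u (- q)))"
    by (subst Henstock_Kurzweil_Integration.integral_mult_right[symmetric]) simp
  finally show ?thesis by (simp add: moment_def)
qed

text \<open>Coefficients of the product of the moments with
  \<open>l^4 / dchar l = - 12 + 2/5 * l^2 + O(l^4)\<close>.\<close>

definition center_poly :: "real hspace \<Rightarrow> nat \<Rightarrow> real"
  where "center_poly U = (\<lambda>n. [- 12 * moment 0 U, - 12 * moment 1 U,
    - 12 * moment 2 U + 2/5 * moment 0 U, - 12 * moment 3 U + 2/5 * moment 1 U] ! n)"

text \<open>The quadruple zero of \<open>dchar\<close> is the quadruple eigenvalue. Dividing by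
  \<open>l^4\<close> leaves the invertible series \<open>- 1/12 - l^2/360 + ...\<close>, and the
  value put in at \<open>0\<close> removes the singularity. Order 3 suffices against a pole of order
  4.\<close>

lemma dchar_expansion:
  obtains S where
    "(\<lambda>l. if l = 0 then - 1/12 else dchar l / l ^ 4) has_fps_expansion S"
    "fps_nth S 0 = - 1/12" "fps_nth S 1 = 0" "fps_nth S 2 = - 1/360" "fps_nth S 3 = 0"
proof -
  define F :: "complex fps" where "F = fps_X^2 + 2 - fps_exp 1 - fps_exp (-1)"
  have F: "dchar has_fps_expansion F"
    unfolding dchar_def F_def by (intro fps_expansion_intros)
  have n: "fps_nth F 0 = 0" "fps_nth F 1 = 0" "fps_nth F 2 = 0" "fps_nth F 3 = 0"
     "fps_nth F 4 = - 1/12" "fps_nth F 5 = 0" "fps_nth F 6 = - 1/360" "fps_nth F 7 = 0"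
    by (auto simp: F_def fps_numeral_nth fact_numeral power2_eq_square fps_X_power_nth simp flip: power2_eq_square)
  have "F \<noteq> 0" using n(5) by auto
  moreover have "fps_nth F i = 0" if "i < 4" for i
  proof -
    have "i \<in> {0, 1, 2, 3}" using that by auto
    then show ?thesis using n by auto
  qed
  ultimately have "4 \<le> subdegree F" by (intro subdegree_geI)
  from has_fps_expansion_shift[OF F this, of "- 1/12"] n
  have "(\<lambda>l. if l = 0 then - 1/12 else dchar l / l ^ 4) has_fps_expansion fps_shift 4 F" by simp
  then show ?thesis using n by (intro that[of "fps_shift 4 F"]) (simp_all add: numeral_eq_Suc)
qed

text \<open>Near \<open>0\<close> the first component of the resolvent is \<open>h l / l^4\<close>
  with \<open>h\<close> analytic, so the three residues are the coefficients of \<open>l^3\<close>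
  in \<open>h l\<close>, \<open>l * h l\<close> and \<open>exp (l * p) * h l\<close>; all other
  terms carry a factor \<open>l^4\<close>. The exponential is what produces the cubic in
  \<open>p\<close>.\<close>

lemma P_center_eq:
  "P_center U = (center_poly U 3, center_poly U 2,
     bcf (\<lambda>p. center_poly U 3 + center_poly U 2 * p + center_poly U 1 * p^2 / 2 + center_poly U 0 * p^3 / 6))"
proof -
  define a b :: complex where "a = of_real (fst U)" "b = of_real (fst (snd U))"
  define W where "W = bcf (\<lambda>p. of_real (ev (third U) p) :: complex)"
  have cU: "complexify U = (a, b, W)" by (simp add: complexify_eq a_b_def W_def)
  obtain S where S: "(\<lambda>l. if l = 0 then - 1/12 else dchar l / l ^ 4) has_fps_expansion S"
    and S_nth: "fps_nth S 0 = - 1/12" "fps_nth S 1 = 0" "fps_nth S 2 = - 1/360" "fps_nth S 3 = 0"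
    by (rule dchar_expansion)
  define D where "D = (\<lambda>l. if l = 0 then - 1/12 else dchar l / l ^ 4)"
  define G where "G = fps_const b + fps_const a * fps_X - Abs_fps (\<lambda>n. transf (ev W) n 0 / fact n)"
  have G: "(\<lambda>l. b + a * l - transf (ev W) 0 l) has_fps_expansion G"
    unfolding G_def by (intro fps_expansion_intros transf_expansion continuous_on_ev)
  have G_nth: "fps_nth G 0 = of_real (moment 0 U)" "fps_nth G 1 = of_real (moment 1 U)"
     "fps_nth G 2 = of_real (moment 2 U)" "fps_nth G 3 = of_real (moment 3 U)"
    using transf_complexify[of U 0] transf_complexify[of U 1]
      transf_complexify[of U 2] transf_complexify[of U 3]
    by (simp_all add: G_def W_def a_b_def)
  define E where "E = inverse S"
  have "E * S = 1" unfolding E_def by (rule inverse_mult_eq_1) (simp add: S_nth)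
  then have e: "fps_nth (E * S) n = (if n = 0 then 1 else 0)" for n by simp
  have E_nth: "fps_nth E 0 = - 12" "fps_nth E 1 = 0" "fps_nth E 2 = 2/5" "fps_nth E 3 = 0"
  proof -
    have e0: "fps_nth E 0 * (- 1/12) = 1"
      using e[of 0] S_nth by simp
    then show E0: "fps_nth E 0 = - 12" by algebra
    have "fps_nth E 1 * (- 1/12) = 0"
      using e[of 1] S_nth by (simp add: fps_mult_nth)
    then show E1: "fps_nth E 1 = 0" by simp
    have "fps_nth E 0 * (- 1/360) + fps_nth E 2 * (- 1/12) = 0"
      using e[of 2] S_nth E1 by (simp add: fps_mult_nth eval_nat_numeral)
    then show "fps_nth E 2 = 2/5" by (simp add: E0 field_simps)
    have "fps_nth E 3 * (- 1/12) = 0"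
      using e[of 3] S_nth E1 by (simp add: fps_mult_nth eval_nat_numeral)
    then show "fps_nth E 3 = 0" by simp
  qed
  define h where "h = (\<lambda>l. (b + a * l - transf (ev W) 0 l) * inverse (D l))"
  define K where "K = G * E"
  have h: "h has_fps_expansion K"
    unfolding h_def K_def E_def D_def by (intro fps_expansion_intros G S) (simp add: S_nth)
  have H_nth: "fps_nth K n = of_real (center_poly U n)" if "n < 4" for n
  proof -
    have "n \<in> {0, 1, 2, 3}" using that by auto
    then show ?thesis using G_nth E_nth
      by (auto simp: K_def fps_mult_nth center_poly_def eval_nat_numeral)
  qed
  \<comment> \<open>\<open>D 0 = - 1/12\<close> is nonzero, so \<open>dchar\<close> has no zero in a
    punctured neighbourhood of \<open>0\<close>; that is enough to compute residues with
    \<open>resolvent_eq\<close>.\<close>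
  have "continuous (at 0) D"
    using has_fps_expansion_imp_continuous[OF S, of UNIV] by (simp add: D_def)
  then have "eventually (\<lambda>l. D l \<noteq> 0) (at 0)"
    unfolding continuous_at by (rule tendsto_imp_eventually_ne) (simp add: D_def)
  moreover have "eventually (\<lambda>l::complex. l \<noteq> 0) (at 0)"
    by (simp add: eventually_at_filter)
  ultimately have ev_nz: "eventually (\<lambda>l. dchar l \<noteq> 0 \<and> l \<noteq> 0 \<and>
      resolvent l (a, b, W) = (h l / l^4, l * (h l / l^4) - a,
        bcf (\<lambda>p. exp (l * of_real p) * (h l / l^4 - prim (ev W) l p)))) (at 0)"
  proof eventually_elim
    case (elim l)
    then have d: "dchar l \<noteq> 0" by (auto simp: D_def)
    have "(b + l * a - transf (ev W) 0 l) / dchar l = h l / l ^ 4"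
      using elim d by (simp add: h_def D_def field_simps)
    then show ?case using elim d resolvent_eq[OF d, of a b W] by simp
  qed
  have "residue (\<lambda>l. fst (resolvent l (complexify U))) 0 = residue (\<lambda>l. h l / l ^ Suc 3) 0"
    unfolding cU by (rule residue_cong[OF _ refl]) (use ev_nz in eventually_elim, simp)
  also have "\<dots> = of_real (center_poly U 3)"
    using residue_fps_expansion_over_power_at_0[OF h, of 3] H_nth by simp
  finally have r1: "residue (\<lambda>l. fst (resolvent l (complexify U))) 0 = of_real (center_poly U 3)" .
  have "residue (\<lambda>l. fst (snd (resolvent l (complexify U)))) 0
      = residue (\<lambda>l. (l * h l - a * l^4) / l ^ Suc 3) 0"
    unfolding cU by (rule residue_cong[OF _ refl])
      (use ev_nz in eventually_elim, simp add: divide_simps)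
  also have "\<dots> = fps_nth (fps_X * K - fps_const a * fps_X ^ 4) 3"
    by (intro residue_fps_expansion_over_power_at_0 fps_expansion_intros h)
  also have "\<dots> = of_real (center_poly U 2)"
    using H_nth[of 2] by (simp add: fps_X_power_nth)
  finally have r2: "residue (\<lambda>l. fst (snd (resolvent l (complexify U)))) 0 = of_real (center_poly U 2)" .
  have r3: "residue (\<lambda>l. third (resolvent l (complexify U)) q) 0
      = of_real (center_poly U 3 + center_poly U 2 * p + center_poly U 1 * p^2 / 2 + center_poly U 0 * p^3 / 6)"
    if q: "p = pval q" for p q
  proof -
    have p: "-1 \<le> p" "p \<le> 1" by (simp_all add: q)
    obtain F where F: "(\<lambda>l. prim (ev W) l p) has_fps_expansion F"
      using has_fps_expansion_fps_expansion[OF _ _ prim_holomorphic[OF continuous_on_ev p]] by blast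
    have "continuous_on {-1..1} (\<lambda>p. exp (l * of_real p) * (h l / l^4 - prim (ev W) l p))" for l
    proof -
      have "continuous_on {-1..1} (prim (ev W) l)"
        unfolding continuous_on_eq_continuous_within
        using prim_deriv[OF continuous_on_ev] has_vector_derivative_continuous by fastforce
      then show ?thesis by (intro continuous_intros)
    qed
    note ap = apply_bcf[OF this]
    have "residue (\<lambda>l. third (resolvent l (complexify U)) q) 0
        = residue (\<lambda>l. (exp (of_real p * l) * (h l - prim (ev W) l p * l ^ 4)) / l ^ Suc 3) 0"
      unfolding cU by (rule residue_cong[OF _ refl])
        (use ev_nz in eventually_elim, simp add: third_def ap q, simp add: divide_simps mult.commute)
    also have "\<dots> = fps_nth (fps_exp (of_real p) * (K - F * fps_X ^ 4)) 3"
      by (intro residue_fps_expansion_over_power_at_0 fps_expansion_intros h F)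
    \<comment> \<open>\<open>F * fps_X ^ 4\<close> starts at order 4, so the unknown coefficients of
      \<open>F\<close> do not enter.\<close>
    also have "\<dots> = (\<Sum>i\<le>3. of_real p ^ i / fact i * fps_nth K (3 - i))"
      unfolding fps_mult_nth atMost_atLeast0
      by (intro sum.cong refl) (simp add: fps_X_power_mult_right_nth)
    also have "\<dots> = of_real (center_poly U 3 + center_poly U 2 * p + center_poly U 1 * p^2 / 2 + center_poly U 0 * p^3 / 6)"
      by (simp add: H_nth eval_nat_numeral algebra_simps)
    finally show ?thesis .
  qed
  show ?thesis
    unfolding P_center_def r1 r2 r3[OF refl] bcf_def by simp
qed

section \<open>The range of the projection as the common kernel of the moments\<close>

lemma moment_diff: "moment n (U - V) = moment n U - moment n V"
proof -
  have "integral {0..1} (\<lambda>q. (1 - q)^n / fact n * (ev (third (U - V)) q - (-1)^n * ev (third (U - V)) (- q)))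
    = integral {0..1} (\<lambda>q. (1 - q)^n / fact n * (ev (third U) q - (-1)^n * ev (third U) (- q))
       - (1 - q)^n / fact n * (ev (third V) q - (-1)^n * ev (third V) (- q)))"
    by (intro integral_cong) (simp add: third_def minus_bcontfun.rep_eq algebra_simps)
  also have "\<dots> = integral {0..1} (\<lambda>q. (1 - q)^n / fact n * (ev (third U) q - (-1)^n * ev (third U) (- q)))
       - integral {0..1} (\<lambda>q. (1 - q)^n / fact n * (ev (third V) q - (-1)^n * ev (third V) (- q)))"
    by (intro Henstock_Kurzweil_Integration.integral_diff integrable_continuous_real continuous_intros) auto
  finally show ?thesis by (simp add: moment_def)
qed

text \<open>A finite computation, because \<open>P_center U\<close> is a cubic in \<open>p\<close>.
  It inverts the triangular relation between moments and \<open>center_poly\<close>.\<close>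

lemma moment_P_center:
  assumes "n < 4"
  shows "moment n (P_center U) = moment n U"
proof -
  define r where "r = center_poly U"
  define f where "f = (\<lambda>p. r 3 + r 2 * p + r 1 * p^2 / 2 + r 0 * p^3 / 6)"
  have c: "continuous_on {-1..1} f" unfolding f_def by (intro continuous_intros) auto
  have e: "moment m (P_center U) = (if m = 0 then r 2 else if m = 1 then r 3 else 0) -
      integral {0..1} (\<lambda>q. (1 - q)^m / fact m * (f q - (-1)^m * f (- q)))" for m
    unfolding moment_def P_center_eq r_def[symmetric] f_def[symmetric]
    by (intro arg_cong2[where f = "(-)"] integral_cong) (simp_all add: third_def ev_bcf[OF c])
  \<comment> \<open>Evaluation by a primitive \<open>F\<close>, supplied in each case below. For
    even \<open>m\<close> only the odd part of \<open>f\<close> enters and for odd \<open>m\<close>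
    only the even part, hence two coefficients in each primitive.\<close>
  have i: "integral {0..1} (\<lambda>q. (1 - q)^m / fact m * (f q - (-1)^m * f (- q))) = F 1 - F 0"
    if "\<And>q. (F has_real_derivative (1 - q)^m / fact m * (f q - (-1)^m * f (- q))) (at q)" for m F
    by (intro integral_unique fundamental_theorem_of_calculus has_field_derivative_at_within[OF that]
        has_real_derivative_iff_has_vector_derivative[THEN iffD1]) simp
  have "n \<in> {0, 1, 2, 3}" using assms by auto
  then consider "n = 0" | "n = 1" | "n = 2" | "n = 3" by auto
  then show ?thesis
  proof cases
    case 1
    show ?thesis unfolding 1 e
      by (subst i[where F = "\<lambda>q. r 2 * q^2 + r 0 * q^4 / 12"])
         (auto intro!: derivative_eq_intros simp: f_def r_def center_poly_def field_simps eval_nat_numeral)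
  next
    case 2
    show ?thesis unfolding 2 e
      by (subst i[where F = "\<lambda>q. 2 * r 3 * (q - q^2/2) + r 1 * (q^3/3 - q^4/4)"])
         (auto intro!: derivative_eq_intros simp: f_def r_def center_poly_def field_simps eval_nat_numeral)
  next
    case 3
    show ?thesis unfolding 3 e
      by (subst i[where F = "\<lambda>q. r 2 * (q^2/2 - 2*q^3/3 + q^4/4) + r 0 / 6 * (q^4/4 - 2*q^5/5 + q^6/6)"])
         (auto intro!: derivative_eq_intros simp: f_def r_def center_poly_def field_simps eval_nat_numeral)
  next
    case 4
    show ?thesis unfolding 4 e
      by (subst i[where F = "\<lambda>q. r 3 / 3 * (q - 3*q^2/2 + q^3 - q^4/4) + r 1 / 6 * (q^3/3 - 3*q^4/4 + 3*q^5/5 - q^6/6)"])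
         (auto intro!: derivative_eq_intros simp: f_def r_def center_poly_def field_simps eval_nat_numeral)
  qed
qed

text \<open>By the preceding computation \<open>P_h\<close> removes all four moments. Conversely
  \<open>P_center\<close> depends on its argument only through these moments, so an element on which
  they vanish is fixed by \<open>P_h\<close>.\<close>

lemma range_P_h: "U \<in> range P_h \<longleftrightarrow> (\<forall>n<4. moment n U = 0)"
proof
  assume "U \<in> range P_h"
  then show "\<forall>n<4. moment n U = 0"
    by (auto simp: P_h_def moment_diff moment_P_center)
next
  assume *: "\<forall>n<4. moment n U = 0"
  have "center_poly U n = 0" if "n \<in> {0, 1, 2, 3}" for n
    using that * by (auto simp: center_poly_def)
  then have "P_center U = 0"
    unfolding P_center_eq by (auto simp: zero_prod_def bcf_def zero_bcontfun_def)
  then show "U \<in> range P_h" by (intro image_eqI[of _ _ U]) (simp_all add: P_h_def)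
qed

definition h0 :: "real \<Rightarrow> real"
  where "h0 p = 2/5 * p * (1 - 5 * p^2)"

lemma continuous_h0: "continuous_on A h0"
  unfolding h0_def by (intro continuous_intros)

text \<open>Only moment 0 of \<open>(0, - 1, 0)\<close> is nonzero. The term
  \<open>2/5 * moment 0\<close> in \<open>center_poly\<close> is the origin of
  \<open>- 3/5 = - 1 + 2/5\<close>.\<close>

lemma F0_eq: "F0 = (0, - 3/5, bcf h0)"
proof -
  have "moment n (0, - 1, 0) = (if n = 0 then - 1 else 0)" for n
    by (simp add: moment_def third_def)
  then have r: "center_poly (0, - 1, 0) = (\<lambda>n. [12, 0, - 2/5, 0] ! n)"
    by (simp add: center_poly_def)
  have "P_center (0, - 1, 0) = (0, - 2/5, bcf (\<lambda>p. - h0 p))"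
    unfolding P_center_eq r
    by (auto intro!: bcf_cong simp: h0_def eval_nat_numeral field_simps)
  moreover have "0 - bcf (\<lambda>p. - h0 p) = bcf h0"
    by (rule bcontfun_eqI) (simp add: minus_bcontfun.rep_eq apply_bcf continuous_h0 continuous_intros)
  ultimately show ?thesis by (simp add: F0_def P_h_def)
qed

section \<open>The linear inhomogeneous equation: a priori estimates\<close>

abbreviation cmp1 :: "dspace \<Rightarrow> real" where "cmp1 U \<equiv> fst (of_D U)"
abbreviation cmp2 :: "dspace \<Rightarrow> real" where "cmp2 U \<equiv> fst (snd (of_D U))"
abbreviation cmp3 :: "dspace \<Rightarrow> real \<Rightarrow> real" where "cmp3 U \<equiv> ev (third (of_D U))"
abbreviation cmp3_dp :: "dspace \<Rightarrow> real \<Rightarrow> real" where "cmp3_dp U \<equiv> ev (dp (third (of_D U)))"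

lemma cmp3_0: "cmp3 U 0 = cmp1 U"
  using of_D[of U] by (auto simp: dom_L_def third_def split_beta)

lemma cmp3_deriv:
  "-1 \<le> p \<Longrightarrow> p \<le> 1 \<Longrightarrow> (cmp3 U has_real_derivative cmp3_dp U p) (at p within {-1..1})"
  using has_dp_ev[OF has_dp_of_D] by (simp add: has_real_derivative_iff_has_vector_derivative)

lemma L10_eq: "L10 U = (cmp2 U, - 2 * cmp1 U + cmp3 U 1 + cmp3 U (-1), dp (third (of_D U)))"
proof -
  obtain a b c where "of_D U = (a, b, c)" by (metis prod_cases3)
  then show ?thesis by (simp only: L10_def L_op_def third_def prod.case fst_conv snd_conv)
qed

lemma of_D_diff: "of_D (U - V) = of_D U - of_D V"
  unfolding minus_dspace_def plus_dspace.rep_eq of_D_uminus by simp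

lemma third_of_D_diff: "third (of_D (U - V)) = third (of_D U) - third (of_D V)"
  by (simp add: of_D_diff third_def)

lemma dp_third_diff: "dp (third (of_D (U - V))) = dp (third (of_D U)) - dp (third (of_D V))"
  unfolding minus_dspace_def dp_third_plus uminus_dspace_def dp_third_scaleR by simp

lemma L10_diff: "L10 (U - V) = L10 U - L10 V"
  unfolding L10_eq
  unfolding dp_third_diff
  unfolding third_of_D_diff
  unfolding of_D_diff fst_diff snd_diff minus_bcontfun.rep_eq diff_Pair prod.inject
  by (intro conjI refl) (simp add: algebra_simps)

lemma norm_dspace_le_iff:
  "norm (U::dspace) \<le> C \<longleftrightarrow> \<bar>cmp1 U\<bar> \<le> C \<and> \<bar>cmp2 U\<bar> \<le> C \<and>
    (\<forall>p\<in>{-1..1}. \<bar>cmp3 U p\<bar> \<le> C) \<and> (\<forall>p\<in>{-1..1}. \<bar>cmp3_dp U p\<bar> \<le> C)"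
proof -
  have *: "norm f \<le> C \<longleftrightarrow> (\<forall>p\<in>{-1..1}. \<bar>ev f p\<bar> \<le> C)" for f :: "pint \<Rightarrow>\<^sub>C real"
  proof
    show "\<forall>p\<in>{-1..1}. \<bar>ev f p\<bar> \<le> C" if C: "norm f \<le> C"
    proof
      fix p show "\<bar>ev f p\<bar> \<le> C" using order_trans[OF norm_bounded[of f "Pint p"] C] by simp
    qed
    assume a: "\<forall>p\<in>{-1..1}. \<bar>ev f p\<bar> \<le> C"
    show "norm f \<le> C"
    proof (rule norm_bound)
      fix p show "norm (f p) \<le> C" using a[rule_format, of "pval p"] by (simp add: pval_inverse)
    qed
  qed
  show ?thesis by (simp only: norm_dspace_max max.bounded_iff *)
qed

text \<open>\<open>f\<close> stands for the whole scalar source, so that the linear theory covers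
  arbitrary continuous sources and differences of solutions of the nonlinear system.\<close>

definition lin_sol :: "(real \<Rightarrow> real) \<Rightarrow> (real \<Rightarrow> dspace) \<Rightarrow> bool"
  where "lin_sol f u \<longleftrightarrow> continuous_on UNIV f \<and> (\<forall>z. of_D (u z) \<in> range P_h) \<and>
    (\<forall>z. ((\<lambda>z. of_D (u z)) has_vector_derivative L10 (u z) + f z *\<^sub>R F0) (at z))"

lemma lin_sol_diff:
  assumes "lin_sol f u" "lin_sol g w"
  shows "lin_sol (\<lambda>z. f z - g z) (\<lambda>z. u z - w z)"
proof -
  have "((\<lambda>z. of_D (u z - w z)) has_vector_derivative L10 (u z - w z) + (f z - g z) *\<^sub>R F0) (at z)" for z
  proof -
    have "((\<lambda>z. of_D (u z) - of_D (w z)) has_vector_derivative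
        (L10 (u z) + f z *\<^sub>R F0) - (L10 (w z) + g z *\<^sub>R F0)) (at z)"
      using assms by (intro has_vector_derivative_diff) (auto simp: lin_sol_def)
    then show ?thesis unfolding of_D_diff L10_diff
      by (rule has_vector_derivative_eq_rhs) (simp add: algebra_simps)
  qed
  moreover have "of_D (u z - w z) \<in> range P_h" for z
    using assms unfolding lin_sol_def range_P_h by (simp add: of_D_diff moment_diff)
  moreover have "continuous_on UNIV (\<lambda>z. f z - g z)"
    using assms unfolding lin_sol_def by (intro continuous_intros) simp_all
  ultimately show ?thesis unfolding lin_sol_def by blast
qed

lemma lin_sol_components:
  assumes "lin_sol f u"
  shows "((\<lambda>z. cmp1 (u z)) has_real_derivative cmp2 (u z)) (at z)"
    "((\<lambda>z. third (of_D (u z))) has_vector_derivative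
       dp (third (of_D (u z))) + f z *\<^sub>R bcf h0) (at z)"
proof -
  have *: "((\<lambda>z. of_D (u z)) has_vector_derivative L10 (u z) + f z *\<^sub>R F0) (at z)"
    using assms by (simp add: lin_sol_def)
  show "((\<lambda>z. cmp1 (u z)) has_real_derivative cmp2 (u z)) (at z)"
    using bounded_linear.has_vector_derivative[OF bounded_linear_fst *]
    by (simp add: F0_eq L10_eq has_real_derivative_iff_has_vector_derivative)
  show "((\<lambda>z. third (of_D (u z))) has_vector_derivative
       dp (third (of_D (u z))) + f z *\<^sub>R bcf h0) (at z)"
    using bounded_linear.has_vector_derivative[OF bounded_linear_snd
      bounded_linear.has_vector_derivative[OF bounded_linear_snd *]]
    by (simp add: F0_eq L10_eq third_def)
qed

lemma deriv_along_characteristic: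
  fixes W :: "real \<Rightarrow> pint \<Rightarrow>\<^sub>C real"
  assumes W: "(W has_vector_derivative D) (at (z + s))"
    and d: "(ev (W (z + s)) has_real_derivative d) (at (p - s) within {-1..1})"
    and s: "s \<in> {p-1..p+1}"
  shows "((\<lambda>r. ev (W (z + r)) (p - r)) has_real_derivative ev D (p - s) - d) (at s within {p-1..p+1})"
proof -
  let ?S = "{p-1..p+1}"
  let ?R = "\<lambda>r. W (z + r) - W (z + s) - (r - s) *\<^sub>R D"
  have "(W \<circ> (\<lambda>r. z + r) has_vector_derivative 1 *\<^sub>R D) (at s)"
    by (rule vector_diff_chain_at) (auto intro!: derivative_eq_intros W)
  then have "((\<lambda>r. W (z + r)) has_vector_derivative D) (at s within ?S)"
    by (auto simp: o_def intro: has_vector_derivative_at_within)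
  then have lim: "((\<lambda>r. norm (?R r) / norm (r - s)) \<longlongrightarrow> 0) (at s within ?S)"
    by (simp add: has_vector_derivative_def has_derivative_iff_norm)
  \<comment> \<open>The remainder is small in the sup norm, hence also at the moving point
    \<open>p - r\<close>.\<close>
  have A: "((\<lambda>r. ev (?R r) (p - r)) has_derivative (\<lambda>_. 0)) (at s within ?S)"
  proof (rule has_derivativeI_sandwich[OF zero_less_one _ _ lim])
    fix r
    have "norm (ev (?R r) (p - r) - ev (?R s) (p - s) - 0) \<le> norm (?R r)"
      using norm_bounded[of "?R r"] by simp
    then show "norm (ev (?R r) (p - r) - ev (?R s) (p - s) - 0) / norm (r - s)
       \<le> norm (?R r) / norm (r - s)"
      by (rule divide_right_mono) simp
  qed simp
  have B: "((\<lambda>r. ev (W (z + s)) (p - r)) has_derivative (*) (- d)) (at s within ?S)"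
  proof -
    have "((\<lambda>r. ev (W (z + s)) (p - r)) has_field_derivative d * (0 - 1)) (at s within ?S)"
      using DERIV_image_chain[OF DERIV_subset[OF d, of "(\<lambda>r. p - r) ` ?S"],
        OF _ DERIV_diff[OF DERIV_const DERIV_ident]] by (force simp: o_def)
    then show ?thesis by (simp add: has_field_derivative_def)
  qed
  \<comment> \<open>Continuity of \<open>D\<close> in \<open>p\<close> is enough here, since the
    factor \<open>r - s\<close> vanishes at \<open>s\<close>.\<close>
  have C: "((\<lambda>r. (r - s) * ev D (p - r)) has_derivative (\<lambda>h. h * ev D (p - s))) (at s within ?S)"
  proof -
    have "continuous_on ?S (\<lambda>r. ev D (p - r))"
      by (rule continuous_on_compose2[OF continuous_on_ev]) (auto intro!: continuous_intros)
    then have "((\<lambda>r. ev D (p - r)) \<longlongrightarrow> ev D (p - s)) (at s within ?S)"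
      using s by (auto simp: continuous_on_def)
    then have "((\<lambda>r. (r - s) * ev D (p - r)) has_field_derivative ev D (p - s)) (at s within ?S)"
      unfolding has_field_derivative_iff
      by (rule Lim_transform_eventually) (auto simp: eventually_at_filter)
    then show ?thesis by (simp add: has_field_derivative_def mult.commute[of _ "ev D (p - s)"])
  qed
  have "((\<lambda>r. ev (?R r) (p - r) + ev (W (z + s)) (p - r) + (r - s) * ev D (p - r))
      has_derivative (\<lambda>h. 0 + (- d) * h + h * ev D (p - s))) (at s within ?S)"
    by (intro has_derivative_add A B C)
  moreover have "(\<lambda>h. 0 + (- d) * h + h * ev D (p - s)) = (*) (ev D (p - s) - d)"
    by (simp add: fun_eq_iff algebra_simps)
  ultimately show ?thesis
    by (simp add: has_field_derivative_def minus_bcontfun.rep_eq scaleR_bcontfun.rep_eq)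
qed

text \<open>Along \<open>(z + r, p - r)\<close> the derivative in \<open>p\<close> coming from the
  equation cancels against that of the moving point, and only the source is left.\<close>

lemma lin_sol_characteristic:
  assumes u: "lin_sol f u" and s: "s \<in> {p-1..p+1}"
  shows "((\<lambda>r. cmp3 (u (z + r)) (p - r)) has_real_derivative f (z + s) * h0 (p - s))
    (at s within {p-1..p+1})"
proof -
  have p: "-1 \<le> p - s" "p - s \<le> 1" using s by auto
  show ?thesis
    using deriv_along_characteristic[OF lin_sol_components(2)[OF u] cmp3_deriv[OF p] s]
    by (simp add: plus_bcontfun.rep_eq scaleR_bcontfun.rep_eq ev_bcf[OF continuous_h0] p)
qed

section \<open>Estimates on a time window of radius 1\<close>

lemma abs_h0_le: "-1 \<le> p \<Longrightarrow> p \<le> 1 \<Longrightarrow> \<bar>h0 p\<bar> \<le> 2"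
proof -
  assume "-1 \<le> p" "p \<le> 1"
  then have p: "\<bar>p\<bar> \<le> 1" "p^2 \<le> 1" "0 \<le> p^2" by (auto simp: abs_square_le_1)
  then have "\<bar>p\<bar> * \<bar>1 - 5 * p^2\<bar> \<le> 1 * 4"
    by (intro mult_mono) (auto simp: abs_le_iff intro: order_trans[of _ 0])
  then show ?thesis by (simp add: h0_def abs_mult)
qed

lemma h0_lipschitz:
  assumes "p \<in> {-1..1}" "q \<in> {-1..1}"
  shows "\<bar>h0 p - h0 q\<bar> \<le> 6 * \<bar>p - q\<bar>"
proof -
  have "norm (h0 p - h0 q) \<le> 6 * norm (p - q)"
  proof (rule field_differentiable_bound[where S = "{-1..1}" and f' = "\<lambda>p. 2/5 - 6 * p^2"])
    show "(h0 has_field_derivative 2/5 - 6 * p^2) (at p within {-1..1})" for p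
      unfolding h0_def by (auto intro!: derivative_eq_intros simp: power2_eq_square field_simps)
    show "norm (2/5 - 6 * p^2) \<le> 6" if "p \<in> {-1..1}" for p :: real
    proof -
      have "p^2 \<le> 1" "0 \<le> p^2" using that by (auto simp: abs_square_le_1)
      then show ?thesis unfolding real_norm_def by linarith
    qed
  qed (use assms in auto)
  then show ?thesis by simp
qed

context
  fixes f u z F
  assumes u: "lin_sol f u" and f: "\<And>s. s \<in> {z-1..z+1} \<Longrightarrow> \<bar>f s\<bar> \<le> F"
begin

lemma f_bound_nonneg: "0 \<le> F"
  using f[of z] by auto

text \<open>The characteristic through \<open>(z, p)\<close> meets \<open>p = 0\<close> at time
  \<open>z + p\<close>, where \<psi>3 equals \<psi>1. It lasts at most one unit of time and
  \<open>\<bar>h0\<bar> \<le> 2\<close>, so only the window around \<open>z\<close> matters.\<close>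

lemma lin_sol_transport:
  assumes p: "p \<in> {-1..1}"
  shows "\<bar>cmp3 (u z) p - cmp1 (u (z + p))\<bar> \<le> 2 * F"
proof -
  have "norm (cmp3 (u (z + 0)) (p - 0) - cmp3 (u (z + p)) (p - p)) \<le> (2 * F) * norm (0 - p)"
  proof (rule field_differentiable_bound[where S = "closed_segment 0 p"
        and f' = "\<lambda>s. f (z + s) * h0 (p - s)" and f = "\<lambda>s. cmp3 (u (z + s)) (p - s)"])
    fix s assume s: "s \<in> closed_segment 0 p"
    then have s': "s \<in> {p-1..p+1}" "\<bar>s\<bar> \<le> 1" "p - s \<in> {-1..1}"
      using p by (auto simp: closed_segment_eq_real_ivl split: if_splits)
    show "((\<lambda>s. cmp3 (u (z + s)) (p - s)) has_field_derivative f (z + s) * h0 (p - s))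
        (at s within closed_segment 0 p)"
      by (rule DERIV_subset[OF lin_sol_characteristic[OF u s'(1)]])
         (use p in \<open>auto simp: closed_segment_eq_real_ivl split: if_splits\<close>)
    have "\<bar>f (z + s)\<bar> * \<bar>h0 (p - s)\<bar> \<le> F * 2"
      using s' f_bound_nonneg by (intro mult_mono f abs_h0_le) auto
    then show "norm (f (z + s) * h0 (p - s)) \<le> 2 * F" by (simp add: abs_mult)
  qed auto
  also have "\<dots> \<le> (2 * F) * 1"
    using p f_bound_nonneg by (intro mult_left_mono) auto
  finally show ?thesis by (simp add: cmp3_0)
qed

text \<open>This bounds the derivative in \<open>p\<close> without differentiating \<open>f\<close>.
  Carrying both points for the same time \<open>p\<close> costs \<open>6 * F\<close>, by the
  Lipschitz constant of \<open>h0\<close>; the point then left at \<open>q - p\<close> reaches the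
  axis at the cost of \<open>2 * F\<close>; the remaining difference of \<psi>1 at the times
  \<open>z + q\<close> and \<open>z + p\<close> costs \<open>Y\<close>. All three are multiplied by
  \<open>\<bar>q - p\<bar>\<close>. The condition that this is at most 1 keeps the companion
  characteristic within the strip.\<close>

lemma lin_sol_increment:
  assumes Y: "\<And>s. s \<in> {z-1..z+1} \<Longrightarrow> \<bar>cmp2 (u s)\<bar> \<le> Y"
    and p: "p \<in> {-1..1}" and q: "q \<in> {-1..1}" and pq: "\<bar>q - p\<bar> \<le> 1"
  shows "\<bar>cmp3 (u z) q - cmp3 (u z) p\<bar> \<le> (Y + 8 * F) * \<bar>q - p\<bar>"
proof -
  let ?d = "q - p"
  note F0 = f_bound_nonneg
  let ?e = "\<lambda>s. cmp3 (u (z + s)) (q - s) - cmp3 (u (z + s)) (p - s)"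
  have "norm (?e 0 - ?e p) \<le> (6 * F * \<bar>?d\<bar>) * norm (0 - p)"
  proof (rule field_differentiable_bound[where S = "closed_segment 0 p"
        and f' = "\<lambda>s. f (z + s) * h0 (q - s) - f (z + s) * h0 (p - s)"])
    fix s assume s: "s \<in> closed_segment 0 p"
    then have s': "s \<in> {p-1..p+1}" "s \<in> {q-1..q+1}" "\<bar>s\<bar> \<le> 1" "p - s \<in> {-1..1}" "q - s \<in> {-1..1}"
      using p q pq by (auto simp: closed_segment_eq_real_ivl abs_le_iff split: if_splits)
    have "closed_segment 0 p \<subseteq> {q-1..q+1}" "closed_segment 0 p \<subseteq> {p-1..p+1}"
      using p q pq by (auto simp: closed_segment_eq_real_ivl split: if_splits)
    then show "(?e has_field_derivative f (z + s) * h0 (q - s) - f (z + s) * h0 (p - s))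
        (at s within closed_segment 0 p)"
      by (intro DERIV_diff DERIV_subset[OF lin_sol_characteristic[OF u s'(1)]]
        DERIV_subset[OF lin_sol_characteristic[OF u s'(2)]])
    have "\<bar>f (z + s)\<bar> * \<bar>h0 (q - s) - h0 (p - s)\<bar> \<le> F * (6 * \<bar>(q - s) - (p - s)\<bar>)"
      using s' F0 by (intro mult_mono f h0_lipschitz) auto
    then show "norm (f (z + s) * h0 (q - s) - f (z + s) * h0 (p - s)) \<le> 6 * F * \<bar>?d\<bar>"
      by (simp add: abs_mult right_diff_distrib[symmetric] mult.assoc mult.left_commute)
  qed auto
  also have "\<dots> \<le> (6 * F * \<bar>?d\<bar>) * 1"
    using p F0 by (intro mult_left_mono) auto
  finally have 1: "\<bar>?e 0 - ?e p\<bar> \<le> 6 * F * \<bar>?d\<bar>" by simp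
  let ?c = "\<lambda>s. cmp3 (u ((z + p) + s)) (?d - s)"
  have "norm (?c 0 - ?c ?d) \<le> (2 * F) * norm (0 - ?d)"
  proof (rule field_differentiable_bound[where S = "closed_segment 0 ?d"
        and f' = "\<lambda>s. f ((z + p) + s) * h0 (?d - s)"])
    fix s assume s: "s \<in> closed_segment 0 ?d"
    then have s': "s \<in> {?d-1..?d+1}" "p + s \<in> {-1..1}" "?d - s \<in> {-1..1}"
      using p q pq by (auto simp: closed_segment_eq_real_ivl split: if_splits)
    show "(?c has_field_derivative f ((z + p) + s) * h0 (?d - s)) (at s within closed_segment 0 ?d)"
      by (rule DERIV_subset[OF lin_sol_characteristic[OF u s'(1)]])
         (use p q pq in \<open>auto simp: closed_segment_eq_real_ivl split: if_splits\<close>)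
    have "\<bar>f ((z + p) + s)\<bar> * \<bar>h0 (?d - s)\<bar> \<le> F * 2"
      using s' F0 by (intro mult_mono f abs_h0_le) auto
    then show "norm (f ((z + p) + s) * h0 (?d - s)) \<le> 2 * F" by (simp add: abs_mult)
  qed auto
  then have 2: "\<bar>cmp3 (u (z + p)) ?d - cmp1 (u (z + q))\<bar> \<le> 2 * F * \<bar>?d\<bar>"
    by (simp add: cmp3_0 abs_minus_commute)
  have "norm (cmp1 (u (z + q)) - cmp1 (u (z + p))) \<le> Y * norm ((z + q) - (z + p))"
  proof (rule field_differentiable_bound[where S = "{z-1..z+1}" and f' = "\<lambda>s. cmp2 (u s)"])
    show "((\<lambda>z. cmp1 (u z)) has_field_derivative cmp2 (u s)) (at s within {z-1..z+1})" for s
      by (rule has_field_derivative_at_within[OF lin_sol_components(1)[OF u]])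
  qed (use Y p q in auto)
  then have 3: "\<bar>cmp1 (u (z + q)) - cmp1 (u (z + p))\<bar> \<le> Y * \<bar>?d\<bar>" by simp
  have "\<bar>cmp3 (u z) q - cmp3 (u z) p\<bar> \<le> 6 * F * \<bar>?d\<bar> + 2 * F * \<bar>?d\<bar> + Y * \<bar>?d\<bar>"
    using 1 2 3 by (simp add: cmp3_0)
  then show ?thesis by (simp add: algebra_simps)
qed

end

lemma deriv_le_lipschitz:
  fixes g :: "real \<Rightarrow> real"
  assumes g: "(g has_real_derivative d) (at x within {a..b})" and x: "x \<in> {a..b}" "a < b"
    and L: "\<And>y. y \<in> {a..b} \<Longrightarrow> \<bar>y - x\<bar> \<le> 1 \<Longrightarrow> \<bar>g y - g x\<bar> \<le> L * \<bar>y - x\<bar>"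
  shows "\<bar>d\<bar> \<le> L"
proof (rule tendsto_upperbound)
  show "((\<lambda>y. \<bar>(g y - g x) / (y - x)\<bar>) \<longlongrightarrow> \<bar>d\<bar>) (at x within {a..b})"
    using g by (intro tendsto_rabs) (simp add: has_field_derivative_iff)
  show "\<forall>\<^sub>F y in at x within {a..b}. \<bar>(g y - g x) / (y - x)\<bar> \<le> L"
    unfolding eventually_at
  proof (intro exI[of _ 1] conjI ballI impI)
    fix y assume y: "y \<in> {a..b}" "y \<noteq> x \<and> dist y x < 1"
    then have "\<bar>g y - g x\<bar> \<le> L * \<bar>y - x\<bar>" by (intro L) (auto simp: dist_real_def)
    then show "\<bar>(g y - g x) / (y - x)\<bar> \<le> L" using y by (simp add: field_simps)
  qed simp
  show "at x within {a..b} \<noteq> bot"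
    using x by (simp add: trivial_limit_within islimpt_Icc)
qed

section \<open>The averaging kernel and the decay of bounds\<close>

definition kerB :: "real \<Rightarrow> real"
  where "kerB q = (1 - q) - (1 - q)^3 / 6"

text \<open>Since the kernel has one sign, the sup norm of the averaging operator is controlled by
  its mass, \<open>11/24\<close> on each of the two sides \<open>q\<close> and
  \<open>- q\<close>.\<close>

lemma kerB_nonneg: "0 \<le> q \<Longrightarrow> q \<le> 1 \<Longrightarrow> 0 \<le> kerB q"
proof -
  assume q: "0 \<le> q" "q \<le> 1"
  then have "(1 - q)^3 \<le> (1 - q)^1" by (intro power_decreasing) auto
  then show ?thesis using q by (simp add: kerB_def)
qed

lemma integral_kerB: "(kerB has_integral 11/24) {0..1}"
proof -
  have "(kerB has_integral (((1 - 1)^4/24 - (1 - 1)^2/2) - ((1 - 0)^4/24 - (1 - 0)^2/2))) {0..1::real}"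
    by (rule fundamental_theorem_of_calculus)
       (auto intro!: derivative_eq_intros simp: kerB_def field_simps simp flip: has_real_derivative_iff_has_vector_derivative)
  then show ?thesis by simp
qed

lemma continuous_kerB [continuous_intros]: "continuous_on A kerB"
  unfolding kerB_def by (intro continuous_intros) auto

lemma abs_integral_kerB_le:
  assumes c: "continuous_on {0..1} w" and W: "\<And>q. q \<in> {0..1} \<Longrightarrow> \<bar>w q\<bar> \<le> W"
  shows "\<bar>integral {0..1} (\<lambda>q. kerB q * w q)\<bar> \<le> 11/24 * W"
proof -
  have "norm (integral {0..1} (\<lambda>q. kerB q * w q)) \<le> integral {0..1} (\<lambda>q. kerB q * W)"
    by (rule integral_norm_bound_integral)
       (auto intro!: integrable_continuous_real continuous_intros c mult_left_mono kerB_nonneg W simp: abs_mult kerB_nonneg)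
  also have "\<dots> = 11/24 * W"
    using has_integral_mult_left[OF integral_kerB, of W] by (intro integral_unique)
  finally show ?thesis by simp
qed

text \<open>The combination of the moments 1 and 3 expresses \<open>\<psi>\<^sub>1\<close> by \<open>\<psi>\<^sub>3\<close> with a kernel of mass
  \<open>11/12 < 1\<close>; this is what makes the hyperbolic part contractive.\<close>

lemma cmp1_eq_integral_kerB:
  assumes "of_D U \<in> range P_h"
  shows "cmp1 U = integral {0..1} (\<lambda>q. kerB q * (cmp3 U q + cmp3 U (- q)))"
proof -
  have m: "moment 1 (of_D U) = 0" "moment 3 (of_D U) = 0"
    using assms by (auto simp: range_P_h)
  have "integral {0..1} (\<lambda>q. kerB q * (cmp3 U q + cmp3 U (- q)))
      = integral {0..1} (\<lambda>q. (1 - q)^1 / fact 1 * (cmp3 U q - (-1)^1 * cmp3 U (- q))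
        - (1 - q)^3 / fact 3 * (cmp3 U q - (-1)^3 * cmp3 U (- q)))"
    by (intro integral_cong) (simp add: kerB_def eval_nat_numeral algebra_simps)
  also have "\<dots> = integral {0..1} (\<lambda>q. (1 - q)^1 / fact 1 * (cmp3 U q - (-1)^1 * cmp3 U (- q)))
      - integral {0..1} (\<lambda>q. (1 - q)^3 / fact 3 * (cmp3 U q - (-1)^3 * cmp3 U (- q)))"
    by (intro Henstock_Kurzweil_Integration.integral_diff integrable_continuous_real continuous_intros) auto
  finally show ?thesis using m by (simp add: moment_def)
qed

lemma cmp2_eq_integral:
  assumes "of_D U \<in> range P_h"
  shows "cmp2 U = integral {0..1} (\<lambda>q. cmp3 U q - cmp3 U (- q))"
  using assms by (auto simp: range_P_h moment_def dest!: spec[of _ 0])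

text \<open>One round of the contraction: a bound on \<psi>1 over the window travels to \<psi>3
  along characteristics, and averaging returns it to \<psi>1 at the centre with the factor
  \<open>11/12\<close>.\<close>

lemma lin_sol_step1:
  assumes u: "lin_sol f u" and f: "\<And>s. s \<in> {z-1..z+1} \<Longrightarrow> \<bar>f s\<bar> \<le> F"
    and X: "\<And>s. s \<in> {z-1..z+1} \<Longrightarrow> \<bar>cmp1 (u s)\<bar> \<le> X"
  shows "\<And>p. p \<in> {-1..1} \<Longrightarrow> \<bar>cmp3 (u z) p\<bar> \<le> X + 2 * F"
    "\<bar>cmp1 (u z)\<bar> \<le> 11/12 * (X + 2 * F)" "\<bar>cmp2 (u z)\<bar> \<le> 2 * (X + 2 * F)"
proof -
  show v: "\<bar>cmp3 (u z) p\<bar> \<le> X + 2 * F" if "p \<in> {-1..1}" for p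
    using lin_sol_transport[OF u f that] X[of "z + p"] that by force
  have r: "of_D (u z) \<in> range P_h" using u by (simp add: lin_sol_def)
  have "\<bar>cmp1 (u z)\<bar> \<le> 11/24 * (2 * (X + 2 * F))"
    unfolding cmp1_eq_integral_kerB[OF r]
  proof (rule abs_integral_kerB_le)
    fix q :: real assume "q \<in> {0..1}"
    then show "\<bar>cmp3 (u z) q + cmp3 (u z) (- q)\<bar> \<le> 2 * (X + 2 * F)"
      using v[of q] v[of "-q"] by auto
  qed (intro continuous_intros)
  then show "\<bar>cmp1 (u z)\<bar> \<le> 11/12 * (X + 2 * F)" by simp
  have "norm (cmp2 (u z)) \<le> integral {0..1::real} (\<lambda>q. 2 * (X + 2 * F))"
    unfolding cmp2_eq_integral[OF r]
  proof (rule integral_norm_bound_integral)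
    fix q :: real assume "q \<in> {0..1}"
    then show "norm (cmp3 (u z) q - cmp3 (u z) (- q)) \<le> 2 * (X + 2 * F)"
      using v[of q] v[of "-q"] by auto
  qed (intro integrable_continuous_real continuous_intros)+
  then show "\<bar>cmp2 (u z)\<bar> \<le> 2 * (X + 2 * F)" by simp
qed

lemma lin_sol_step2:
  assumes u: "lin_sol f u" and f: "\<And>s. s \<in> {z-1..z+1} \<Longrightarrow> \<bar>f s\<bar> \<le> F"
    and Y: "\<And>s. s \<in> {z-1..z+1} \<Longrightarrow> \<bar>cmp2 (u s)\<bar> \<le> Y" and p: "p \<in> {-1..1}"
  shows "\<bar>cmp3_dp (u z) p\<bar> \<le> Y + 8 * F"
  by (rule deriv_le_lipschitz[OF cmp3_deriv])
     (use p in \<open>auto intro!: lin_sol_increment[OF u f Y p]\<close>)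

text \<open>Working with \<open>top\<close>, \<open>at_top\<close> and \<open>at_bot\<close> at once yields uniqueness, the norm bound and the
  asymptotics from one estimate.\<close>

definition shift_stable :: "real filter \<Rightarrow> bool"
  where "shift_stable X \<longleftrightarrow>
    (\<forall>P. eventually P X \<longrightarrow> eventually (\<lambda>z. \<forall>s\<in>{z-1..z+1}. P s) X)"

lemma shift_stable_filters: "shift_stable top" "shift_stable at_top" "shift_stable at_bot"
  unfolding shift_stable_def
proof (safe)
  fix P :: "real \<Rightarrow> bool"
  show "eventually (\<lambda>z. \<forall>s\<in>{z-1..z+1}. P s) at_top" if P: "eventually P at_top"
  proof -
    obtain N where "\<And>z. z \<ge> N \<Longrightarrow> P z" using P by (auto simp: eventually_at_top_linorder)
    then show ?thesis by (auto simp: eventually_at_top_linorder intro!: exI[of _ "N + 1"])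
  qed
  show "eventually (\<lambda>z. \<forall>s\<in>{z-1..z+1}. P s) at_bot" if P: "eventually P at_bot"
  proof -
    obtain N where "\<And>z. z \<le> N \<Longrightarrow> P z" using P by (auto simp: eventually_at_bot_linorder)
    then show ?thesis by (auto simp: eventually_at_bot_linorder intro!: exI[of _ "N - 1"])
  qed
qed simp

text \<open>The affine map \<open>X \<mapsto> q * X + (1 - q) * c\<close> has the fixed point
  \<open>c\<close>, and \<open>n\<close> rounds starting from \<open>A\<close> give
  \<open>c + q ^ n * (A - c)\<close>. The slack \<open>\<eta>\<close> allows stopping after finitely
  many rounds, as a filter need not be closed under infinite intersections.\<close>

lemma eventually_le_iterate:
  fixes x :: "'a \<Rightarrow> real"
  assumes init: "eventually (\<lambda>z. x z \<le> A) \<X>" and q: "0 \<le> q" "q < 1"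
    and step: "\<And>X. eventually (\<lambda>z. x z \<le> X) \<X> \<Longrightarrow> eventually (\<lambda>z. x z \<le> q * X + (1 - q) * c) \<X>"
    and "\<eta> > 0"
  shows "eventually (\<lambda>z. x z \<le> c + \<eta>) \<X>"
proof -
  have it: "eventually (\<lambda>z. x z \<le> c + q ^ n * (A - c)) \<X>" for n
  proof (induction n)
    case (Suc n)
    from step[OF this] show ?case by (rule eventually_mono) (simp add: algebra_simps)
  qed (use init in simp)
  have "(\<lambda>n. q ^ n * (A - c)) \<longlonglongrightarrow> 0 * (A - c)"
    using q by (intro tendsto_intros LIMSEQ_power_zero) auto
  then have "eventually (\<lambda>n. q ^ n * (A - c) < \<eta>) sequentially"
    using \<open>\<eta> > 0\<close> by (intro order_tendstoD(2)) auto
  then obtain n where "q ^ n * (A - c) < \<eta>" by (auto simp: eventually_sequentially)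
  then show ?thesis by (intro eventually_mono[OF it[of n]]) auto
qed

text \<open>The constants: \<open>22 * F\<close> is the fixed point of
  \<open>X \<mapsto> 11/12 * (X + 2 * F)\<close>; \<psi>3 adds \<open>2 * F\<close>, giving
  \<open>24 * F\<close>; \<psi>2 integrates a difference of two such values, giving
  \<open>48 * F\<close>; the derivative in \<open>p\<close> adds \<open>8 * F\<close>. The global
  bound \<open>X0\<close> only starts the iteration and is absent from the result.\<close>

lemma lin_sol_estimate:
  assumes u: "lin_sol f u" and bdd: "\<And>z. \<bar>cmp1 (u z)\<bar> \<le> X0" and \<X>: "shift_stable \<X>"
    and f: "eventually (\<lambda>z. \<bar>f z\<bar> \<le> F) \<X>" and "\<eta> > 0"
  shows "eventually (\<lambda>z. norm (u z) \<le> 56 * F + \<eta>) \<X>"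
proof -
  have sh: "eventually P \<X> \<Longrightarrow> eventually (\<lambda>z. \<forall>s\<in>{z-1..z+1}. P s) \<X>" for P
    using \<X> by (auto simp: shift_stable_def)
  note f' = sh[OF f]
  have x: "eventually (\<lambda>z. \<bar>cmp1 (u z)\<bar> \<le> 22 * F + \<eta> / 2) \<X>"
  proof (rule eventually_le_iterate[where q = "11/12" and A = X0])
    fix X assume "eventually (\<lambda>z. \<bar>cmp1 (u z)\<bar> \<le> X) \<X>"
    from sh[OF this] f' show "eventually (\<lambda>z. \<bar>cmp1 (u z)\<bar> \<le> 11/12 * X + (1 - 11/12) * (22 * F)) \<X>"
    proof eventually_elim
      case (elim z)
      then have "\<bar>cmp1 (u z)\<bar> \<le> 11/12 * (X + 2 * F)" by (intro lin_sol_step1(2)[OF u]) auto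
      then show ?case by simp
    qed
  qed (use bdd \<open>\<eta> > 0\<close> in auto)
  have y: "eventually (\<lambda>z. \<bar>cmp2 (u z)\<bar> \<le> 48 * F + \<eta> \<and>
      (\<forall>p\<in>{-1..1}. \<bar>cmp3 (u z) p\<bar> \<le> 24 * F + \<eta> / 2)) \<X>"
    using sh[OF x] f'
  proof eventually_elim
    case (elim z)
    then have "\<bar>cmp2 (u z)\<bar> \<le> 2 * ((22 * F + \<eta> / 2) + 2 * F)"
      by (intro lin_sol_step1(3)[OF u]) auto
    moreover have "\<bar>cmp3 (u z) p\<bar> \<le> (22 * F + \<eta> / 2) + 2 * F" if "p \<in> {-1..1}" for p
      using elim that by (intro lin_sol_step1(1)[OF u]) auto
    ultimately show ?case by simp
  qed
  show ?thesis using x y sh[OF y] f'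
  proof eventually_elim
    case (elim z)
    from elim(4) have "\<bar>f z\<bar> \<le> F" by simp
    then have F: "0 \<le> F" by linarith
    have "\<bar>cmp3_dp (u z) p\<bar> \<le> (48 * F + \<eta>) + 8 * F" if "p \<in> {-1..1}" for p
      using elim(3,4) by (intro lin_sol_step2[OF u _ _ that]) auto
    then have v': "\<forall>p\<in>{-1..1}. \<bar>cmp3_dp (u z) p\<bar> \<le> 56 * F + \<eta>" by simp
    have "\<bar>cmp3 (u z) p\<bar> \<le> 56 * F + \<eta>" if "p \<in> {-1..1}" for p
      using bspec[OF conjunct2[OF elim(2)] that] F \<open>\<eta> > 0\<close> by linarith
    moreover have "\<bar>cmp1 (u z)\<bar> \<le> 56 * F + \<eta>" "\<bar>cmp2 (u z)\<bar> \<le> 56 * F + \<eta>"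
      using elim(1) conjunct1[OF elim(2)] F \<open>\<eta> > 0\<close> by linarith+
    ultimately show ?case unfolding norm_dspace_le_iff using v' by blast
  qed
qed

section \<open>The linear inhomogeneous equation: existence\<close>

lemma antiderivative_exists:
  fixes f :: "real \<Rightarrow> real"
  assumes "continuous_on UNIV f"
  shows "\<exists>F. \<forall>z. (F has_real_derivative f z) (at z)"
proof -
  have "\<exists>F. \<forall>z::real. -\<infinity> < ereal z \<longrightarrow> ereal z < \<infinity> \<longrightarrow> (F has_vector_derivative f z) (at z)"
    using assms by (intro einterval_antiderivative) (auto simp: continuous_on_eq_continuous_at)
  then show ?thesis
    by (auto simp: has_real_derivative_iff_has_vector_derivative)
qed

section \<open>Function-valued curves given by functions of two variables\<close>

lemma norm_bcont_leI:
  fixes f :: "pint \<Rightarrow>\<^sub>C real"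
  assumes "\<And>p. p \<in> {-1..1} \<Longrightarrow> \<bar>ev f p\<bar> \<le> e"
  shows "norm f \<le> e"
proof (rule norm_bound)
  fix p show "norm (f p) \<le> e" using assms[of "pval p"] by (simp add: pval_inverse)
qed

lemma continuous_on_slice:
  assumes "continuous_on (UNIV \<times> S) (\<lambda>(z, p). V z p)"
  shows "continuous_on S (V z)"
proof -
  have "continuous_on S (\<lambda>p. (z, p))" by (intro continuous_intros)
  from continuous_on_compose2[OF assms this] show ?thesis by auto
qed

text \<open>Compactness of \<open>{-1..1}\<close> makes the continuity in \<open>z\<close> uniform
  in \<open>p\<close>.\<close>

lemma continuous_bcf_curve:
  fixes V :: "real \<Rightarrow> real \<Rightarrow> real"
  assumes c: "continuous_on (UNIV \<times> {-1..1}) (\<lambda>(z, p). V z p)"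
  shows "continuous_on UNIV (\<lambda>z. bcf (V z))"
  unfolding continuous_on_def
proof
  fix z0 :: real
  show "((\<lambda>z. bcf (V z)) \<longlongrightarrow> bcf (V z0)) (at z0 within UNIV)"
    unfolding tendsto_iff
  proof (intro allI impI)
    fix e :: real assume "e > 0"
    then have e2: "e / 2 > 0" by simp
    obtain A where A: "z0 \<in> A" "open A" and
      "\<forall>z\<in>A \<inter> UNIV. \<forall>p\<in>{-1..1}. dist (case (z, p) of (z, p) \<Rightarrow> V z p) (case (z0, p) of (z, p) \<Rightarrow> V z p) \<le> e / 2"
      by (rule continuous_on_prod_compactE[OF c compact_Icc UNIV_I[of z0] e2])
    then have A3: "\<And>z p. z \<in> A \<Longrightarrow> p \<in> {-1..1} \<Longrightarrow> dist (V z p) (V z0 p) \<le> e / 2" by simp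
    have "dist (bcf (V z)) (bcf (V z0)) < e" if "z \<in> A" for z
    proof -
      have "norm (bcf (V z) - bcf (V z0)) \<le> e / 2"
        by (rule norm_bcont_leI)
           (use A3[OF that] in \<open>simp add: minus_bcontfun.rep_eq ev_bcf continuous_on_slice[OF c] dist_real_def\<close>)
      then show ?thesis using \<open>e > 0\<close> by (simp add: dist_norm)
    qed
    then show "\<forall>\<^sub>F z in at z0 within UNIV. dist (bcf (V z)) (bcf (V z0)) < e"
      using A(1,2) by (auto simp: eventually_at_topological)
  qed
qed

text \<open>The mean value inequality for \<open>V z p - z * V' z0 p\<close> bounds the Taylor
  remainder by the oscillation of \<open>V'\<close> in time, which by compactness is small uniformly
  in \<open>p\<close>.\<close>

lemma deriv_bcf_curve:
  fixes V V' :: "real \<Rightarrow> real \<Rightarrow> real"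
  assumes c: "continuous_on (UNIV \<times> {-1..1}) (\<lambda>(z, p). V z p)"
    and c': "continuous_on (UNIV \<times> {-1..1}) (\<lambda>(z, p). V' z p)"
    and d: "\<And>z p. p \<in> {-1..1} \<Longrightarrow> ((\<lambda>z. V z p) has_real_derivative V' z p) (at z)"
  shows "((\<lambda>z. bcf (V z)) has_vector_derivative bcf (V' z0)) (at z0)"
  unfolding has_vector_derivative_def has_derivative_at_alt
proof (intro conjI allI impI)
  fix e :: real assume e: "e > 0"
  obtain A where A: "z0 \<in> A" "open A" and
    "\<forall>z\<in>A \<inter> UNIV. \<forall>p\<in>{-1..1}. dist (case (z, p) of (z, p) \<Rightarrow> V' z p) (case (z0, p) of (z, p) \<Rightarrow> V' z p) \<le> e"
    by (rule continuous_on_prod_compactE[OF c' compact_Icc UNIV_I[of z0] e])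
  then have A3: "\<And>z p. z \<in> A \<Longrightarrow> p \<in> {-1..1} \<Longrightarrow> dist (V' z p) (V' z0 p) \<le> e" by simp
  from A obtain r where r: "r > 0" "ball z0 r \<subseteq> A" using open_contains_ball by blast
  have "norm (bcf (V z) - bcf (V z0) - (z - z0) *\<^sub>R bcf (V' z0)) \<le> e * norm (z - z0)"
    if z: "norm (z - z0) < r" for z
  proof (rule norm_bcont_leI)
    fix p :: real assume p: "p \<in> {-1..1}"
    have "norm ((V z p - z * V' z0 p) - (V z0 p - z0 * V' z0 p)) \<le> e * norm (z - z0)"
    proof (rule field_differentiable_bound[where S = "ball z0 r" and f' = "\<lambda>s. V' s p - V' z0 p"])
      show "((\<lambda>z. V z p - z * V' z0 p) has_field_derivative V' s p - V' z0 p) (at s within ball z0 r)" for s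
        by (auto intro!: derivative_eq_intros has_field_derivative_at_within[OF d[OF p]])
      show "norm (V' s p - V' z0 p) \<le> e" if "s \<in> ball z0 r" for s
        using A3[of s p] r(2) that p by (auto simp: dist_real_def)
    qed (use r z in \<open>auto simp: dist_norm norm_minus_commute\<close>)
    then show "\<bar>ev (bcf (V z) - bcf (V z0) - (z - z0) *\<^sub>R bcf (V' z0)) p\<bar> \<le> e * norm (z - z0)"
      using p by (simp add: minus_bcontfun.rep_eq scaleR_bcontfun.rep_eq ev_bcf
          continuous_on_slice[OF c] continuous_on_slice[OF c'] algebra_simps)
  qed
  then show "\<exists>d>0. \<forall>y. norm (y - z0) < d \<longrightarrow>
      norm (bcf (V y) - bcf (V z0) - (y - z0) *\<^sub>R bcf (V' z0)) \<le> e * norm (y - z0)"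
    using r(1) by blast
qed (rule bounded_linear_scaleR_left)

lemma bounded_exponential_eq_0:
  fixes a :: "real \<Rightarrow> real"
  assumes d: "\<And>z. (a has_real_derivative c * a z) (at z)" and c: "c * c = 1"
    and b: "\<And>z. \<bar>a z\<bar> \<le> A"
  shows "a z = 0"
proof -
  have "((\<lambda>z. a z * exp (- (c * z))) has_real_derivative 0) (at z)" for z
    by (auto intro!: derivative_eq_intros d)
  then have k: "a z * exp (- (c * z)) = a 0 * exp (- (c * 0))" for z
    by (intro DERIV_isconst_all) blast
  define k where "k = a 0"
  have a: "a z = k * exp (c * z)" for z
    using k[of z] by (simp add: exp_minus k_def field_simps)
  have "k = 0"
  proof (rule ccontr)
    assume "k \<noteq> 0"
    \<comment> \<open>The test point \<open>c * (A / \<bar>k\<bar>)\<close> makes the exponent equal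
      to \<open>A / \<bar>k\<bar>\<close> for either sign of \<open>c\<close>; there
      \<open>1 + t \<le> exp t\<close> already gives a value above \<open>A\<close>.\<close>
    have e: "c * (c * (A / \<bar>k\<bar>)) = A / \<bar>k\<bar>" using c by (simp only: mult.assoc[symmetric] mult_1_left)
    have "\<bar>k\<bar> * exp (A / \<bar>k\<bar>) \<le> A"
      using b[of "c * (A / \<bar>k\<bar>)"] unfolding a e by (simp add: abs_mult)
    moreover have "\<bar>k\<bar> * (1 + A / \<bar>k\<bar>) \<le> \<bar>k\<bar> * exp (A / \<bar>k\<bar>)"
      by (intro mult_left_mono exp_ge_add_one_self) auto
    ultimately show False using \<open>k \<noteq> 0\<close> by (simp add: algebra_simps)
  qed
  then show ?thesis using a by simp
qed

section \<open>Moment equations along a bounded classical solution of the transport equation\<close>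

context
  fixes f x :: "real \<Rightarrow> real" and v vz vp :: "real \<Rightarrow> real \<Rightarrow> real" and X F :: real
  assumes fc: "continuous_on UNIV f" and fb: "\<And>z. \<bar>f z\<bar> \<le> F"
    and v0: "\<And>z. v z 0 = x z"
    and cv: "continuous_on UNIV (\<lambda>(z, p). v z p)"
    and cvz: "continuous_on UNIV (\<lambda>(z, p). vz z p)"
    and cvp: "continuous_on UNIV (\<lambda>(z, p). vp z p)"
    and dvz: "\<And>z p. ((\<lambda>z. v z p) has_real_derivative vz z p) (at z)"
    and dvp: "\<And>z p. (v z has_real_derivative vp z p) (at p)"
    and pde: "\<And>z p. vz z p = vp z p + f z * h0 p"
    and xv: "\<And>z. x z = integral {0..1} (\<lambda>q. kerB q * (v z q + v z (- q)))"
    and bv: "\<And>z p. p \<in> {-1..1} \<Longrightarrow> \<bar>v z p\<bar> \<le> X"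
begin

lemma continuous_comp2:
  assumes "continuous_on UNIV (\<lambda>(z, p). V z p)" "continuous_on A a" "continuous_on A b"
  shows "continuous_on A (\<lambda>t. V (a t) (b t) :: real)"
  using continuous_on_compose2[OF assms(1) continuous_on_Pair[OF assms(2,3)]] by simp

text \<open>With the weights \<open>wt n\<close> these are the integral parts of the moments:
  \<open>evenint\<close> for odd \<open>n\<close>, \<open>oddint\<close> for even \<open>n\<close>.
  The source acts through the odd function \<open>h0\<close> and therefore appears only in the
  equations for \<open>oddint\<close>.\<close>

definition "evenint w z = integral {0..1} (\<lambda>q. w q * (v z q + v z (- q)))"
definition "oddint w z = integral {0..1} (\<lambda>q. w q * (v z q - v z (- q)))"

text \<open>After differentiation under the integral the source cancels because \<open>h0\<close> is
  odd. Integration by parts follows; its boundary term at \<open>q = 0\<close> is zero.\<close>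

lemma evenint_deriv:
  assumes w: "\<And>q. (w has_real_derivative w' q) (at q)" and w': "continuous_on {0..1} w'"
  shows "(evenint w has_real_derivative w 1 * (v z 1 - v z (-1)) - oddint w' z) (at z)"
proof -
  have wc: "continuous_on A w" for A
    using w by (intro DERIV_continuous_on) (auto intro: has_field_derivative_at_within)
  have "(evenint w has_real_derivative integral (cbox 0 1) (\<lambda>q. w q * (vz z q + vz z (- q)))) (at z within UNIV)"
    unfolding evenint_def[abs_def] cbox_interval[symmetric]
  proof (rule leibniz_rule_field_derivative[where U = UNIV])
    show "continuous_on (UNIV \<times> cbox 0 1) (\<lambda>(z, q). w q * (vz z q + vz z (- q)))"
      unfolding split_beta
      by (intro continuous_intros continuous_comp2[OF cvz] continuous_on_compose2[OF wc]) auto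
    show "(\<lambda>q. w q * (v z q + v z (- q))) integrable_on cbox 0 1" for z
      by (intro integrable_continuous continuous_intros continuous_comp2[OF cv] wc)
  qed (auto intro!: derivative_eq_intros has_field_derivative_at_within[OF dvz])
  also have "(\<lambda>q. w q * (vz z q + vz z (- q))) = (\<lambda>q. w q * (vp z q + vp z (- q)))"
    by (simp add: pde h0_def)
  also have "integral (cbox 0 1) (\<lambda>q. w q * (vp z q + vp z (- q))) =
      w 1 * (v z 1 - v z (-1)) - oddint w' z"
  proof -
    have "((\<lambda>q. w' q * (v z q - v z (- q)) + w q * (vp z q + vp z (- q))) has_integral
        w 1 * (v z 1 - v z (-1)) - w 0 * (v z 0 - v z (- 0))) {0..1}"
      by (rule fundamental_theorem_of_calculus)
         (auto intro!: derivative_eq_intros has_field_derivative_at_within[OF w]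
           DERIV_chain2[OF dvp] simp: algebra_simps
           simp flip: has_real_derivative_iff_has_vector_derivative)
    moreover have "((\<lambda>q. w' q * (v z q - v z (- q))) has_integral oddint w' z) {0..1}"
      unfolding oddint_def
      by (intro integrable_integral integrable_continuous_real continuous_intros w' continuous_comp2[OF cv])
    ultimately have "((\<lambda>q. (w' q * (v z q - v z (- q)) + w q * (vp z q + vp z (- q)))
        - w' q * (v z q - v z (- q))) has_integral
        (w 1 * (v z 1 - v z (-1)) - w 0 * (v z 0 - v z (- 0))) - oddint w' z) {0..1}"
      by (rule has_integral_diff)
    then show ?thesis by (simp add: integral_unique)
  qed
  finally show ?thesis by simp
qed

text \<open>Here the source survives with the factor \<open>2 * k\<close>, and the boundary term at
  \<open>q = 0\<close> brings in the trace \<open>v z 0 = x z\<close>.\<close>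

lemma oddint_deriv:
  assumes w: "\<And>q. (w has_real_derivative w' q) (at q)" and w': "continuous_on {0..1} w'"
    and k: "((\<lambda>q. w q * h0 q) has_integral k) {0..1}"
  shows "(oddint w has_real_derivative
    w 1 * (v z 1 + v z (-1)) - 2 * w 0 * x z - evenint w' z + 2 * k * f z) (at z)"
proof -
  have wc: "continuous_on A w" for A
    using w by (intro DERIV_continuous_on) (auto intro: has_field_derivative_at_within)
  have "(oddint w has_real_derivative integral (cbox 0 1) (\<lambda>q. w q * (vz z q - vz z (- q)))) (at z within UNIV)"
    unfolding oddint_def[abs_def] cbox_interval[symmetric]
  proof (rule leibniz_rule_field_derivative[where U = UNIV])
    show "continuous_on (UNIV \<times> cbox 0 1) (\<lambda>(z, q). w q * (vz z q - vz z (- q)))"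
      unfolding split_beta
      by (intro continuous_intros continuous_comp2[OF cvz] continuous_on_compose2[OF wc]) auto
    show "(\<lambda>q. w q * (v z q - v z (- q))) integrable_on cbox 0 1" for z
      by (intro integrable_continuous continuous_intros continuous_comp2[OF cv] wc)
  qed (auto intro!: derivative_eq_intros has_field_derivative_at_within[OF dvz])
  also have "(\<lambda>q. w q * (vz z q - vz z (- q))) =
      (\<lambda>q. w q * (vp z q - vp z (- q)) + (w q * h0 q) * (2 * f z))"
    by (simp add: pde h0_def fun_eq_iff algebra_simps)
  also have "integral (cbox 0 1) \<dots> =
      w 1 * (v z 1 + v z (-1)) - 2 * w 0 * x z - evenint w' z + 2 * k * f z"
  proof -
    have "((\<lambda>q. w' q * (v z q + v z (- q)) + w q * (vp z q - vp z (- q))) has_integral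
        w 1 * (v z 1 + v z (-1)) - w 0 * (v z 0 + v z (- 0))) {0..1}"
      by (rule fundamental_theorem_of_calculus)
         (auto intro!: derivative_eq_intros has_field_derivative_at_within[OF w]
           DERIV_chain2[OF dvp] simp: algebra_simps
           simp flip: has_real_derivative_iff_has_vector_derivative)
    moreover have "((\<lambda>q. w' q * (v z q + v z (- q))) has_integral evenint w' z) {0..1}"
      unfolding evenint_def
      by (intro integrable_integral integrable_continuous_real continuous_intros w' continuous_comp2[OF cv])
    ultimately have "((\<lambda>q. (w' q * (v z q + v z (- q)) + w q * (vp z q - vp z (- q)))
        - w' q * (v z q + v z (- q))) has_integral
        (w 1 * (v z 1 + v z (-1)) - w 0 * (v z 0 + v z (- 0))) - evenint w' z) {0..1}"
      by (rule has_integral_diff)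
    from has_integral_add[OF this has_integral_mult_left[OF k, of "2 * f z"]]
    show ?thesis by (simp add: integral_unique v0 algebra_simps)
  qed
  finally show ?thesis by simp
qed

abbreviation (input) wt :: "nat \<Rightarrow> real \<Rightarrow> real"
  where "wt n \<equiv> (\<lambda>q. (1 - q) ^ n / fact n)"

lemma wt_deriv: "(wt (Suc n) has_real_derivative - wt n q) (at q)"
proof -
  have "((\<lambda>q::real. 1 - q) has_real_derivative - 1) (at q)"
    by (auto intro!: derivative_eq_intros)
  from DERIV_cdivide[OF DERIV_power[OF this, of "Suc n"], of "fact (Suc n)"]
  have "(wt (Suc n) has_real_derivative of_nat (Suc n) * (- 1 * (1 - q) ^ n) / (of_nat (Suc n) * fact n)) (at q)"
    by (simp only: diff_Suc_Suc diff_zero fact_Suc)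
  moreover have "of_nat (Suc n) * (- 1 * (1 - q) ^ n) / (of_nat (Suc n) * fact n) = - wt n q"
    by (subst nonzero_mult_divide_mult_cancel_left) auto
  ultimately show ?thesis by (simp only:)
qed

lemma kerB_moments: "x z = evenint (wt 1) z - evenint (wt 3) z"
proof -
  have "x z = integral {0..1} (\<lambda>q. wt 1 q * (v z q + v z (- q)) - wt 3 q * (v z q + v z (- q)))"
    unfolding xv by (intro integral_cong) (simp add: kerB_def eval_nat_numeral algebra_simps)
  also have "\<dots> = evenint (wt 1) z - evenint (wt 3) z"
    unfolding evenint_def
    by (intro Henstock_Kurzweil_Integration.integral_diff integrable_continuous_real
        continuous_intros continuous_comp2[OF cv]) auto
  finally show ?thesis .
qed

lemma minus_int: "evenint (\<lambda>q. - w q) z = - evenint w z" "oddint (\<lambda>q. - w q) z = - oddint w z"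
  by (simp_all add: evenint_def oddint_def)

lemma continuous_wt: "continuous_on A (\<lambda>q. - wt n q)"
  by (intro continuous_intros) auto

text \<open>These integrals reflect the vanishing of moments 0 and 2 of \<open>F0\<close>: the
  former gives \<open>- 3/5 - 2 * (- 3/10) = 0\<close>, the latter keeps the source out of the
  equation for \<open>oddint (wt 2)\<close>.\<close>

lemma h0_integrals:
  "((\<lambda>q. wt 0 q * h0 q) has_integral - 3/10) {0..1}" "((\<lambda>q. wt 2 q * h0 q) has_integral 0) {0..1}"
proof -
  have "((\<lambda>q. wt 0 q * h0 q) has_integral (1^2/5 - 1^4/2) - (0^2/5 - 0^4/2)) {0..1::real}"
    by (rule fundamental_theorem_of_calculus)
       (auto intro!: derivative_eq_intros simp: h0_def field_simps eval_nat_numeral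
           simp flip: has_real_derivative_iff_has_vector_derivative)
  then show "((\<lambda>q. wt 0 q * h0 q) has_integral - 3/10) {0..1}" by simp
  let ?G = "\<lambda>q::real. q^2/10 - 2*q^3/15 + q^4/20 - q^4/4 + 2*q^5/5 - q^6/6"
  have "((\<lambda>q. wt 2 q * h0 q) has_integral ?G 1 - ?G 0) {0..1::real}"
    by (rule fundamental_theorem_of_calculus)
       (auto intro!: derivative_eq_intros simp: h0_def field_simps eval_nat_numeral
           simp flip: has_real_derivative_iff_has_vector_derivative)
  then show "((\<lambda>q. wt 2 q * h0 q) has_integral 0) {0..1}" by simp
qed

lemma even3_deriv: "(evenint (wt 3) has_real_derivative oddint (wt 2) z) (at z)"
  using evenint_deriv[OF wt_deriv[of 2] continuous_wt, of z] by (simp add: minus_int numeral_3_eq_3)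

lemma even1_deriv: "(evenint (wt 1) has_real_derivative oddint (wt 0) z) (at z)"
  using evenint_deriv[OF wt_deriv[of 0] continuous_wt, of z] by (simp add: minus_int)

text \<open>Integration by parts yields \<open>evenint (wt 1) z - x z\<close>. The fixed point
  equation identifies this with \<open>evenint (wt 3) z\<close>, which closes the system for this
  pair.\<close>

lemma odd2_deriv: "(oddint (wt 2) has_real_derivative evenint (wt 3) z) (at z)"
proof -
  have "((\<lambda>q. wt (Suc 1) q * h0 q) has_integral 0) {0..1}"
    using h0_integrals(2) by (simp add: numeral_2_eq_2)
  note oddint_deriv[OF wt_deriv[of 1] continuous_wt this, of z]
  moreover have "wt (Suc 1) 1 * (v z 1 + v z (-1)) - 2 * wt (Suc 1) 0 * x z
      - evenint (\<lambda>q. - wt 1 q) z + 2 * 0 * f z = evenint (wt 3) z"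
    unfolding minus_int kerB_moments[of z] by simp
  ultimately show ?thesis by (simp only: Suc_1)
qed

text \<open>For \<open>y = oddint (wt 0)\<close> this is the second component of the system, with
  \<open>- 3/5\<close> from \<open>F0\<close>.\<close>

lemma odd0_deriv: "(oddint (wt 0) has_real_derivative - 2 * x z + v z 1 + v z (-1) - 3/5 * f z) (at z)"
proof -
  have "(wt 0 has_real_derivative 0) (at q)" for q by (auto intro!: derivative_eq_intros)
  from oddint_deriv[OF this continuous_on_const h0_integrals(1), of z]
  show ?thesis by (simp add: evenint_def algebra_simps)
qed

text \<open>The moment of order 3 satisfies \<open>Z'' = Z\<close> and is bounded, hence vanishes; the other three
  moment conditions follow from this one and the fixed point equation.\<close>

lemma moments_vanish:
  "evenint (wt 3) z = 0" "oddint (wt 2) z = 0" "evenint (wt 1) z = x z"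
proof -
  have wt: "\<bar>wt n q\<bar> \<le> 1" if "q \<in> {0..1}" for n q
  proof -
    have "(1 - q) ^ n \<le> fact n" "0 \<le> (1 - q) ^ n"
      using that order_trans[OF power_le_one[of "1 - q" n] fact_ge_1] by auto
    then show ?thesis by simp
  qed
  have b: "\<bar>wt n q * (v z q + v z (- q))\<bar> \<le> 2 * X" "\<bar>wt n q * (v z q - v z (- q))\<bar> \<le> 2 * X"
    if q: "q \<in> {0..1}" for n q z
  proof -
    have t: "\<bar>v z q + v z (- q)\<bar> \<le> 2 * X" "\<bar>v z q - v z (- q)\<bar> \<le> 2 * X"
      using bv[of q z] bv[of "- q" z] q by auto
    show "\<bar>wt n q * (v z q + v z (- q))\<bar> \<le> 2 * X" "\<bar>wt n q * (v z q - v z (- q))\<bar> \<le> 2 * X"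
      using mult_mono[OF wt[OF q, of n] t(1)] mult_mono[OF wt[OF q, of n] t(2)]
      by (simp_all only: abs_mult) auto
  qed
  have int: "(\<lambda>q. wt n q * (v z q + v z (- q))) integrable_on {0..1}"
    "(\<lambda>q. wt n q * (v z q - v z (- q))) integrable_on {0..1}" for n z
    by (auto intro!: integrable_continuous_real continuous_intros continuous_comp2[OF cv])
  have "norm (evenint (wt 3) z) \<le> integral {0..1::real} (\<lambda>q. 2 * X)" for z
    unfolding evenint_def
  proof (rule integral_norm_bound_integral[OF int(1)])
    show "norm (wt 3 q * (v z q + v z (- q))) \<le> 2 * X" if "q \<in> {0..1}" for q
      unfolding real_norm_def by (rule b(1)[OF that])
  qed (rule integrable_const_ivl)
  then have e3: "\<bar>evenint (wt 3) z\<bar> \<le> 2 * X" for z by simp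
  have "norm (oddint (wt 2) z) \<le> integral {0..1::real} (\<lambda>q. 2 * X)" for z
    unfolding oddint_def
  proof (rule integral_norm_bound_integral[OF int(2)])
    show "norm (wt 2 q * (v z q - v z (- q))) \<le> 2 * X" if "q \<in> {0..1}" for q
      unfolding real_norm_def by (rule b(2)[OF that])
  qed (rule integrable_const_ivl)
  then have o2: "\<bar>oddint (wt 2) z\<bar> \<le> 2 * X" for z by simp
  \<comment> \<open>\<open>Z'' = Z\<close> is factored into first order equations for
    \<open>Z + Z'\<close> and \<open>Z - Z'\<close>, where \<open>Z' = oddint (wt 2)\<close>;
    boundedness excludes the growing exponential at one of the two ends.\<close>
  have "evenint (wt 3) z + oddint (wt 2) z = 0"
  proof (rule bounded_exponential_eq_0[where c = 1 and A = "4 * X" and z = z and a = "\<lambda>z. evenint (wt 3) z + oddint (wt 2) z"])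
    show "((\<lambda>z. evenint (wt 3) z + oddint (wt 2) z) has_real_derivative
        1 * (evenint (wt 3) z + oddint (wt 2) z)) (at z)" for z
      using DERIV_add[OF even3_deriv odd2_deriv] by (simp add: add.commute)
    show "\<bar>evenint (wt 3) z + oddint (wt 2) z\<bar> \<le> 4 * X" for z
      using e3[of z] o2[of z] by linarith
  qed simp
  moreover have "evenint (wt 3) z - oddint (wt 2) z = 0"
  proof (rule bounded_exponential_eq_0[where c = "-1" and A = "4 * X" and z = z and a = "\<lambda>z. evenint (wt 3) z - oddint (wt 2) z"])
    show "((\<lambda>z. evenint (wt 3) z - oddint (wt 2) z) has_real_derivative
        -1 * (evenint (wt 3) z - oddint (wt 2) z)) (at z)" for z
      using DERIV_diff[OF even3_deriv odd2_deriv] by simp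
    show "\<bar>evenint (wt 3) z - oddint (wt 2) z\<bar> \<le> 4 * X" for z
      using e3[of z] o2[of z] by linarith
  qed simp
  ultimately show "evenint (wt 3) z = 0" "oddint (wt 2) z = 0" by linarith+
  then show "evenint (wt 1) z = x z" using kerB_moments[of z] by simp
qed

text \<open>The second component is chosen as \<open>oddint (wt 0)\<close>, which makes moment 0
  vanish by construction; moment 1 then says that this is the derivative of
  \<open>x\<close>.\<close>

lemma lin_sol_of_wave: "\<exists>u :: real \<Rightarrow>\<^sub>C dspace. lin_sol f u"
proof -
  define y where "y = oddint (wt 0)"
  have xe: "x = evenint (wt 1)" using moments_vanish(3) by (intro ext) simp
  have dx: "(x has_real_derivative y z) (at z)" for z
    unfolding xe y_def by (rule even1_deriv)
  have dy: "(y has_real_derivative - 2 * x z + v z 1 + v z (-1) - 3/5 * f z) (at z)" for z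
    unfolding y_def by (rule odd0_deriv)
  have cvS: "continuous_on (UNIV \<times> {-1..1}) (\<lambda>(z, p). v z p)"
    "continuous_on (UNIV \<times> {-1..1}) (\<lambda>(z, p). vz z p)"
    "continuous_on (UNIV \<times> {-1..1}) (\<lambda>(z, p). vp z p)"
    by (rule continuous_on_subset[OF cv] continuous_on_subset[OF cvz] continuous_on_subset[OF cvp], simp)+
  note sl = continuous_on_slice[OF cvS(1)] continuous_on_slice[OF cvS(3)]
  define u where "u z = D_of (x z, y z, bcf (v z))" for z
  have hd: "has_dp (bcf (v z)) (bcf (vp z))" for z
    by (rule has_dp_bcf[OF _ sl(2)])
       (rule has_vector_derivative_at_within, use dvp in \<open>simp add: has_real_derivative_iff_has_vector_derivative\<close>)
  have of_u: "of_D (u z) = (x z, y z, bcf (v z))" for z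
    unfolding u_def
    by (rule D_of_inverse) (use hd in \<open>auto simp: dom_L_def ev_bcf[OF sl(1)] v0\<close>)
  have L: "L10 (u z) = (y z, - 2 * x z + v z 1 + v z (-1), bcf (vp z))" for z
    by (simp add: L10_eq of_u third_def ev_bcf[OF sl(1)] dp_eq[OF hd])
  have "of_D (u z) \<in> range P_h" for z
    unfolding range_P_h
  proof (intro allI impI)
    fix n :: nat assume "n < 4"
    have m: "integral {0..1} (\<lambda>q. wt n q * (ev (bcf (v z)) q - (- 1) ^ n * ev (bcf (v z)) (- q)))
        = (if even n then oddint (wt n) z else evenint (wt n) z)"
      unfolding evenint_def oddint_def
      by (auto intro!: integral_cong simp: ev_bcf[OF sl(1)])
    have "n \<in> {0, 1, 2, 3}" using \<open>n < 4\<close> by auto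
    then show "moment n (of_D (u z)) = 0"
      unfolding moment_def of_u third_def fst_conv snd_conv m
      using moments_vanish[of z] by (auto simp: y_def)
  qed
  moreover have "((\<lambda>z. of_D (u z)) has_vector_derivative L10 (u z) + f z *\<^sub>R F0) (at z)" for z
  proof -
    have x': "(x has_derivative (\<lambda>h. h * y z)) (at z)"
      using dx[of z] by (simp add: has_field_derivative_def mult.commute[of _ "y z"])
    have y': "(y has_derivative (\<lambda>h. h * (- 2 * x z + v z 1 + v z (-1) - 3/5 * f z))) (at z)"
      using dy[of z] unfolding has_field_derivative_def by (rule has_derivative_eq_rhs) (simp add: fun_eq_iff)
    have v': "((\<lambda>z. bcf (v z)) has_derivative (\<lambda>h. h *\<^sub>R bcf (vz z))) (at z)"
      using deriv_bcf_curve[OF cvS(1,2) dvz, of z] by (simp add: has_vector_derivative_def)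
    have "bcf (vz z) = bcf (vp z) + f z *\<^sub>R bcf h0"
      by (rule bcontfun_eqI)
         (simp add: plus_bcontfun.rep_eq scaleR_bcontfun.rep_eq apply_bcf continuous_h0 sl
           apply_bcf[OF continuous_on_slice[OF cvS(2)]] pde)
    then show ?thesis
      unfolding has_vector_derivative_def of_u L F0_eq
      by (intro has_derivative_eq_rhs[OF has_derivative_Pair[OF x' has_derivative_Pair[OF y' v']]])
         (simp add: fun_eq_iff algebra_simps)
  qed
  ultimately have ls: "lin_sol f u" using fc unfolding lin_sol_def by blast
  have "continuous_on UNIV u"
    unfolding continuous_on_def
  proof
    fix z0
    \<comment> \<open>The explicit form of the \<open>dspace\<close> norm of
      \<open>u z - u z0\<close>; its last entry makes continuity of \<open>vp\<close> necessary as
      well.\<close>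
    define N where "N = (\<lambda>z. max \<bar>x z - x z0\<bar> (max \<bar>y z - y z0\<bar>
        (max (norm (bcf (v z) - bcf (v z0))) (norm (bcf (vp z) - bcf (vp z0))))))"
    have "continuous_on UNIV x" "continuous_on UNIV y"
      by (rule DERIV_continuous_on, rule dx dy)+
    then have "continuous_on UNIV N"
      unfolding N_def by (intro continuous_intros continuous_bcf_curve cvS)
    moreover have "N z0 = 0" by (simp add: N_def)
    ultimately have N0: "(N \<longlongrightarrow> 0) (at z0 within UNIV)"
      by (auto simp: continuous_on_def dest!: spec[of _ z0])
    have "norm (u z - u z0) = N z" for z
    proof -
      have "dp (third (of_D (u z - u z0))) = bcf (vp z) - bcf (vp z0)"
        unfolding dp_third_diff unfolding of_u third_def snd_conv dp_eq[OF hd] ..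
      then show ?thesis
        unfolding norm_dspace_max N_def third_of_D_diff unfolding of_D_diff
        unfolding of_u third_def fst_diff snd_diff fst_conv snd_conv by simp
    qed
    then have "((\<lambda>z. norm (u z - u z0)) \<longlongrightarrow> 0) (at z0 within UNIV)"
      using N0 by (simp only:)
    then show "(u \<longlongrightarrow> u z0) (at z0 within UNIV)"
      by (rule LIM_zero_cancel[OF tendsto_norm_zero_cancel])
  qed
  \<comment> \<open>Only \<open>v\<close> is assumed bounded, not \<open>vp\<close> or
    \<open>y\<close>. The a priori estimate along \<open>top\<close> supplies the bound in the full
    norm of \<open>dspace\<close>.\<close>
  moreover have "norm (u z) \<le> 56 * F + 1" for z
  proof -
    have "\<bar>cmp1 (u z)\<bar> \<le> X" for z using bv[of 0 z] by (simp add: of_u v0)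
    from lin_sol_estimate[OF ls this shift_stable_filters(1), of F 1] fb show ?thesis by simp
  qed
  then have "bounded (range u)" by (auto simp: bounded_iff)
  ultimately have "apply_bcontfun (Bcontfun u) = u"
    by (intro Bcontfun_inverse) (auto simp: bcontfun_def)
  then show ?thesis using ls by (intro exI[of _ "Bcontfun u"]) simp
qed

end

text \<open>The oriented integral of \<open>q \<mapsto> f (z + p - q) * h0 q\<close> from \<open>0\<close> to \<open>p\<close>, integrated by parts:
  \<open>f1\<close>, \<open>f2\<close>, \<open>f3\<close>, \<open>f4\<close> are iterated antiderivatives of \<open>f\<close>. In this form it is differentiable
  in \<open>p\<close> although \<open>f\<close> is only continuous.\<close>

definition Jint :: "(real \<Rightarrow> real) \<Rightarrow> (real \<Rightarrow> real) \<Rightarrow> (real \<Rightarrow> real) \<Rightarrow> (real \<Rightarrow> real) \<Rightarrow> real \<Rightarrow> real \<Rightarrow> real"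
  where "Jint f1 f2 f3 f4 z p = 2/5 * f2 (z + p) - 12 * f4 (z + p)
    - (h0 p * f1 z + (2/5 - 6 * p^2) * f2 z - 12 * p * f3 z - 12 * f4 z)"

section \<open>Solving the fixed point equation for a continuous source\<close>

context
  fixes f f1 f2 f3 f4 :: "real \<Rightarrow> real" and F :: real
  assumes fc: "continuous_on UNIV f" and fb: "\<And>z. \<bar>f z\<bar> \<le> F"
    and d1: "\<And>z. (f1 has_real_derivative f z) (at z)"
    and d2: "\<And>z. (f2 has_real_derivative f1 z) (at z)"
    and d3: "\<And>z. (f3 has_real_derivative f2 z) (at z)"
    and d4: "\<And>z. (f4 has_real_derivative f3 z) (at z)"
begin

lemma f_continuous:
  "continuous_on A a \<Longrightarrow> continuous_on A (\<lambda>t. f (a t))"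
  "continuous_on A a \<Longrightarrow> continuous_on A (\<lambda>t. f1 (a t))"
  "continuous_on A a \<Longrightarrow> continuous_on A (\<lambda>t. f2 (a t))"
  "continuous_on A a \<Longrightarrow> continuous_on A (\<lambda>t. f3 (a t))"
  "continuous_on A a \<Longrightarrow> continuous_on A (\<lambda>t. f4 (a t))"
proof -
  have "continuous_on UNIV f1" "continuous_on UNIV f2" "continuous_on UNIV f3" "continuous_on UNIV f4"
    by (rule DERIV_continuous_on, rule d1 d2 d3 d4)+
  then show "continuous_on A a \<Longrightarrow> continuous_on A (\<lambda>t. f (a t))"
    "continuous_on A a \<Longrightarrow> continuous_on A (\<lambda>t. f1 (a t))"
    "continuous_on A a \<Longrightarrow> continuous_on A (\<lambda>t. f2 (a t))"
    "continuous_on A a \<Longrightarrow> continuous_on A (\<lambda>t. f3 (a t))"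
    "continuous_on A a \<Longrightarrow> continuous_on A (\<lambda>t. f4 (a t))"
    using fc continuous_on_compose2 by (metis subset_UNIV)+
qed

lemma continuous_h0_comp: "continuous_on A a \<Longrightarrow> continuous_on A (\<lambda>t. h0 (a t))"
  unfolding h0_def by (intro continuous_intros)

lemma h0_deriv: "(h0 has_real_derivative 2/5 - 6 * p^2) (at p)"
  unfolding h0_def by (auto intro!: derivative_eq_intros simp: power2_eq_square field_simps)

abbreviation "J \<equiv> Jint f1 f2 f3 f4"

text \<open>The antiderivatives may grow, so the formula cannot be bounded term by term. Along
  \<open>s \<mapsto> (z + s, p - s)\<close> the sum \<open>z + p\<close> is constant, the derivative
  of \<open>J\<close> collapses to \<open>- f (z + s) * h0 (p - s)\<close>, and \<open>J\<close>
  vanishes at \<open>s = p\<close>.\<close>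

lemma abs_J_le:
  assumes p: "p \<in> {-1..1}"
  shows "\<bar>J z p\<bar> \<le> 2 * F"
proof -
  have F: "0 \<le> F" using fb[of 0] by linarith
  have J: "J (z + s) (p - s) = 2/5 * f2 (z + p) - 12 * f4 (z + p)
    - (h0 (p - s) * f1 (z + s) + (2/5 - 6 * (p - s)^2) * f2 (z + s) - 12 * (p - s) * f3 (z + s) - 12 * f4 (z + s))" for s
    by (simp add: Jint_def)
  have "norm (J (z + 0) (p - 0) - J (z + p) (p - p)) \<le> 2 * F * norm (0 - p)"
  proof (rule field_differentiable_bound[where S = "closed_segment 0 p"
        and f = "\<lambda>s. J (z + s) (p - s)" and f' = "\<lambda>s. - f (z + s) * h0 (p - s)"])
    fix s assume s: "s \<in> closed_segment 0 p"
    then have s': "p - s \<in> {-1..1}"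
      using p by (auto simp: closed_segment_eq_real_ivl split: if_splits)
    show "((\<lambda>s. J (z + s) (p - s)) has_field_derivative - f (z + s) * h0 (p - s))
        (at s within closed_segment 0 p)"
      unfolding J
      by (rule derivative_eq_intros DERIV_chain2[OF h0_deriv] DERIV_chain2[OF d1] DERIV_chain2[OF d2]
           DERIV_chain2[OF d3] DERIV_chain2[OF d4] refl)+ (simp add: algebra_simps power2_eq_square)
    have "\<bar>f (z + s)\<bar> * \<bar>h0 (p - s)\<bar> \<le> F * 2"
      using s' F by (intro mult_mono fb abs_h0_le) auto
    then show "norm (- f (z + s) * h0 (p - s)) \<le> 2 * F" by (simp add: abs_mult)
  qed auto
  also have "J (z + p) (p - p) = 0" by (simp add: Jint_def h0_def)
  also have "2 * F * norm (0 - p) \<le> 2 * F * 1"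
    using p F by (intro mult_left_mono) auto
  finally show ?thesis by simp
qed

lemma continuous_J:
  "continuous_on A a \<Longrightarrow> continuous_on A b \<Longrightarrow> continuous_on A (\<lambda>t. J (a t) (b t))"
  unfolding Jint_def by (intro continuous_intros f_continuous continuous_h0_comp) auto

text \<open>\<open>x (z + p) - J z p\<close> is the value at \<open>(z, p)\<close> that transport
  with source \<open>f\<close> assigns to the trace \<open>x\<close> on \<open>p = 0\<close>. Its
  weighted average contracts with constant \<open>11/12\<close>.\<close>

lemma fixpoint_exists:
  "\<exists>x :: real \<Rightarrow>\<^sub>C real. \<forall>z. x z = integral {0..1} (\<lambda>q. kerB q * ((x (z + q) - J z q) + (x (z - q) - J z (- q))))"
proof -
  define G where "G x z q = (x (z + q) - J z q) + (x (z - q) - J z (- q))"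
    for x :: "real \<Rightarrow>\<^sub>C real" and z q
  have cG: "continuous_on A a \<Longrightarrow> continuous_on A b \<Longrightarrow> continuous_on A (\<lambda>t. G x (a t) (b t))" for x A and a b :: "'a :: topological_space \<Rightarrow> real"
    unfolding G_def
    by (intro continuous_intros continuous_J continuous_on_compose2[OF continuous_on_apply_bcontfun[of UNIV x]]) auto
  define T where "T x = Bcontfun (\<lambda>z. integral {0..1} (\<lambda>q. kerB q * G x z q))" for x
  have "continuous_on UNIV (\<lambda>z. integral (cbox 0 1) (\<lambda>q. kerB q * G x z q))" for x
    by (rule integral_continuous_on_param)
       (auto simp: split_beta intro!: continuous_intros cG continuous_on_compose2[OF continuous_kerB[of UNIV]])
  moreover have "\<bar>integral {0..1} (\<lambda>q. kerB q * G x z q)\<bar> \<le> 11/24 * (2 * norm x + 4 * F)" for x z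
  proof (rule abs_integral_kerB_le)
    fix q :: real assume q: "q \<in> {0..1}"
    show "\<bar>G x z q\<bar> \<le> 2 * norm x + 4 * F"
      unfolding G_def using norm_bounded[of x "z + q"] norm_bounded[of x "z - q"]
        abs_J_le[of q z] abs_J_le[of "- q" z] q by auto
  qed (intro cG continuous_intros)
  ultimately have T: "T x z = integral {0..1} (\<lambda>q. kerB q * G x z q)" for x z
    unfolding T_def
    by (subst Bcontfun_inverse) (auto simp: bcontfun_def bounded_iff intro!: exI[of _ "11/24 * (2 * norm x + 4 * F)"])
  have "dist (T x) (T y) \<le> 11/12 * dist x y" for x y
  proof (rule dist_bound)
    fix z
    have "T x z - T y z = integral {0..1} (\<lambda>q. kerB q * G x z q - kerB q * G y z q)"
      unfolding T
      by (intro Henstock_Kurzweil_Integration.integral_diff[symmetric] integrable_continuous_real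
        continuous_intros cG)
    also have "\<dots> = integral {0..1} (\<lambda>q. kerB q * (G x z q - G y z q))"
      by (simp add: algebra_simps)
    also have "\<bar>\<dots>\<bar> \<le> 11/24 * (2 * dist x y)"
    proof (rule abs_integral_kerB_le)
      fix q :: real assume q: "q \<in> {0..1}"
      show "\<bar>G x z q - G y z q\<bar> \<le> 2 * dist x y"
        unfolding G_def using dist_bounded[of x "z + q" y] dist_bounded[of x "z - q" y]
        by (auto simp: dist_real_def)
    qed (intro cG continuous_intros)
    finally show "dist (T x z) (T y z) \<le> 11/12 * dist x y" by (simp add: dist_real_def)
  qed
  then have "\<exists>!x. T x = x" by (intro banach_fix_type[where c = "11/12"]) auto
  then obtain x where "T x = x" by blast
  then have "\<forall>z. x z = integral {0..1} (\<lambda>q. kerB q * G x z q)" using T[of x] by simp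
  then show ?thesis unfolding G_def by blast
qed

text \<open>The fixed point \<open>x\<close> is at first only continuous, while
  \<open>lin_sol_of_wave\<close> needs derivatives of \<open>v\<close>. The fixed point equation
  itself supplies them: after integration by parts against the cubic kernel, its right-hand side
  contains only differentiable antiderivatives.\<close>

lemma lin_exists_aux: "\<exists>u :: real \<Rightarrow>\<^sub>C dspace. lin_sol f u"
proof -
  obtain x :: "real \<Rightarrow>\<^sub>C real" where
    x: "\<And>z. x z = integral {0..1} (\<lambda>q. kerB q * ((x (z + q) - J z q) + (x (z - q) - J z (- q))))"
    using fixpoint_exists by blast
  \<comment> \<open>\<open>m (z + p)\<close> collects the part of \<open>x (z + p) - J z p\<close>
    that depends on \<open>z + p\<close> alone; the rest is polynomial in \<open>p\<close> with
    coefficients depending on \<open>z\<close>.\<close>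
  define m where "m z = x z - 2/5 * f2 z + 12 * f4 z" for z
  have mc: "continuous_on UNIV m"
    unfolding m_def by (intro continuous_intros continuous_on_apply_bcontfun f_continuous)
  obtain X1 where X1: "\<And>z. (X1 has_real_derivative m z) (at z)"
    using antiderivative_exists[OF mc] by blast
  have "continuous_on UNIV X1" by (rule DERIV_continuous_on, rule X1)
  then obtain X2 where X2: "\<And>z. (X2 has_real_derivative X1 z) (at z)"
    by (blast dest: antiderivative_exists)
  have "continuous_on UNIV X2" by (rule DERIV_continuous_on, rule X2)
  then obtain X3 where X3: "\<And>z. (X3 has_real_derivative X2 z) (at z)"
    by (blast dest: antiderivative_exists)
  have "continuous_on UNIV X3" by (rule DERIV_continuous_on, rule X3)
  then obtain X4 where X4: "\<And>z. (X4 has_real_derivative X3 z) (at z)"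
    by (blast dest: antiderivative_exists)
  define v where "v z p = m (z + p) + (h0 p * f1 z + (2/5 - 6 * p^2) * f2 z - 12 * p * f3 z - 12 * f4 z)" for z p
  have vJ: "v z p = x (z + p) - J z p" for z p
    by (simp add: v_def m_def Jint_def algebra_simps)
  have xv: "x z = integral {0..1} (\<lambda>q. kerB q * (v z q + v z (- q)))" for z
    using x[of z] by (simp add: vJ)
  \<comment> \<open>In \<open>v z q + v z (- q)\<close> the terms with \<open>f1\<close> and
    \<open>f3\<close> cancel, being odd in \<open>q\<close>. The term with \<open>f2\<close> leaves
    this constant as its coefficient; its value is irrelevant.\<close>
  define k1 where "k1 = integral {0..1} (\<lambda>q. kerB q * (2 * (2/5 - 6 * q^2)))"
  have mm: "((\<lambda>q. kerB q * (m (z + q) + m (z - q))) has_integral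
      X2 (z + 1) + X2 (z - 1) - X2 z - X4 (z + 1) - X4 (z - 1) + 2 * X4 z) {0..1}" for z
  proof -
    \<comment> \<open>The successive derivatives of \<open>kerB\<close>, the third being
      \<open>1\<close>. \<open>?G\<close> is the primitive obtained by moving all of them onto the
      antiderivatives of \<open>m\<close>.\<close>
    define B' where "B' = (\<lambda>q::real. (1 - q)^2/2 - 1)"
    define B'' where "B'' = (\<lambda>q::real. q - 1)"
    let ?G = "\<lambda>q. kerB q * X1 (z + q) - B' q * X2 (z + q) + B'' q * X3 (z + q) - X4 (z + q)
       - kerB q * X1 (z - q) - B' q * X2 (z - q) - B'' q * X3 (z - q) - X4 (z - q)"
    have p: "((\<lambda>q. Y (z + q)) has_real_derivative Y' (z + q)) (at q)"
      and n: "((\<lambda>q. Y (z - q)) has_real_derivative - Y' (z - q)) (at q)"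
      if "\<And>z. (Y has_real_derivative Y' z) (at z)" for Y Y' :: "real \<Rightarrow> real" and q
    proof -
      have "((\<lambda>q. z + q) has_real_derivative 1) (at q)" "((\<lambda>q. z - q) has_real_derivative - 1) (at q)"
        using DERIV_add[OF DERIV_const DERIV_ident, of z q UNIV] DERIV_diff[OF DERIV_const DERIV_ident, of z q UNIV]
        by (simp_all only: add_0 diff_0)
      from DERIV_chain2[OF that this(1)] DERIV_chain2[OF that this(2)]
      show "((\<lambda>q. Y (z + q)) has_real_derivative Y' (z + q)) (at q)"
        "((\<lambda>q. Y (z - q)) has_real_derivative - Y' (z - q)) (at q)" by simp_all
    qed
    have B: "(kerB has_real_derivative B' q) (at q)" "(B' has_real_derivative B'' q) (at q)"
      "(B'' has_real_derivative 1) (at q)" for q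
      unfolding kerB_def B'_def B''_def
      by (auto intro!: derivative_eq_intros simp: field_simps power2_eq_square)
    have "(?G has_real_derivative
        (B' q * X1 (z + q) + m (z + q) * kerB q) - (B'' q * X2 (z + q) + X1 (z + q) * B' q)
        + (1 * X3 (z + q) + X2 (z + q) * B'' q) - X3 (z + q)
        - (B' q * X1 (z - q) + - m (z - q) * kerB q) - (B'' q * X2 (z - q) + - X1 (z - q) * B' q)
        - (1 * X3 (z - q) + - X2 (z - q) * B'' q) - - X3 (z - q)) (at q)" for q
      by (rule DERIV_add DERIV_diff DERIV_mult B p[OF X1] p[OF X2] p[OF X3] p[OF X4]
          n[OF X1] n[OF X2] n[OF X3] n[OF X4])+
    moreover have "(B' q * X1 (z + q) + m (z + q) * kerB q) - (B'' q * X2 (z + q) + X1 (z + q) * B' q)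
        + (1 * X3 (z + q) + X2 (z + q) * B'' q) - X3 (z + q)
        - (B' q * X1 (z - q) + - m (z - q) * kerB q) - (B'' q * X2 (z - q) + - X1 (z - q) * B' q)
        - (1 * X3 (z - q) + - X2 (z - q) * B'' q) - - X3 (z - q) = kerB q * (m (z + q) + m (z - q))" for q
      by (simp only: algebra_simps)
    ultimately have G: "(?G has_real_derivative kerB q * (m (z + q) + m (z - q))) (at q)" for q
      by (simp only:)
    have "((\<lambda>q. kerB q * (m (z + q) + m (z - q))) has_integral ?G 1 - ?G 0) {0..1}"
      by (rule fundamental_theorem_of_calculus)
         (simp_all only: has_real_derivative_iff_has_vector_derivative[symmetric]
           has_field_derivative_at_within[OF G] zero_le_one)
    then show ?thesis by (rule has_integral_eq_rhs) (simp add: kerB_def B'_def B''_def)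
  qed
  \<comment> \<open>\<open>11 = 24 * 11/24\<close>: the two terms \<open>- 12 * f4 z\<close> against
    the mass of \<open>kerB\<close>.\<close>
  have xe: "x z = X2 (z + 1) + X2 (z - 1) - X2 z - X4 (z + 1) - X4 (z - 1) + 2 * X4 z
      + k1 * f2 z - 11 * f4 z" for z
  proof -
    have "((\<lambda>q. kerB q * (2 * (2/5 - 6 * q^2))) has_integral k1) {0..1}"
      unfolding k1_def by (intro integrable_integral integrable_continuous_real continuous_intros)
    from has_integral_diff[OF has_integral_add[OF mm[of z] has_integral_mult_left[OF this, of "f2 z"]]
        has_integral_mult_left[OF integral_kerB, of "24 * f4 z"]]
    have "((\<lambda>q. kerB q * (v z q + v z (- q))) has_integral
       (X2 (z + 1) + X2 (z - 1) - X2 z - X4 (z + 1) - X4 (z - 1) + 2 * X4 z) + k1 * f2 z - 11/24 * (24 * f4 z)) {0..1}"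
      by (rule has_integral_eq[rotated]) (simp add: v_def h0_def algebra_simps)
    then show ?thesis using xv[of z] by (simp add: integral_unique)
  qed
  \<comment> \<open>The formal derivative of the preceding right-hand side. It involves
    \<open>X1\<close> and \<open>X3\<close>, which are continuous, so \<open>x\<close> is
    C^1.\<close>
  define x1 where "x1 z = X1 (z + 1) + X1 (z - 1) - X1 z - X3 (z + 1) - X3 (z - 1) + 2 * X3 z
      + k1 * f1 z - 11 * f3 z" for z
  have "((\<lambda>z. X2 (z + 1) + X2 (z - 1) - X2 z - X4 (z + 1) - X4 (z - 1) + 2 * X4 z
      + k1 * f2 z - 11 * f4 z) has_real_derivative x1 z) (at z)" for z
    by (rule derivative_eq_intros DERIV_chain2[OF X2] DERIV_chain2[OF X4] d2 d4 X2 X4 refl)+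
       (simp add: x1_def)
  then have dx: "(x has_real_derivative x1 z) (at z)" for z
    by (simp add: xe[abs_def, symmetric])
  define m1 where "m1 z = x1 z - 2/5 * f1 z + 12 * f3 z" for z
  have dm: "(m has_real_derivative m1 z) (at z)" for z
    unfolding m_def m1_def by (rule derivative_eq_intros dx d2 d4 refl)+ simp
  have m1c: "continuous_on UNIV m1"
    unfolding m1_def x1_def
    by (intro continuous_intros f_continuous
        continuous_on_compose2[OF \<open>continuous_on UNIV X1\<close>] continuous_on_compose2[OF \<open>continuous_on UNIV X3\<close>]) auto
  define vp where "vp z p = m1 (z + p) + ((2/5 - 6 * p^2) * f1 z - 12 * p * f2 z - 12 * f3 z)" for z p
  define vz where "vz z p = vp z p + f z * h0 p" for z p
  have X: "\<bar>v z p\<bar> \<le> norm x + 2 * F" if "p \<in> {-1..1}" for z p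
    unfolding vJ using norm_bounded[of x "z + p"] abs_J_le[OF that, of z] by auto
  show ?thesis
  proof (rule lin_sol_of_wave[OF fc fb, where v = v and vz = vz and vp = vp and x = x and X = "norm x + 2 * F"])
    show "v z 0 = x z" for z by (simp add: vJ Jint_def h0_def)
    show "continuous_on UNIV (\<lambda>(z, p). v z p)"
      unfolding split_beta v_def
      by (intro continuous_intros f_continuous continuous_h0_comp continuous_on_compose2[OF mc]) auto
    show vpc: "continuous_on UNIV (\<lambda>(z, p). vp z p)"
      unfolding split_beta vp_def
      by (intro continuous_intros f_continuous continuous_h0_comp continuous_on_compose2[OF m1c]) auto
    show "continuous_on UNIV (\<lambda>(z, p). vz z p)"
      using vpc unfolding split_beta vz_def
      by (intro continuous_intros f_continuous continuous_h0_comp)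
    show "((\<lambda>z. v z p) has_real_derivative vz z p) (at z)" for z p
      unfolding v_def vz_def vp_def
      by (rule derivative_eq_intros DERIV_chain2[OF dm] d1 d2 d3 d4 refl)+ (simp add: algebra_simps)
    show "(v z has_real_derivative vp z p) (at p)" for z p
      unfolding v_def[abs_def] vp_def
      by (rule derivative_eq_intros DERIV_chain2[OF dm] h0_deriv refl)+ (simp add: algebra_simps)
  qed (use X xv in \<open>auto simp: vz_def\<close>)
qed

end

lemma lin_exists:
  fixes f :: "real \<Rightarrow> real"
  assumes fc: "continuous_on UNIV f" and fb: "\<And>z. \<bar>f z\<bar> \<le> F"
  shows "\<exists>u :: real \<Rightarrow>\<^sub>C dspace. lin_sol f u"
proof -
  obtain f1 where d1: "\<And>z. (f1 has_real_derivative f z) (at z)"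
    using antiderivative_exists[OF fc] by blast
  have "continuous_on UNIV f1" by (rule DERIV_continuous_on, rule d1)
  then obtain f2 where d2: "\<And>z. (f2 has_real_derivative f1 z) (at z)"
    by (blast dest: antiderivative_exists)
  have "continuous_on UNIV f2" by (rule DERIV_continuous_on, rule d2)
  then obtain f3 where d3: "\<And>z. (f3 has_real_derivative f2 z) (at z)"
    by (blast dest: antiderivative_exists)
  have "continuous_on UNIV f3" by (rule DERIV_continuous_on, rule d3)
  then obtain f4 where d4: "\<And>z. (f4 has_real_derivative f3 z) (at z)"
    by (blast dest: antiderivative_exists)
  show ?thesis by (rule lin_exists_aux[OF fc fb d1 d2 d3 d4])
qed

section \<open>The nonlinearity\<close>

text \<open>The continuous partial derivatives are bounded on the compact set, the operator norm is
  at most the sum of these bounds, and convexity permits the mean value inequality.\<close>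

lemma Ck1_lipschitz:
  fixes f :: "'a::euclidean_space \<Rightarrow> real"
  assumes f: "Ck 1 f" and S: "compact S" "convex S"
  obtains L where "0 \<le> L" "\<And>x y. x \<in> S \<Longrightarrow> y \<in> S \<Longrightarrow> \<bar>f x - f y\<bar> \<le> L * norm (x - y)"
proof -
  let ?D = "\<lambda>x. frechet_derivative f (at x)"
  have d: "(f has_derivative ?D x) (at x)" for x
    using f by (simp add: frechet_derivative_works[symmetric])
  have "\<forall>b\<in>Basis. \<exists>B. \<forall>x\<in>S. \<bar>?D x b\<bar> \<le> B"
  proof
    fix b :: 'a assume "b \<in> Basis"
    then have "continuous_on UNIV (\<lambda>x. ?D x b)" using f by simp
    then have "compact ((\<lambda>x. ?D x b) ` S)"
      using S(1) by (intro compact_continuous_image) (auto intro: continuous_on_subset)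
    then obtain B where "\<forall>y\<in>(\<lambda>x. ?D x b) ` S. norm y \<le> B"
      using compact_imp_bounded bounded_iff by blast
    then show "\<exists>B. \<forall>x\<in>S. \<bar>?D x b\<bar> \<le> B" by auto
  qed
  from bchoice[OF this] obtain B where B: "\<And>b x. b \<in> Basis \<Longrightarrow> x \<in> S \<Longrightarrow> \<bar>?D x b\<bar> \<le> B b"
    by blast
  let ?L = "\<Sum>b\<in>Basis. \<bar>B b\<bar>"
  have on: "onorm (?D x) \<le> ?L" if x: "x \<in> S" for x
  proof (rule onorm_le)
    fix h
    interpret D: bounded_linear "?D x" by (rule has_derivative_bounded_linear[OF d])
    have "?D x h = (\<Sum>b\<in>Basis. (h \<bullet> b) * ?D x b)"
      using arg_cong[OF euclidean_representation[of h], of "?D x"] by (simp only: D.sum D.scaleR real_scaleR_def)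
    also have "\<bar>\<dots>\<bar> \<le> (\<Sum>b\<in>Basis. norm h * \<bar>B b\<bar>)"
    proof (rule order_trans[OF sum_abs], rule sum_mono)
      fix b :: 'a assume b: "b \<in> Basis"
      have "\<bar>h \<bullet> b\<bar> * \<bar>?D x b\<bar> \<le> norm h * \<bar>B b\<bar>"
        using B[OF b x] Basis_le_norm[OF b, of h] by (intro mult_mono) auto
      then show "\<bar>(h \<bullet> b) * ?D x b\<bar> \<le> norm h * \<bar>B b\<bar>" by (simp add: abs_mult)
    qed
    finally show "norm (?D x h) \<le> ?L * norm h"
      by (simp add: sum_distrib_left[symmetric] mult.commute)
  qed
  show ?thesis
  proof
    show "0 \<le> ?L" by (simp add: sum_nonneg)
    show "\<bar>f x - f y\<bar> \<le> ?L * norm (x - y)" if "x \<in> S" "y \<in> S" for x y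
      using differentiable_bound[OF S(2) has_derivative_at_withinI[OF d] on that] by simp
  qed
qed

lemma abs_comb_le:
  fixes \<phi> :: "real^4"
  assumes "\<bar>a\<bar> \<le> 1" "\<bar>b\<bar> \<le> 1" "\<bar>c\<bar> \<le> 1" "\<bar>d\<bar> \<le> 1"
  shows "\<bar>\<phi> $ 1 + a * \<phi> $ 2 + b * \<phi> $ 3 + c * \<phi> $ 4 + d * y\<bar> \<le> 4 * norm \<phi> + \<bar>y\<bar>"
proof -
  have m: "\<bar>a * t\<bar> \<le> \<bar>t\<bar>" if "\<bar>a\<bar> \<le> 1" for a t :: real
    using mult_right_mono[OF that, of "\<bar>t\<bar>"] by (simp add: abs_mult)
  have "\<bar>\<phi> $ i\<bar> \<le> norm \<phi>" for i by (rule component_le_norm_cart)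
  from this[of 1] this[of 2] this[of 3] this[of 4] show ?thesis
    using m[OF assms(1), of "\<phi> $ 2"] m[OF assms(2), of "\<phi> $ 3"] m[OF assms(3), of "\<phi> $ 4"]
      m[OF assms(4), of y] by linarith
qed

text \<open>The common form of the three arguments of \<open>Q\<close>. It is linear in the pair
  \<open>(\<phi>, y)\<close>, so differences have the same form, and for
  \<open>\<epsilon> \<le> 1\<close> all coefficients used are at most 1 in absolute value.\<close>

definition comb :: "real \<Rightarrow> real \<Rightarrow> real \<Rightarrow> real \<Rightarrow> real^4 \<Rightarrow> real \<Rightarrow> real"
  where "comb a b c d \<phi> y = \<phi> $ 1 + a * \<phi> $ 2 + b * \<phi> $ 3 + c * \<phi> $ 4 + d * y"

lemma comb_diff: "comb a b c d \<phi> y - comb a b c d \<phi>' y' = comb a b c d (\<phi> - \<phi>') (y - y')"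
  by (simp add: comb_def algebra_simps)

lemma abs_comb:
  "\<lbrakk>\<bar>a\<bar> \<le> 1; \<bar>b\<bar> \<le> 1; \<bar>c\<bar> \<le> 1; \<bar>d\<bar> \<le> 1\<rbrakk> \<Longrightarrow> \<bar>comb a b c d \<phi> y\<bar> \<le> 4 * norm \<phi> + \<bar>y\<bar>"
  unfolding comb_def by (rule abs_comb_le)

lemma g_fun_eq:
  "g_fun \<gamma> \<tau> Q \<epsilon> \<phi> (of_D U) =
    \<gamma> * (\<phi> $ 3 - 2 * sqrt \<epsilon> * cmp1 U + sqrt \<epsilon> * (cmp3 U 1 + cmp3 U (-1)))
    - \<tau> * (\<phi> $ 1 + Q (comb (- sqrt \<epsilon>) (1/2 * \<epsilon>) (- (1/6 * \<epsilon> powr (3/2))) (\<epsilon> powr (3/2)) \<phi> (cmp3 U (-1)))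
        (comb 0 0 0 (\<epsilon> powr (3/2)) \<phi> (cmp1 U))
        (comb (sqrt \<epsilon>) (1/2 * \<epsilon>) (1/6 * \<epsilon> powr (3/2)) (\<epsilon> powr (3/2)) \<phi> (cmp3 U 1))
      + \<epsilon> powr (3/2) * cmp1 U)"
  by (cases "of_D U") (simp add: g_fun_def comb_def third_def Let_def)

lemma components_le_norm:
  "\<bar>cmp1 U\<bar> \<le> norm U" "\<bar>cmp2 U\<bar> \<le> norm U" "p \<in> {-1..1} \<Longrightarrow> \<bar>cmp3 U p\<bar> \<le> norm U"
  using norm_dspace_le_iff[of U "norm U"] by auto

lemma cmp_diff: "cmp1 (U - V) = cmp1 U - cmp1 V" "cmp3 (U - V) p = cmp3 U p - cmp3 V p"
  by (simp_all add: third_of_D_diff minus_bcontfun.rep_eq) (simp add: of_D_diff)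

text \<open>The constant is uniform in \<open>\<epsilon> \<le> 1\<close>; all smallness later comes
  from the factor \<open>sqrt \<epsilon>\<close> in front of \<open>g\<close>. The radius 1 for
  \<open>U\<close> is a fixed ball that contains the small ball of the theorem.\<close>

definition g_lip :: "real \<Rightarrow> real \<Rightarrow> (real \<Rightarrow> real \<Rightarrow> real \<Rightarrow> real) \<Rightarrow> real \<Rightarrow> real \<Rightarrow> bool"
  where "g_lip \<gamma> \<tau> Q M L \<longleftrightarrow> (\<forall>\<epsilon> \<phi> \<phi>' U U'. 0 < \<epsilon> \<and> \<epsilon> \<le> 1 \<and> norm \<phi> \<le> M \<and> norm \<phi>' \<le> M \<and>
    norm U \<le> 1 \<and> norm U' \<le> 1 \<longrightarrow>
    \<bar>g_fun \<gamma> \<tau> Q \<epsilon> \<phi> (of_D U) - g_fun \<gamma> \<tau> Q \<epsilon> \<phi>' (of_D U')\<bar> \<le> L * (norm (\<phi> - \<phi>') + norm (U - U')))"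

lemma g_lip_exists:
  assumes Q: "Ck 1 (\<lambda>(v, u, w). Q v u w)"
  shows "\<exists>L\<ge>1. g_lip \<gamma> \<tau> Q M L"
proof -
  \<comment> \<open>Each of the three arguments of \<open>Q\<close> is at most
    \<open>4 * M + 1\<close>, and the norm of a triple is at most the sum of the absolute
    values.\<close>
  define R where "R = 3 * (4 * M + 1)"
  obtain C where C0: "0 \<le> C" and C: "\<And>x y. x \<in> cball 0 R \<Longrightarrow> y \<in> cball 0 R \<Longrightarrow>
      \<bar>(\<lambda>(v, u, w). Q v u w) x - (\<lambda>(v, u, w). Q v u w) y\<bar> \<le> C * norm (x - y)"
    by (rule Ck1_lipschitz[OF Q compact_cball convex_cball]) blast
  \<comment> \<open>\<open>5\<close> counts the terms of the linear part with multiplicity,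
    \<open>2\<close> the two linear terms next to \<open>Q\<close>, and \<open>12 * C\<close> the
    three arguments of \<open>Q\<close> with up to four components of \<open>\<phi>\<close> each.
    The final \<open>1\<close> ensures \<open>L \<ge> 1\<close>.\<close>
  define L where "L = 5 * \<bar>\<gamma>\<bar> + \<bar>\<tau>\<bar> * (2 + 12 * C) + 1"
  have "g_lip \<gamma> \<tau> Q M L"
    unfolding g_lip_def
  proof (intro allI impI, elim conjE)
    fix \<epsilon> :: real and \<phi> \<phi>' :: "real^4" and U U' :: dspace
    assume \<epsilon>: "0 < \<epsilon>" "\<epsilon> \<le> 1" and \<phi>: "norm \<phi> \<le> M" "norm \<phi>' \<le> M" and U: "norm U \<le> 1" "norm U' \<le> 1"
    define s where "s = sqrt \<epsilon>"
    define e where "e = \<epsilon> powr (3/2)"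
    have s: "0 \<le> s" "s \<le> 1" using \<epsilon> by (auto simp: s_def)
    have e: "0 \<le> e" "e \<le> 1" using \<epsilon> by (auto simp: e_def intro: powr_le1)
    define n where "n = norm (\<phi> - \<phi>') + norm (U - U')"
    have n: "norm (\<phi> - \<phi>') \<le> n" "norm (U - U') \<le> n" "0 \<le> n" by (auto simp: n_def)
    define A where "A = (\<lambda>\<phi> U. comb (- s) (1/2 * \<epsilon>) (- (1/6 * e)) e \<phi> (cmp3 U (-1)))"
    define B where "B = (\<lambda>\<phi> U. comb 0 0 0 e \<phi> (cmp1 U))"
    define D where "D = (\<lambda>\<phi> U. comb s (1/2 * \<epsilon>) (1/6 * e) e \<phi> (cmp3 U 1))"
    define lin where "lin = (\<lambda>(\<phi>::real^4) U. \<phi> $ 3 - 2 * s * cmp1 U + s * (cmp3 U 1 + cmp3 U (-1)))"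
    have g: "g_fun \<gamma> \<tau> Q \<epsilon> \<phi> (of_D U) =
        \<gamma> * lin \<phi> U - \<tau> * (\<phi> $ 1 + Q (A \<phi> U) (B \<phi> U) (D \<phi> U) + e * cmp1 U)" for \<phi> U
      unfolding g_fun_eq lin_def A_def B_def D_def s_def e_def ..
    have ABD: "\<bar>A \<phi> U\<bar> \<le> 4 * norm \<phi> + norm U" "\<bar>B \<phi> U\<bar> \<le> 4 * norm \<phi> + norm U" "\<bar>D \<phi> U\<bar> \<le> 4 * norm \<phi> + norm U" for \<phi> U
      unfolding A_def B_def D_def using s e \<epsilon>
      by (auto intro!: order_trans[OF abs_comb] components_le_norm)
    have diff: "A \<phi> U - A \<phi>' U' = A (\<phi> - \<phi>') (U - U')" "B \<phi> U - B \<phi>' U' = B (\<phi> - \<phi>') (U - U')"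
      "D \<phi> U - D \<phi>' U' = D (\<phi> - \<phi>') (U - U')" "lin \<phi> U - lin \<phi>' U' = lin (\<phi> - \<phi>') (U - U')" for \<phi> \<phi>' U U'
      unfolding A_def B_def D_def lin_def comb_diff cmp_diff by (simp_all add: algebra_simps)
    have n3: "norm (a, b, c) \<le> \<bar>a\<bar> + \<bar>b\<bar> + \<bar>c\<bar>" for a b c :: real
      using norm_Pair_le[of a "(b, c)"] norm_Pair_le[of b c] by simp
    have ball: "(A \<phi> U, B \<phi> U, D \<phi> U) \<in> cball 0 R" if "norm \<phi> \<le> M" "norm U \<le> 1" for \<phi> U
      using ABD[where \<phi> = \<phi> and U = U] n3[of "A \<phi> U" "B \<phi> U" "D \<phi> U"] that by (simp add: R_def)
    have "\<bar>Q (A \<phi> U) (B \<phi> U) (D \<phi> U) - Q (A \<phi>' U') (B \<phi>' U') (D \<phi>' U')\<bar>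
        \<le> C * norm ((A \<phi> U, B \<phi> U, D \<phi> U) - (A \<phi>' U', B \<phi>' U', D \<phi>' U'))"
      using C[OF ball[OF \<phi>(1) U(1)] ball[OF \<phi>(2) U(2)]] by simp
    also have "\<dots> \<le> C * (12 * n)"
    proof (rule mult_left_mono[OF _ C0])
      have "norm (A (\<phi> - \<phi>') (U - U'), B (\<phi> - \<phi>') (U - U'), D (\<phi> - \<phi>') (U - U')) \<le> 3 * (4 * norm (\<phi> - \<phi>') + norm (U - U'))"
      proof -
        have "norm (A (\<phi> - \<phi>') (U - U'), B (\<phi> - \<phi>') (U - U'), D (\<phi> - \<phi>') (U - U')) \<le>
          (4 * norm (\<phi> - \<phi>') + norm (U - U')) + (4 * norm (\<phi> - \<phi>') + norm (U - U')) + (4 * norm (\<phi> - \<phi>') + norm (U - U'))"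
          by (rule order_trans[OF n3]) (intro add_mono ABD)
        then show ?thesis by simp
      qed
      also have "\<dots> \<le> 12 * n" unfolding n_def by simp
      finally show "norm ((A \<phi> U, B \<phi> U, D \<phi> U) - (A \<phi>' U', B \<phi>' U', D \<phi>' U')) \<le> 12 * n"
        by (simp add: diff)
    qed
    finally have q: "\<bar>Q (A \<phi> U) (B \<phi> U) (D \<phi> U) - Q (A \<phi>' U') (B \<phi>' U') (D \<phi>' U')\<bar> \<le> 12 * C * n" by simp
    have c: "\<bar>(\<phi> - \<phi>') $ i\<bar> \<le> n" for i
      using component_le_norm_cart[of "\<phi> - \<phi>'" i] n(1) by linarith
    have u: "\<bar>cmp1 (U - U')\<bar> \<le> n" "\<bar>cmp3 (U - U') 1\<bar> \<le> n" "\<bar>cmp3 (U - U') (-1)\<bar> \<le> n"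
      using components_le_norm(1)[of "U - U'"] components_le_norm(3)[of 1 "U - U'"]
        components_le_norm(3)[of "-1" "U - U'"] n(2) by auto
    have m: "\<bar>a * t\<bar> \<le> n" if "0 \<le> a" "a \<le> 1" "\<bar>t\<bar> \<le> n" for a t :: real
      using mult_mono[OF that(2,3)] that by (simp add: abs_mult)
    have l: "\<bar>lin \<phi> U - lin \<phi>' U'\<bar> \<le> 5 * n"
    proof -
      have "\<bar>t - 2 * s * a + s * (b + d)\<bar> \<le> 5 * n"
        if "\<bar>t\<bar> \<le> n" "\<bar>s * a\<bar> \<le> n" "\<bar>s * b\<bar> \<le> n" "\<bar>s * d\<bar> \<le> n" for t a b d
      proof -
        have "t - 2 * s * a + s * (b + d) = t - 2 * (s * a) + s * b + s * d" by (simp add: algebra_simps)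
        then show ?thesis using that by linarith
      qed
      from this[OF c[of 3] m[OF s u(1)] m[OF s u(2)] m[OF s u(3)]]
      show ?thesis unfolding diff unfolding lin_def .
    qed
    have r: "\<bar>(\<phi> $ 1 + Q (A \<phi> U) (B \<phi> U) (D \<phi> U) + e * cmp1 U)
        - (\<phi>' $ 1 + Q (A \<phi>' U') (B \<phi>' U') (D \<phi>' U') + e * cmp1 U')\<bar> \<le> (2 + 12 * C) * n"
      using c[of 1] m[OF e u(1)] q by (simp add: cmp_diff algebra_simps)
    have "\<bar>g_fun \<gamma> \<tau> Q \<epsilon> \<phi> (of_D U) - g_fun \<gamma> \<tau> Q \<epsilon> \<phi>' (of_D U')\<bar>
       = \<bar>\<gamma> * (lin \<phi> U - lin \<phi>' U') - \<tau> * ((\<phi> $ 1 + Q (A \<phi> U) (B \<phi> U) (D \<phi> U) + e * cmp1 U)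
        - (\<phi>' $ 1 + Q (A \<phi>' U') (B \<phi>' U') (D \<phi>' U') + e * cmp1 U'))\<bar>"
      unfolding g by (simp add: algebra_simps)
    also have "\<dots> \<le> \<bar>\<gamma>\<bar> * (5 * n) + \<bar>\<tau>\<bar> * ((2 + 12 * C) * n)"
      using mult_left_mono[OF l, of "\<bar>\<gamma>\<bar>"] mult_left_mono[OF r, of "\<bar>\<tau>\<bar>"]
      by (intro order_trans[OF abs_triangle_ineq4] add_mono) (simp_all add: abs_mult)
    also have "\<dots> \<le> L * n" using n(3) by (simp add: L_def algebra_simps)
    finally show "\<bar>g_fun \<gamma> \<tau> Q \<epsilon> \<phi> (of_D U) - g_fun \<gamma> \<tau> Q \<epsilon> \<phi>' (of_D U')\<bar> \<le> L * (norm (\<phi> - \<phi>') + norm (U - U'))"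
      by (simp add: n_def)
  qed
  moreover have "L \<ge> 1" using C0 by (simp add: L_def)
  ultimately show ?thesis by blast
qed

section \<open>Existence, uniqueness and asymptotics\<close>

definition rhs :: "real \<Rightarrow> real \<Rightarrow> (real \<Rightarrow> real \<Rightarrow> real \<Rightarrow> real) \<Rightarrow> real \<Rightarrow> (real \<Rightarrow> real^4) \<Rightarrow> (real \<Rightarrow> dspace) \<Rightarrow> real \<Rightarrow> real"
  where "rhs \<gamma> \<tau> Q \<epsilon> \<phi> \<psi> z = sqrt \<epsilon> * g_fun \<gamma> \<tau> Q \<epsilon> (\<phi> (sqrt \<epsilon> * z)) (of_D (\<psi> z))"

lemma lin_sol_norm_le:
  fixes u :: "real \<Rightarrow>\<^sub>C dspace"
  assumes u: "lin_sol f u" and f: "\<And>z. \<bar>f z\<bar> \<le> F"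
  shows "norm (u z) \<le> 56 * F"
proof (rule field_le_epsilon)
  fix e :: real assume e: "0 < e"
  have "\<bar>cmp1 (u z)\<bar> \<le> norm u" for z
    using components_le_norm(1)[of "u z"] norm_bounded[of u z] by linarith
  from lin_sol_estimate[OF u this shift_stable_filters(1) _ e, of F] f
  show "norm (u z) \<le> 56 * F + e" by simp
qed

section \<open>The nonlinear problem for small \<open>\<epsilon>\<close>\<close>

context
  fixes \<gamma> \<tau> M L \<epsilon> :: real and Q :: "real \<Rightarrow> real \<Rightarrow> real \<Rightarrow> real"
  assumes Qodd: "\<And>v u w. Q (- v) (- u) (- w) = - Q v u w"
    and Qsym: "\<And>v u w. Q v u w = Q w u v"
    and lip: "g_lip \<gamma> \<tau> Q M L" and L: "1 \<le> L" and M: "0 < M"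
    and \<epsilon>: "0 < \<epsilon>" "\<epsilon> \<le> 1" and small: "sqrt \<epsilon> * (56 * L * (M + 1)) \<le> 1/2"
begin

abbreviation "Rhs \<equiv> rhs \<gamma> \<tau> Q \<epsilon>"

lemma rhs_lipschitz:
  fixes \<phi> \<phi>' :: "real \<Rightarrow>\<^sub>C (real^4)" and \<psi> \<psi>' :: "real \<Rightarrow>\<^sub>C dspace"
  assumes "norm \<phi> \<le> M" "norm \<phi>' \<le> M" "norm \<psi> \<le> 1" "norm \<psi>' \<le> 1"
  shows "\<bar>Rhs \<phi> \<psi> z - Rhs \<phi>' \<psi>' z'\<bar> \<le>
    sqrt \<epsilon> * L * (norm (\<phi> (sqrt \<epsilon> * z) - \<phi>' (sqrt \<epsilon> * z')) + norm (\<psi> z - \<psi>' z'))"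
proof -
  have "\<bar>g_fun \<gamma> \<tau> Q \<epsilon> (\<phi> (sqrt \<epsilon> * z)) (of_D (\<psi> z)) - g_fun \<gamma> \<tau> Q \<epsilon> (\<phi>' (sqrt \<epsilon> * z')) (of_D (\<psi>' z'))\<bar>
      \<le> L * (norm (\<phi> (sqrt \<epsilon> * z) - \<phi>' (sqrt \<epsilon> * z')) + norm (\<psi> z - \<psi>' z'))"
    using lip assms \<epsilon> unfolding g_lip_def
    by (simp add: order_trans[OF norm_bounded])
  from mult_left_mono[OF this, of "sqrt \<epsilon>"] show ?thesis
    using \<epsilon> by (simp add: rhs_def right_diff_distrib[symmetric] abs_mult mult.assoc)
qed

text \<open>Oddness gives \<open>Q 0 0 0 = 0\<close>, so \<open>g\<close> vanishes for
  \<open>\<phi> = 0\<close> and \<open>\<psi> = 0\<close>, and the Lipschitz estimate is applied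
  against this pair.\<close>

lemma rhs_bound:
  fixes \<phi> :: "real \<Rightarrow>\<^sub>C (real^4)" and \<psi> :: "real \<Rightarrow>\<^sub>C dspace"
  assumes \<phi>: "norm \<phi> \<le> M" and \<psi>: "norm \<psi> \<le> 1"
  shows "\<bar>Rhs \<phi> \<psi> z\<bar> \<le> sqrt \<epsilon> * L * (M + 1)"
proof -
  have "Rhs (0 :: real \<Rightarrow>\<^sub>C (real^4)) (0 :: real \<Rightarrow>\<^sub>C dspace) z = 0"
  proof -
    have "Q 0 0 0 = 0" using Qodd[of 0 0 0] by simp
    then show ?thesis
      unfolding rhs_def zero_bcontfun.rep_eq g_fun_eq comb_def
      by (simp add: zero_dspace.rep_eq third_def zero_bcontfun.rep_eq)
  qed
  moreover have "norm (\<phi> (sqrt \<epsilon> * z)) \<le> M" "norm (\<psi> z) \<le> 1"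
    by (rule order_trans[OF norm_bounded \<phi>] order_trans[OF norm_bounded \<psi>])+
  then have "sqrt \<epsilon> * L * (norm (\<phi> (sqrt \<epsilon> * z)) + norm (\<psi> z)) \<le> sqrt \<epsilon> * L * (M + 1)"
    using \<epsilon> L by (intro mult_left_mono) auto
  ultimately show ?thesis
    using rhs_lipschitz[of \<phi> 0 \<psi> 0 z z] \<phi> \<psi> M by simp
qed

lemma rhs_continuous:
  fixes \<phi> :: "real \<Rightarrow>\<^sub>C (real^4)" and \<psi> :: "real \<Rightarrow>\<^sub>C dspace"
  assumes \<phi>: "norm \<phi> \<le> M" and \<psi>: "norm \<psi> \<le> 1"
  shows "continuous_on UNIV (Rhs \<phi> \<psi>)"
  unfolding continuous_on_def
proof
  fix z0 :: real
  let ?N = "\<lambda>z. sqrt \<epsilon> * L * (norm (\<phi> (sqrt \<epsilon> * z) - \<phi> (sqrt \<epsilon> * z0)) + norm (\<psi> z - \<psi> z0))"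
  have "continuous_on UNIV ?N"
    by (intro continuous_intros continuous_on_compose2[OF continuous_on_apply_bcontfun[of UNIV \<phi>]] continuous_on_apply_bcontfun) auto
  then have "(?N \<longlongrightarrow> ?N z0) (at z0 within UNIV)" unfolding continuous_on_def by blast
  then have N: "(?N \<longlongrightarrow> 0) (at z0 within UNIV)" by simp
  have "((\<lambda>z. Rhs \<phi> \<psi> z - Rhs \<phi> \<psi> z0) \<longlongrightarrow> 0) (at z0 within UNIV)"
    by (rule Lim_null_comparison[OF _ N]) (use rhs_lipschitz[OF \<phi> \<phi> \<psi> \<psi>] in auto)
  then show "(Rhs \<phi> \<psi> \<longlongrightarrow> Rhs \<phi> \<psi> z0) (at z0 within UNIV)" by (rule LIM_zero_cancel)
qed

lemma solution_iff:
  fixes \<phi> :: "real \<Rightarrow>\<^sub>C (real^4)" and \<psi> :: "real \<Rightarrow>\<^sub>C dspace"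
  assumes "norm \<phi> \<le> M" "norm \<psi> \<le> 1"
  shows "solution \<gamma> \<tau> Q \<epsilon> \<phi> \<psi> \<longleftrightarrow> lin_sol (Rhs \<phi> \<psi>) \<psi>"
proof -
  have "(\<exists>d. (w has_vector_derivative d) (at z) \<and> d - l = r) \<longleftrightarrow> (w has_vector_derivative l + r) (at z)"
    for w :: "real \<Rightarrow> real hspace" and z l r
  proof
    assume "\<exists>d. (w has_vector_derivative d) (at z) \<and> d - l = r"
    then obtain d where d: "(w has_vector_derivative d) (at z)" "d - l = r" by blast
    have "d = l + r" unfolding d(2)[symmetric] by simp
    then show "(w has_vector_derivative l + r) (at z)" using d(1) by simp
  qed (intro exI[of _ "l + r"], simp)
  then show ?thesis
    using rhs_continuous[OF assms] unfolding solution_def lin_sol_def by (simp add: rhs_def)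
qed

text \<open>A bootstrap: inside the unit ball the source is of order \<open>sqrt \<epsilon>\<close>,
  and the linear estimate passes this on to the solution.\<close>

lemma lin_sol_rhs_norm_le:
  fixes \<phi> :: "real \<Rightarrow>\<^sub>C (real^4)" and \<psi> :: "real \<Rightarrow>\<^sub>C dspace"
  assumes \<phi>: "norm \<phi> \<le> M" and \<psi>: "norm \<psi> \<le> 1" and sol: "lin_sol (Rhs \<phi> \<psi>) \<psi>"
  shows "norm \<psi> \<le> sqrt \<epsilon> * (56 * L * (M + 1))"
proof (rule norm_bound)
  fix z
  have "norm (\<psi> z) \<le> 56 * (sqrt \<epsilon> * L * (M + 1))"
    by (rule lin_sol_norm_le[OF sol rhs_bound[OF \<phi> \<psi>]])
  then show "norm (\<psi> z) \<le> sqrt \<epsilon> * (56 * L * (M + 1))" by (simp add: algebra_simps)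
qed

lemma small_L: "56 * (sqrt \<epsilon> * L) \<le> 1/2"
proof -
  have "56 * (sqrt \<epsilon> * L) * 1 \<le> 56 * (sqrt \<epsilon> * L) * (M + 1)"
    using \<epsilon> L M by (intro mult_left_mono) auto
  also have "56 * (sqrt \<epsilon> * L) * (M + 1) = sqrt \<epsilon> * (56 * L * (M + 1))"
    by (simp only: mult_ac)
  finally show ?thesis using small by linarith
qed

text \<open>The difference solves the linear problem with the difference of the sources. That source
  contains the difference of solutions itself, with a factor which after the linear estimate is at
  most \<open>1/2\<close>; iteration leaves only the contribution of
  \<open>\<phi> - \<phi>'\<close>.\<close>

lemma comparison:
  fixes \<phi> \<phi>' :: "real \<Rightarrow>\<^sub>C (real^4)" and \<psi> \<psi>' :: "real \<Rightarrow>\<^sub>C dspace"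
  assumes \<phi>: "norm \<phi> \<le> M" "norm \<phi>' \<le> M" and \<psi>: "norm \<psi> \<le> 1" "norm \<psi>' \<le> 1"
    and sol: "lin_sol (Rhs \<phi> \<psi>) \<psi>" "lin_sol (Rhs \<phi>' \<psi>') \<psi>'"
    and X: "shift_stable \<X>"
    and lim: "((\<lambda>z. \<phi> (sqrt \<epsilon> * z) - \<phi>' (sqrt \<epsilon> * z)) \<longlongrightarrow> 0) \<X>"
    and \<eta>: "\<eta> > 0"
  shows "eventually (\<lambda>z. norm (\<psi> z - \<psi>' z) \<le> \<eta>) \<X>"
proof -
  have n2: "norm (\<psi> z - \<psi>' z) \<le> 2" for z
    using norm_triangle_ineq4[of "\<psi> z" "\<psi>' z"] norm_bounded[of \<psi> z] norm_bounded[of \<psi>' z] \<psi> by linarith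
  have \<phi>lim: "eventually (\<lambda>z. norm (\<phi> (sqrt \<epsilon> * z) - \<phi>' (sqrt \<epsilon> * z)) \<le> \<eta> / 4) \<X>"
    using tendstoD[OF lim, of "\<eta> / 4"] \<eta> by (auto elim: eventually_mono)
  \<comment> \<open>A bound \<open>Y\<close> improves to
    \<open>1/2 * (\<eta> / 4 + Y) + \<eta> / 4\<close>, with fixed point
    \<open>3 * \<eta> / 4\<close>; the last \<open>\<eta> / 4\<close> is the slack of the iteration,
    and \<open>A = 2\<close> bounds two curves in the unit ball.\<close>
  have "eventually (\<lambda>z. norm (\<psi> z - \<psi>' z) \<le> 3 * \<eta> / 4 + \<eta> / 4) \<X>"
  proof (rule eventually_le_iterate[where q = "1/2" and A = 2])
    fix Y assume Y: "eventually (\<lambda>z. norm (\<psi> z - \<psi>' z) \<le> Y) \<X>"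
    have f: "eventually (\<lambda>z. \<bar>Rhs \<phi> \<psi> z - Rhs \<phi>' \<psi>' z\<bar> \<le> sqrt \<epsilon> * L * (\<eta> / 4 + Y)) \<X>"
      using Y \<phi>lim
    proof eventually_elim
      case (elim z)
      have "\<bar>Rhs \<phi> \<psi> z - Rhs \<phi>' \<psi>' z\<bar> \<le>
          sqrt \<epsilon> * L * (norm (\<phi> (sqrt \<epsilon> * z) - \<phi>' (sqrt \<epsilon> * z)) + norm (\<psi> z - \<psi>' z))"
        by (rule rhs_lipschitz[OF \<phi> \<psi>])
      also have "\<dots> \<le> sqrt \<epsilon> * L * (\<eta> / 4 + Y)"
        using elim \<epsilon> L by (intro mult_left_mono add_mono) auto
      finally show ?case .
    qed
    have b: "\<bar>cmp1 (\<psi> z - \<psi>' z)\<bar> \<le> 2" for z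
      using components_le_norm(1)[of "\<psi> z - \<psi>' z"] n2[of z] by linarith
    have "0 < \<eta> / 4" using \<eta> by simp
    from lin_sol_estimate[OF lin_sol_diff[OF sol] b X f this] Y
    show "eventually (\<lambda>z. norm (\<psi> z - \<psi>' z) \<le> 1/2 * Y + (1 - 1/2) * (3 * \<eta> / 4)) \<X>"
    proof eventually_elim
      case (elim z)
      have "0 \<le> Y" using elim(2) norm_ge_zero[of "\<psi> z - \<psi>' z"] by linarith
      then have "56 * (sqrt \<epsilon> * L) * (\<eta> / 4 + Y) \<le> 1/2 * (\<eta> / 4 + Y)"
        using small_L \<eta> by (intro mult_right_mono) auto
      then have "norm (\<psi> z - \<psi>' z) \<le> 1/2 * (\<eta> / 4 + Y) + \<eta> / 4"
        unfolding mult.assoc by (rule order_trans[OF elim(1)[unfolded mult.assoc] add_right_mono])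
      then show ?case by (simp add: field_simps)
    qed
  qed (use n2 \<eta> in auto)
  then show ?thesis by simp
qed

text \<open>The comparison along \<open>top\<close>, where an eventual property holds everywhere,
  with the same \<open>\<phi>\<close> on both sides. Uniqueness is obtained in the unit ball, so
  reflected and translated curves qualify directly.\<close>

lemma unique:
  fixes \<phi> :: "real \<Rightarrow>\<^sub>C (real^4)" and \<psi> \<psi>' :: "real \<Rightarrow>\<^sub>C dspace"
  assumes \<phi>: "norm \<phi> \<le> M" and \<psi>: "norm \<psi> \<le> 1" "norm \<psi>' \<le> 1"
    and sol: "lin_sol (Rhs \<phi> \<psi>) \<psi>" "lin_sol (Rhs \<phi> \<psi>') \<psi>'"
  shows "\<psi> = \<psi>'"
proof (rule bcontfun_eqI)
  fix z
  have "norm (\<psi> z - \<psi>' z) \<le> 0 + e" if "e > 0" for e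
    using comparison[OF \<phi> \<phi> \<psi> sol shift_stable_filters(1) _ that] by simp
  then have "norm (\<psi> z - \<psi>' z) \<le> 0" by (rule field_le_epsilon)
  then show "\<psi> z = \<psi>' z" by simp
qed

text \<open>The iteration takes place on the source \<open>f\<close>: \<open>u f\<close> is the
  linear response to \<open>f\<close>, and a fixed point of
  \<open>f \<mapsto> Rhs \<phi> (u f)\<close> makes \<open>u f\<close> a solution. Completeness is
  thus needed for scalar functions only, not for curves in \<open>dspace\<close>.\<close>

lemma lin_sol_exists_rhs:
  fixes \<phi> :: "real \<Rightarrow>\<^sub>C (real^4)"
  assumes \<phi>: "norm \<phi> \<le> M"
  shows "\<exists>\<psi>. norm \<psi> \<le> 1 \<and> lin_sol (Rhs \<phi> (apply_bcontfun \<psi>)) (apply_bcontfun \<psi>)"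
proof -
  \<comment> \<open>The a priori bound of the source. The linear estimate gives
    \<open>56 * R \<le> 1/2\<close>, so responses to sources in \<open>S\<close> remain in the unit
    ball.\<close>
  define R where "R = sqrt \<epsilon> * L * (M + 1)"
  have R0: "0 \<le> R" using \<epsilon> L M by (simp add: R_def)
  define S where "S = cball (0 :: real \<Rightarrow>\<^sub>C real) R"
  have "\<exists>u :: real \<Rightarrow>\<^sub>C dspace. lin_sol f u" for f :: "real \<Rightarrow>\<^sub>C real"
    by (rule lin_exists[of f "norm f"]) (use norm_bounded[of f] in \<open>auto intro: continuous_on_apply_bcontfun\<close>)
  then obtain u :: "(real \<Rightarrow>\<^sub>C real) \<Rightarrow> (real \<Rightarrow>\<^sub>C dspace)" where u: "\<And>f. lin_sol (apply_bcontfun f) (apply_bcontfun (u f))"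
    by metis
  have u1: "norm (u f) \<le> 1" if "f \<in> S" for f
  proof (rule norm_bound)
    fix z
    have "\<bar>f z\<bar> \<le> R" for z using norm_bounded[of f z] that by (simp add: S_def)
    from lin_sol_norm_le[OF u this] have "norm (u f z) \<le> 56 * R" .
    also have "56 * R = sqrt \<epsilon> * (56 * L * (M + 1))" unfolding R_def by (simp only: mult_ac)
    also have "\<dots> \<le> 1" by (rule order_trans[OF small]) simp
    finally show "norm (u f z) \<le> 1" .
  qed
  define T where "T f = Bcontfun (Rhs \<phi> (u f))" for f
  have T: "apply_bcontfun (T f) = Rhs \<phi> (u f)" if "f \<in> S" for f
    unfolding T_def
    by (rule Bcontfun_inverse)
       (use rhs_bound[OF \<phi> u1[OF that]] rhs_continuous[OF \<phi> u1[OF that]] in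
         \<open>auto simp: bcontfun_def bounded_iff intro!: exI[of _ R, unfolded R_def]\<close>)
  have "\<exists>!f. f \<in> S \<and> T f = f"
  proof (rule Banach_fix[where c = "1/2"])
    show "complete S" unfolding S_def by (simp add: complete_eq_closed)
    show "S \<noteq> {}" using R0 by (auto simp: S_def)
    show "T ` S \<subseteq> S"
    proof (rule image_subsetI)
      fix f assume f: "f \<in> S"
      have "norm (T f) \<le> R"
        by (rule norm_bound) (use rhs_bound[OF \<phi> u1[OF f]] in \<open>simp add: T[OF f] R_def\<close>)
      then show "T f \<in> S" by (simp add: S_def)
    qed
    fix f h assume fh: "f \<in> S" "h \<in> S"
    show "dist (T f) (T h) \<le> 1/2 * dist f h"
    proof (rule dist_bound)
      fix z
      have d: "\<bar>f z - h z\<bar> \<le> dist f h" for z using dist_bounded[of f z h] by (simp add: dist_real_def)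
      have "lin_sol (\<lambda>z. f z - h z) (u f - u h)"
        using lin_sol_diff[OF u u, of f h] by (simp add: minus_bcontfun.rep_eq fun_diff_def)
      from lin_sol_norm_le[OF this d] have n: "norm (u f z - u h z) \<le> 56 * dist f h"
        by (simp add: minus_bcontfun.rep_eq)
      have "\<bar>Rhs \<phi> (u f) z - Rhs \<phi> (u h) z\<bar> \<le> sqrt \<epsilon> * L * norm (u f z - u h z)"
        using rhs_lipschitz[OF \<phi> \<phi> u1[OF fh(1)] u1[OF fh(2)], of z z] by simp
      also have "\<dots> \<le> sqrt \<epsilon> * L * (56 * dist f h)"
        using \<epsilon> L n by (intro mult_left_mono) auto
      also have "\<dots> = 56 * (sqrt \<epsilon> * L) * dist f h" by simp
      also have "\<dots> \<le> 1/2 * dist f h"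
        using small_L by (intro mult_right_mono) auto
      finally show "dist (T f z) (T h z) \<le> 1/2 * dist f h" by (simp add: T fh dist_real_def)
    qed
  qed auto
  then obtain f where f: "f \<in> S" "T f = f" by blast
  have "lin_sol (Rhs \<phi> (u f)) (u f)" using u[of f] T[OF f(1)] f(2) by simp
  then show ?thesis using u1[OF f(1)] by blast
qed

end

section \<open>Time rescaling, translations and limit orbits\<close>

lemma compress_time:
  assumes lim: "filterlim (\<lambda>z. sqrt \<epsilon> * z) \<X> \<X>"
    and P: "tends_to_orbit \<X> \<phi> P \<theta>"
  shows "((\<lambda>z. \<phi> (sqrt \<epsilon> * z) - P (sqrt \<epsilon> * z + \<theta>)) \<longlongrightarrow> 0) \<X>"
  using filterlim_compose[OF P[unfolded tends_to_orbit_def] lim] .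

lemma compress_filters:
  assumes "0 < \<epsilon>"
  shows
  "filterlim (\<lambda>z. sqrt \<epsilon> * z) at_top at_top" "filterlim (\<lambda>z. sqrt \<epsilon> * z) at_bot at_bot"
  using assms by (auto intro!: filterlim_tendsto_pos_mult_at_top[OF tendsto_const _ filterlim_ident]
      filterlim_tendsto_pos_mult_at_bot[OF tendsto_const _ filterlim_ident])

definition shift :: "real \<Rightarrow> (real \<Rightarrow>\<^sub>C 'a::metric_space) \<Rightarrow> (real \<Rightarrow>\<^sub>C 'a)"
  where "shift a f = Bcontfun (\<lambda>t. f (t + a))"

lemma shift_apply [simp]: "shift a f t = f (t + a)"
proof -
  have "continuous_on UNIV (\<lambda>t. f (t + a))"
    by (rule continuous_on_compose2[OF continuous_on_apply_bcontfun[of UNIV f]])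
       (auto intro!: continuous_intros)
  moreover have "bounded (range (\<lambda>t. f (t + a)))"
    by (rule bounded_subset[OF bounded_apply_bcontfun[of f]]) auto
  ultimately show ?thesis
    unfolding shift_def by (subst Bcontfun_inverse) (auto simp: bcontfun_def)
qed

lemma norm_shift_le:
  fixes f :: "real \<Rightarrow>\<^sub>C 'a::real_normed_vector"
  shows "norm f \<le> C \<Longrightarrow> norm (shift a f) \<le> C"
  by (rule norm_bound) (simp add: order_trans[OF norm_bounded])

lemma lin_sol_shift:
  assumes "lin_sol f u"
  shows "lin_sol (\<lambda>z. f (z + a)) (\<lambda>z. u (z + a))"
proof -
  have "((\<lambda>z. of_D (u (z + a))) has_vector_derivative L10 (u (z + a)) + f (z + a) *\<^sub>R F0) (at z)" for z
  proof -
    have 1: "((\<lambda>z. z + a) has_vector_derivative 1) (at z)"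
      by (auto intro!: derivative_eq_intros)
    have 2: "((\<lambda>z. of_D (u z)) has_vector_derivative L10 (u (z + a)) + f (z + a) *\<^sub>R F0) (at (z + a))"
      using assms by (simp only: lin_sol_def)
    show ?thesis using vector_diff_chain_at[OF 1 2] by (simp only: o_def scaleR_one)
  qed
  moreover have "continuous_on UNIV (\<lambda>z. f (z + a))"
  proof -
    have "continuous_on UNIV f" using assms unfolding lin_sol_def by blast
    then show ?thesis by (rule continuous_on_compose2) (auto intro!: continuous_intros)
  qed
  ultimately show ?thesis using assms unfolding lin_sol_def by blast
qed

lemma periodic_nat:
  assumes "periodic T P"
  shows "P (t + of_nat n * T) = P t" "P (t - of_nat n * T) = P t"
proof -
  have *: "P (t + of_nat n * T) = P t" for t
  proof (induction n)
    case (Suc n)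
    have "P ((t + of_nat n * T) + T) = P (t + of_nat n * T)" using assms by (simp only: periodic_def)
    then show ?case using Suc by (simp add: algebra_simps)
  qed simp
  show "P (t + of_nat n * T) = P t" "P (t - of_nat n * T) = P t"
    using *[of t] *[of "t - of_nat n * T"] by simp_all
qed

text \<open>Needed so that the existence result applies to the limit \<open>P\<close> as well. By
  periodicity each value \<open>P t\<close> is the limit of values of \<open>\<phi>\<close> along
  \<open>t - \<theta> + n * T\<close>, or \<open>t - \<theta> - n * T\<close> for the other
  end.\<close>

lemma norm_limit_orbit_le:
  fixes \<phi> P :: "real \<Rightarrow>\<^sub>C 'a::real_normed_vector"
  assumes \<phi>: "norm \<phi> \<le> M" and P: "periodic T P"
    and t: "tends_to_orbit at_top \<phi> P \<theta> \<or> tends_to_orbit at_bot \<phi> P \<theta>"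
  shows "norm P \<le> M"
proof (rule norm_bound)
  fix t
  have T: "T > 0" using P by (simp add: periodic_def)
  have top: "filterlim (\<lambda>n. a + of_nat n * T) at_top sequentially" for a
    using T by (intro filterlim_tendsto_add_at_top[OF tendsto_const]
      filterlim_at_top_mult_tendsto_pos[OF tendsto_const] filterlim_real_sequentially)
  have bot: "filterlim (\<lambda>n. - ((\<theta> - t) + of_nat n * T)) at_bot sequentially"
    using top[of "\<theta> - t"] unfolding filterlim_uminus_at_top .
  obtain s :: "nat \<Rightarrow> real" where s: "(\<lambda>n. \<phi> (s n) - P (s n + \<theta>)) \<longlonglongrightarrow> 0"
    and sP: "\<And>n. P (s n + \<theta>) = P t"
    using t
  proof (elim disjE)
    assume p: "tends_to_orbit at_top \<phi> P \<theta>"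
    show ?thesis
      by (rule that[OF filterlim_compose[OF p[unfolded tends_to_orbit_def] top[of "t - \<theta>"]]])
         (use periodic_nat(1)[OF P, of t] in \<open>simp add: algebra_simps\<close>)
  next
    assume p: "tends_to_orbit at_bot \<phi> P \<theta>"
    show ?thesis
      by (rule that[OF filterlim_compose[OF p[unfolded tends_to_orbit_def] bot]])
         (use periodic_nat(2)[OF P, of t] in \<open>simp add: algebra_simps\<close>)
  qed
  have "(\<lambda>n. \<phi> (s n) - P t) \<longlonglongrightarrow> 0" using s unfolding sP .
  then have "(\<lambda>n. norm (\<phi> (s n))) \<longlonglongrightarrow> norm (P t)"
    by (intro tendsto_norm) (rule LIM_zero_cancel)
  then show "norm (P t) \<le> M"
    by (rule LIMSEQ_le_const2) (use order_trans[OF norm_bounded \<phi>] in blast)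
qed

section \<open>Reversibility\<close>

text \<open>Minus the reversibility operator, so that anti-reversibility becomes invariance of the
  curve under reflection combined with time reversal. Such an invariance follows from
  uniqueness.\<close>

definition refl_H :: "real hspace \<Rightarrow> real hspace"
  where "refl_H U = (- fst U, fst (snd U), bcf (\<lambda>p. - ev (third U) (- p)))"

lemma continuous_refl: "continuous_on {-1..1} (\<lambda>p. - ev (f :: pint \<Rightarrow>\<^sub>C real) (- p))"
  by (intro continuous_intros continuous_on_compose2[OF continuous_on_ev]) auto

lemma refl_H_eq: "refl_H U = - S_rev U"
proof -
  have "bcf (\<lambda>p. - ev (third U) (- p)) = - bcf (\<lambda>p. ev (third U) (- p))"
  proof (rule bcontfun_eqI)
    have "continuous_on {-1..1} (\<lambda>p. ev (third U) (- p))"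
      by (intro continuous_intros continuous_on_compose2[OF continuous_on_ev]) auto
    then show "bcf (\<lambda>p. - ev (third U) (- p)) p = (- bcf (\<lambda>p. ev (third U) (- p))) p" for p
      by (simp add: apply_bcf continuous_refl uminus_bcontfun.rep_eq)
  qed
  then show ?thesis
    by (cases U) (simp add: refl_H_def S_rev_def third_def bcf_def)
qed

lemma ev_refl_H: "p \<in> {-1..1} \<Longrightarrow> ev (third (refl_H U)) p = - ev (third U) (- p)"
  by (simp add: refl_H_def third_def ev_bcf[OF continuous_refl])

lemma bounded_linear_refl_H: "bounded_linear refl_H"
proof -
  have "bounded_linear (\<lambda>f :: pint \<Rightarrow>\<^sub>C real. bcf (\<lambda>p. - ev f (- p)))"
  proof (rule bounded_linear_intro[where K = 1])
    fix f g :: "pint \<Rightarrow>\<^sub>C real" and r :: real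
    show "bcf (\<lambda>p. - ev (f + g) (- p)) = bcf (\<lambda>p. - ev f (- p)) + bcf (\<lambda>p. - ev g (- p))"
      by (rule bcontfun_eqI, subst apply_bcf[OF continuous_refl])
        (simp add: apply_bcf[OF continuous_refl] plus_bcontfun.rep_eq)
    show "bcf (\<lambda>p. - ev (r *\<^sub>R f) (- p)) = r *\<^sub>R bcf (\<lambda>p. - ev f (- p))"
      by (rule bcontfun_eqI, subst apply_bcf[OF continuous_refl])
        (simp add: apply_bcf[OF continuous_refl] scaleR_bcontfun.rep_eq)
    show "norm (bcf (\<lambda>p. - ev f (- p))) \<le> norm f * 1"
      by (rule norm_bound) (use norm_bounded[of f] in \<open>simp add: apply_bcf[OF continuous_refl]\<close>)
  qed
  from bounded_linear_compose[OF this bounded_linear_compose[OF bounded_linear_snd bounded_linear_snd]]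
  show ?thesis
    unfolding refl_H_def third_def
    by (intro bounded_linear_Pair bounded_linear_minus bounded_linear_fst
        bounded_linear_compose[OF bounded_linear_fst bounded_linear_snd]) simp
qed

definition refl_D :: "dspace \<Rightarrow> dspace"
  where "refl_D U = D_of (refl_H (of_D U))"

lemma has_dp_refl: "has_dp (third (refl_H (of_D U))) (bcf (\<lambda>p. cmp3_dp U (- p)))"
  unfolding refl_H_def third_def snd_conv
proof (rule has_dp_bcf)
  show "continuous_on {-1..1} (\<lambda>p. ev (dp (snd (snd (of_D U)))) (- p))"
    by (intro continuous_intros continuous_on_compose2[OF continuous_on_ev]) auto
  fix p :: real assume p: "-1 \<le> p" "p \<le> 1"
  have "uminus ` {-1..1::real} = {-1..1}" by (auto simp: image_iff intro!: bexI[of _ "- x" for x])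
  then have "(cmp3 U has_real_derivative cmp3_dp U (- p)) (at (- p) within uminus ` {-1..1})"
    using cmp3_deriv[of "- p" U] p by simp
  from DERIV_minus[OF DERIV_image_chain[OF this DERIV_minus[OF DERIV_ident]]]
  show "((\<lambda>p. - ev (snd (snd (of_D U))) (- p)) has_vector_derivative ev (dp (snd (snd (of_D U)))) (- p)) (at p within {-1..1})"
    by (simp add: o_def third_def has_real_derivative_iff_has_vector_derivative)
qed

lemma of_D_refl_D: "of_D (refl_D U) = refl_H (of_D U)"
proof -
  have "ev (third (refl_H (of_D U))) 0 = fst (refl_H (of_D U))"
    by (simp add: ev_refl_H cmp3_0) (simp add: refl_H_def)
  then show ?thesis unfolding refl_D_def
    using has_dp_refl[of U] by (intro D_of_inverse) (auto simp: dom_L_def refl_H_def third_def)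
qed

lemma refl_components:
  "cmp1 (refl_D U) = - cmp1 U" "cmp2 (refl_D U) = cmp2 U"
  "p \<in> {-1..1} \<Longrightarrow> cmp3 (refl_D U) p = - cmp3 U (- p)"
  "dp (third (of_D (refl_D U))) = bcf (\<lambda>p. cmp3_dp U (- p))"
  using dp_eq[OF has_dp_refl[of U]]
  by (simp_all add: of_D_refl_D ev_refl_H) (simp_all add: refl_H_def)

lemma cmp3_dp_refl: "p \<in> {-1..1} \<Longrightarrow> cmp3_dp (refl_D U) p = cmp3_dp U (- p)"
proof -
  have "continuous_on {-1..1} (\<lambda>p. cmp3_dp U (- p))"
    by (intro continuous_intros continuous_on_compose2[OF continuous_on_ev]) auto
  then show "p \<in> {-1..1} \<Longrightarrow> ?thesis" unfolding refl_components by (simp add: ev_bcf)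
qed

lemma norm_refl_D_le: "norm (refl_D U) \<le> norm U"
  unfolding norm_dspace_le_iff
  using norm_dspace_le_iff[of U "norm U"] by (auto simp: refl_components(1-3) cmp3_dp_refl)

lemma refl_D_diff: "refl_D U - refl_D V = refl_D (U - V)"
  unfolding of_D_inject[symmetric] of_D_diff of_D_refl_D
  by (rule linear_diff[OF bounded_linear.linear[OF bounded_linear_refl_H], symmetric])

text \<open>The reversibility of the linear system: reflection changes the sign of
  \<open>d/dp\<close> and exchanges the two end values. The minus sign is compensated by reversing
  time.\<close>

lemma L10_refl_D: "L10 (refl_D U) = - refl_H (L10 U)"
proof -
  have "bcf (\<lambda>p. cmp3_dp U (- p)) = - bcf (\<lambda>p. - cmp3_dp U (- p))"
  proof (rule bcontfun_eqI)
    have "continuous_on {-1..1} (\<lambda>p. cmp3_dp U (- p))"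
      by (intro continuous_intros continuous_on_compose2[OF continuous_on_ev]) auto
    then show "bcf (\<lambda>p. cmp3_dp U (- p)) p = (- bcf (\<lambda>p. - cmp3_dp U (- p))) p" for p
      by (simp add: apply_bcf[OF continuous_refl] apply_bcf uminus_bcontfun.rep_eq)
  qed
  then show ?thesis
    unfolding L10_eq by (simp add: refl_components) (simp add: refl_H_def third_def)
qed

lemma refl_F0: "refl_H F0 = F0"
  by (auto simp: refl_H_def F0_eq third_def ev_bcf[OF continuous_h0] h0_def intro!: bcf_cong)

text \<open>Reflection exchanges the values at \<open>q\<close> and \<open>- q\<close>, so each
  moment is preserved up to sign; hence \<open>range P_h\<close> is invariant.\<close>

lemma moment_refl: "moment n (refl_H U) = (- 1) ^ n * moment n U"
proof -
  let ?I = "\<lambda>V. integral {0..1} (\<lambda>q. (1 - q) ^ n / fact n * (ev (third V) q - (- 1) ^ n * ev (third V) (- q)))"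
  have "?I (refl_H U) = integral {0..1} (\<lambda>q. (- 1) ^ n *
      ((1 - q) ^ n / fact n * (ev (third U) q - (- 1) ^ n * ev (third U) (- q))))"
  proof (rule integral_cong)
    fix q :: real assume "q \<in> {0..1}"
    then have e: "ev (third (refl_H U)) q = - ev (third U) (- q)" "ev (third (refl_H U)) (- q) = - ev (third U) q"
      by (simp_all add: ev_refl_H)
    have s: "(- 1) ^ n * (- 1) ^ n = (1::real)" by (simp flip: power_mult_distrib)
    have "- b - m * - a = m * (a - m * b)" if "m * m = 1" for a b m :: real
      using that by algebra
    from this[OF s] show "(1 - q) ^ n / fact n * (ev (third (refl_H U)) q - (- 1) ^ n * ev (third (refl_H U)) (- q)) =
        (- 1) ^ n * ((1 - q) ^ n / fact n * (ev (third U) q - (- 1) ^ n * ev (third U) (- q)))"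
      unfolding e by (simp only: mult.left_commute)
  qed
  also have "\<dots> = (- 1) ^ n * ?I U" by (rule integral_mult_right)
  finally have I: "?I (refl_H U) = (- 1) ^ n * ?I U" .
  have "fst (refl_H U) = - fst U" "fst (snd (refl_H U)) = fst (snd U)" by (simp_all add: refl_H_def)
  then show ?thesis unfolding moment_def I by (simp only: right_diff_distrib) simp
qed

text \<open>Time reversal and \<open>L10_refl_D\<close> each contribute a minus sign. These cancel
  in the operator, while the source, whose direction \<open>F0\<close> is fixed by the reflection,
  changes sign.\<close>

lemma lin_sol_refl:
  assumes u: "lin_sol f u"
  shows "lin_sol (\<lambda>z. - f (- z)) (\<lambda>z. refl_D (u (- z)))"
proof -
  have "((\<lambda>z. of_D (refl_D (u (- z)))) has_vector_derivative
      L10 (refl_D (u (- z))) + (- f (- z)) *\<^sub>R F0) (at z)" for z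
  proof -
    interpret R: bounded_linear refl_H by (rule bounded_linear_refl_H)
    have 1: "(uminus has_vector_derivative (- 1)) (at z)"
      by (auto intro!: derivative_eq_intros)
    have 2: "((\<lambda>z. of_D (u z)) has_vector_derivative L10 (u (- z)) + f (- z) *\<^sub>R F0) (at (- z))"
      using u by (simp only: lin_sol_def)
    from R.has_vector_derivative[OF vector_diff_chain_at[OF 1 2]] show ?thesis
      unfolding of_D_refl_D L10_refl_D
      by (simp add: o_def R.add R.diff R.scaleR R.neg refl_F0)
  qed
  moreover have "continuous_on UNIV (\<lambda>z. - f (- z))"
  proof -
    have "continuous_on UNIV f" using u unfolding lin_sol_def by blast
    then have "continuous_on UNIV (\<lambda>z. f (- z))"
      by (rule continuous_on_compose2) (auto intro!: continuous_intros)
    then show ?thesis by (intro continuous_intros)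
  qed
  moreover have "of_D (refl_D (u (- z))) \<in> range P_h" for z
    using u unfolding lin_sol_def range_P_h by (simp add: of_D_refl_D moment_refl)
  ultimately show ?thesis unfolding lin_sol_def by blast
qed

definition refl_curve :: "(real \<Rightarrow>\<^sub>C dspace) \<Rightarrow> (real \<Rightarrow>\<^sub>C dspace)"
  where "refl_curve \<psi> = Bcontfun (\<lambda>z. refl_D (\<psi> (- z)))"

lemma refl_curve_apply: "refl_curve \<psi> z = refl_D (\<psi> (- z))"
proof -
  have "continuous_on UNIV refl_D"
    unfolding continuous_on_iff dist_norm refl_D_diff
    by (auto intro!: exI le_less_trans[OF norm_refl_D_le])
  then have "continuous_on UNIV (\<lambda>z. refl_D (\<psi> (- z)))"
    by (rule continuous_on_compose2)
       (auto intro!: continuous_on_compose2[OF continuous_on_apply_bcontfun[of UNIV \<psi>]] continuous_intros)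
  moreover have "bounded (range (\<lambda>z. refl_D (\<psi> (- z))))"
    unfolding bounded_iff using order_trans[OF norm_refl_D_le norm_bounded] by blast
  ultimately show ?thesis
    unfolding refl_curve_def by (subst Bcontfun_inverse) (auto simp: bcontfun_def)
qed

lemma norm_refl_curve_le: "norm \<psi> \<le> C \<Longrightarrow> norm (refl_curve \<psi>) \<le> C"
  by (rule norm_bound) (auto simp: refl_curve_apply intro: order_trans[OF norm_refl_D_le order_trans[OF norm_bounded]])

text \<open>The reflection sends \<open>v\<^sub>+\<close> and \<open>v\<^sub>-\<close> to
  \<open>- v\<^sub>-\<close> and \<open>- v\<^sub>+\<close>; oddness of \<open>Q\<close> extracts
  the sign and its symmetry undoes the exchange of the outer arguments.\<close>

lemma g_fun_refl:
  assumes Qodd: "\<And>v u w. Q (- v) (- u) (- w) = - Q v u w" and Qsym: "\<And>v u w. Q v u w = Q w u v"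
    and \<phi>: "S0_rev \<phi>' = - \<phi>"
  shows "g_fun \<gamma> \<tau> Q \<epsilon> \<phi> (of_D (refl_D U)) = - g_fun \<gamma> \<tau> Q \<epsilon> \<phi>' (of_D U)"
proof -
  have c: "\<phi> $ 1 = - \<phi>' $ 1" "\<phi> $ 2 = \<phi>' $ 2" "\<phi> $ 3 = - \<phi>' $ 3" "\<phi> $ 4 = \<phi>' $ 4"
    using \<phi> by (simp_all add: S0_rev_def vec_eq_iff forall_4 vector_def)
  have "comb (- sqrt \<epsilon>) (1/2 * \<epsilon>) (- (1/6 * \<epsilon> powr (3/2))) (\<epsilon> powr (3/2)) \<phi> (cmp3 (refl_D U) (-1))
      = - comb (sqrt \<epsilon>) (1/2 * \<epsilon>) (1/6 * \<epsilon> powr (3/2)) (\<epsilon> powr (3/2)) \<phi>' (cmp3 U 1)"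
    "comb (sqrt \<epsilon>) (1/2 * \<epsilon>) (1/6 * \<epsilon> powr (3/2)) (\<epsilon> powr (3/2)) \<phi> (cmp3 (refl_D U) 1)
      = - comb (- sqrt \<epsilon>) (1/2 * \<epsilon>) (- (1/6 * \<epsilon> powr (3/2))) (\<epsilon> powr (3/2)) \<phi>' (cmp3 U (-1))"
    "comb 0 0 0 (\<epsilon> powr (3/2)) \<phi> (cmp1 (refl_D U)) = - comb 0 0 0 (\<epsilon> powr (3/2)) \<phi>' (cmp1 U)"
    by (simp_all add: comb_def c refl_components algebra_simps)
  then show ?thesis
    unfolding g_fun_eq Qodd
    using Qsym[of "comb (sqrt \<epsilon>) (1/2 * \<epsilon>) (1/6 * \<epsilon> powr (3/2)) (\<epsilon> powr (3/2)) \<phi>' (cmp3 U 1)"]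
    by (simp add: Qodd c refl_components algebra_simps)
qed

section \<open>Reversible and asymptotically periodic solutions\<close>

context
  fixes \<gamma> \<tau> M L \<epsilon> :: real and Q :: "real \<Rightarrow> real \<Rightarrow> real \<Rightarrow> real"
  assumes Qodd: "\<And>v u w. Q (- v) (- u) (- w) = - Q v u w"
    and Qsym: "\<And>v u w. Q v u w = Q w u v"
    and lip: "g_lip \<gamma> \<tau> Q M L" and L: "1 \<le> L" and M: "0 < M"
    and \<epsilon>: "0 < \<epsilon>" "\<epsilon> \<le> 1" and small: "sqrt \<epsilon> * (56 * L * (M + 1)) \<le> 1/2"
begin

lemmas setting = Qodd Qsym lip L M \<epsilon> small

lemma le_1: "norm \<psi> \<le> sqrt \<epsilon> * (56 * L * (M + 1)) \<Longrightarrow> norm \<psi> \<le> 1"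
  using small by linarith

lemma solution_exists_unique:
  fixes \<phi> :: "real \<Rightarrow>\<^sub>C (real^4)"
  assumes \<phi>: "norm \<phi> \<le> M"
  shows "\<exists>!\<psi>. solution \<gamma> \<tau> Q \<epsilon> \<phi> \<psi> \<and> norm \<psi> \<le> sqrt \<epsilon> * (56 * L * (M + 1))"
proof -
  note iff = solution_iff[where Q = Q, OF setting \<phi>]
  obtain \<psi> where \<psi>: "norm \<psi> \<le> 1"
      "lin_sol (rhs \<gamma> \<tau> Q \<epsilon> \<phi> (apply_bcontfun \<psi>)) (apply_bcontfun \<psi>)"
    using lin_sol_exists_rhs[where Q = Q, OF setting \<phi>] by blast
  show ?thesis
  proof (rule ex1I[of _ \<psi>])
    show "solution \<gamma> \<tau> Q \<epsilon> \<phi> \<psi> \<and> norm \<psi> \<le> sqrt \<epsilon> * (56 * L * (M + 1))"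
      using iff[OF \<psi>(1)] \<psi>(2) lin_sol_rhs_norm_le[where Q = Q, OF setting \<phi> \<psi>] by simp
    fix \<psi>' assume "solution \<gamma> \<tau> Q \<epsilon> \<phi> \<psi>' \<and> norm \<psi>' \<le> sqrt \<epsilon> * (56 * L * (M + 1))"
    then have "norm \<psi>' \<le> 1" "solution \<gamma> \<tau> Q \<epsilon> \<phi> \<psi>'" using le_1 by auto
    then show "\<psi>' = \<psi>"
      using unique[where Q = Q, OF setting \<phi> _ \<psi>(1) _ \<psi>(2), of \<psi>'] iff[of \<psi>'] by simp
  qed
qed

text \<open>For anti-reversible \<open>\<phi>\<close> the reflected, time-reversed curve solves the
  same system in the unit ball, and hence coincides with \<open>\<psi>\<close>.\<close>

lemma solution_reversible:
  fixes \<phi> :: "real \<Rightarrow>\<^sub>C (real^4)" and \<psi> :: "real \<Rightarrow>\<^sub>C dspace"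
  assumes \<phi>: "norm \<phi> \<le> M" and \<psi>: "norm \<psi> \<le> 1" and sol: "solution \<gamma> \<tau> Q \<epsilon> \<phi> \<psi>"
    and rev: "\<And>t. S0_rev (\<phi> (- t)) = - \<phi> t"
  shows "S_rev (of_D (\<psi> (- \<zeta>))) = - of_D (\<psi> \<zeta>)"
proof -
  have l: "lin_sol (rhs \<gamma> \<tau> Q \<epsilon> \<phi> \<psi>) \<psi>"
    using sol solution_iff[where Q = Q, OF setting \<phi> \<psi>] by simp
  have "rhs \<gamma> \<tau> Q \<epsilon> \<phi> (refl_curve \<psi>) = (\<lambda>z. - rhs \<gamma> \<tau> Q \<epsilon> \<phi> \<psi> (- z))"
  proof
    fix z
    have "g_fun \<gamma> \<tau> Q \<epsilon> (\<phi> (sqrt \<epsilon> * z)) (of_D (refl_D (\<psi> (- z)))) =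
        - g_fun \<gamma> \<tau> Q \<epsilon> (\<phi> (- (sqrt \<epsilon> * z))) (of_D (\<psi> (- z)))"
      by (rule g_fun_refl[where Q = Q, OF Qodd Qsym rev])
    then show "rhs \<gamma> \<tau> Q \<epsilon> \<phi> (refl_curve \<psi>) z = - rhs \<gamma> \<tau> Q \<epsilon> \<phi> \<psi> (- z)"
      by (simp add: rhs_def refl_curve_apply)
  qed
  moreover have "apply_bcontfun (refl_curve \<psi>) = (\<lambda>z. refl_D (\<psi> (- z)))"
    by (rule ext) (rule refl_curve_apply)
  ultimately have "lin_sol (rhs \<gamma> \<tau> Q \<epsilon> \<phi> (refl_curve \<psi>)) (refl_curve \<psi>)"
    using lin_sol_refl[OF l] by simp
  from unique[where Q = Q, OF setting \<phi> norm_refl_curve_le[OF \<psi>] \<psi> this l]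
  have "of_D (\<psi> \<zeta>) = of_D (refl_curve \<psi> \<zeta>)" by simp
  then show ?thesis by (simp add: refl_curve_apply of_D_refl_D refl_H_eq)
qed

text \<open>\<open>sqrt \<epsilon> * (z + \<theta> / sqrt \<epsilon>) = sqrt \<epsilon> * z +
  \<theta>\<close>: this is where phases and periods acquire the factor
  \<open>1 / sqrt \<epsilon>\<close>.\<close>

lemma lin_sol_rhs_shift:
  fixes \<phi> :: "real \<Rightarrow>\<^sub>C (real^4)" and \<psi> :: "real \<Rightarrow>\<^sub>C dspace"
  assumes "lin_sol (rhs \<gamma> \<tau> Q \<epsilon> \<phi> \<psi>) \<psi>"
  shows "lin_sol (rhs \<gamma> \<tau> Q \<epsilon> (shift \<theta> \<phi>) (shift (\<theta> / sqrt \<epsilon>) \<psi>)) (shift (\<theta> / sqrt \<epsilon>) \<psi>)"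
proof -
  have "rhs \<gamma> \<tau> Q \<epsilon> (shift \<theta> \<phi>) (shift (\<theta> / sqrt \<epsilon>) \<psi>) = (\<lambda>z. rhs \<gamma> \<tau> Q \<epsilon> \<phi> \<psi> (z + \<theta> / sqrt \<epsilon>))"
    using \<epsilon> by (simp add: rhs_def fun_eq_iff distrib_left)
  moreover have "apply_bcontfun (shift (\<theta> / sqrt \<epsilon>) \<psi>) = (\<lambda>z. \<psi> (z + \<theta> / sqrt \<epsilon>))"
    by (rule ext) simp
  ultimately show ?thesis using lin_sol_shift[OF assms] by simp
qed

text \<open>The phase is absorbed by translating \<open>P\<close> and \<open>\<Psi>\<close>
  together; what remains is the comparison of two solutions whose data approach each other along the
  filter.\<close>

lemma solution_asymptotic:
  fixes \<phi> P :: "real \<Rightarrow>\<^sub>C (real^4)" and \<psi> \<Psi> :: "real \<Rightarrow>\<^sub>C dspace"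
  assumes \<phi>: "norm \<phi> \<le> M" "norm P \<le> M" and \<psi>: "norm \<psi> \<le> 1" "norm \<Psi> \<le> 1"
    and sol: "lin_sol (rhs \<gamma> \<tau> Q \<epsilon> \<phi> \<psi>) \<psi>" "lin_sol (rhs \<gamma> \<tau> Q \<epsilon> P \<Psi>) \<Psi>"
    and X: "shift_stable \<X>" "filterlim (\<lambda>z. sqrt \<epsilon> * z) \<X> \<X>"
    and lim: "tends_to_orbit \<X> \<phi> P \<theta>"
  shows "tends_to_orbit \<X> \<psi> \<Psi> (\<theta> / sqrt \<epsilon>)"
  unfolding tends_to_orbit_def tendsto_iff
proof (intro allI impI)
  fix e :: real assume "e > 0"
  then have e: "e / 2 > 0" by simp
  have "((\<lambda>z. \<phi> (sqrt \<epsilon> * z) - shift \<theta> P (sqrt \<epsilon> * z)) \<longlongrightarrow> 0) \<X>"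
    using compress_time[OF X(2) lim] by simp
  from comparison[where Q = Q, OF setting \<phi>(1) norm_shift_le[OF \<phi>(2)] \<psi>(1) norm_shift_le[OF \<psi>(2)]
      sol(1) lin_sol_rhs_shift[OF sol(2)] X(1) this e]
  show "\<forall>\<^sub>F z in \<X>. dist (\<psi> z - \<Psi> (z + \<theta> / sqrt \<epsilon>)) 0 < e"
    by (rule eventually_mono) (use \<open>e > 0\<close> in simp)
qed

text \<open>The translate by \<open>T / sqrt \<epsilon>\<close> solves the system for the same
  \<open>P\<close>, so uniqueness identifies it with \<open>\<Psi>\<close>.\<close>

lemma solution_periodic:
  fixes P :: "real \<Rightarrow>\<^sub>C (real^4)" and \<Psi> :: "real \<Rightarrow>\<^sub>C dspace"
  assumes P: "norm P \<le> M" "periodic T P" and \<Psi>: "norm \<Psi> \<le> 1"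
    and sol: "lin_sol (rhs \<gamma> \<tau> Q \<epsilon> P \<Psi>) \<Psi>"
  shows "periodic (T / sqrt \<epsilon>) \<Psi>"
proof -
  have T: "T > 0" "\<And>t. P (t + T) = P t" using P(2) by (auto simp: periodic_def)
  have "shift T P = P" by (rule bcontfun_eqI) (simp add: T)
  then have "lin_sol (rhs \<gamma> \<tau> Q \<epsilon> P (shift (T / sqrt \<epsilon>) \<Psi>)) (shift (T / sqrt \<epsilon>) \<Psi>)"
    using lin_sol_rhs_shift[OF sol, of T] by simp
  from unique[where Q = Q, OF setting P(1) norm_shift_le[OF \<Psi>] \<Psi> this sol]
  have "shift (T / sqrt \<epsilon>) \<Psi> t = \<Psi> t" for t by simp
  then show ?thesis using T(1) \<epsilon> by (simp add: periodic_def)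
qed

end

theorem theorem1:
  fixes \<gamma> \<tau> M :: real and Q :: "real \<Rightarrow> real \<Rightarrow> real \<Rightarrow> real"
  assumes "\<tau> > 0" and "admissible_Q Q" and "M > 0"
  shows "\<exists>\<epsilon>0>0. \<exists>K>0. \<forall>\<epsilon>. 0 < \<epsilon> \<and> \<epsilon> < \<epsilon>0 \<longrightarrow>
    (\<forall>\<phi> :: real \<Rightarrow>\<^sub>C (real^4). norm \<phi> \<le> M \<longrightarrow>
      (\<exists>!\<psi>. solution \<gamma> \<tau> Q \<epsilon> \<phi> \<psi> \<and> norm \<psi> \<le> sqrt \<epsilon> * K) \<and>
      (\<forall>\<psi>. solution \<gamma> \<tau> Q \<epsilon> \<phi> \<psi> \<and> norm \<psi> \<le> sqrt \<epsilon> * K \<longrightarrow>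
        ((\<forall>t. S0_rev (\<phi> (- t)) = - \<phi> t) \<longrightarrow>
          (\<forall>\<zeta>. S_rev (of_D (\<psi> (- \<zeta>))) = - of_D (\<psi> \<zeta>))) \<and>
        (\<forall>T (P :: real \<Rightarrow>\<^sub>C (real^4)). periodic T P \<and>
            (\<exists>\<theta>. tends_to_orbit at_top \<phi> P \<theta> \<or> tends_to_orbit at_bot \<phi> P \<theta>) \<longrightarrow>
          (\<exists>\<Psi>. solution \<gamma> \<tau> Q \<epsilon> P \<Psi> \<and> periodic (T / sqrt \<epsilon>) \<Psi> \<and>
            (\<forall>\<theta>. tends_to_orbit at_top \<phi> P \<theta> \<longrightarrow>
              tends_to_orbit at_top \<psi> \<Psi> (\<theta> / sqrt \<epsilon>)) \<and>
            (\<forall>\<theta>. tends_to_orbit at_bot \<phi> P \<theta> \<longrightarrow>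
              tends_to_orbit at_bot \<psi> \<Psi> (\<theta> / sqrt \<epsilon>))))))"
proof -
  have Q1: "Ck 1 (\<lambda>(v, u, w). Q v u w)" and Qodd: "\<And>v u w. Q (- v) (- u) (- w) = - Q v u w"
    and Qsym: "\<And>v u w. Q v u w = Q w u v"
    using assms(2) unfolding admissible_Q_def by blast+
  obtain L where L: "1 \<le> L" and lip: "g_lip \<gamma> \<tau> Q M L"
    using g_lip_exists[OF Q1] by blast
  \<comment> \<open>\<open>56\<close> comes from the linear estimate, and \<open>L * (M + 1)\<close>
    bounds \<open>g\<close> on the balls of radius \<open>M\<close> and 1.\<close>
  define K where "K = 56 * L * (M + 1)"
  have K: "K > 0" using L \<open>M > 0\<close> by (simp add: K_def)
  \<comment> \<open>From \<open>sqrt \<epsilon> \<le> 1 / (1 + 2 * K)\<close> follow both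
    \<open>\<epsilon> \<le> 1\<close> and \<open>sqrt \<epsilon> * K \<le> 1/2\<close>.\<close>
  define \<epsilon>0 where "\<epsilon>0 = 1 / (1 + 2 * K)^2"
  have \<epsilon>0: "\<epsilon>0 > 0" using K by (simp add: \<epsilon>0_def)
  have setting: "Q (- v) (- u) (- w) = - Q v u w" "Q v u w = Q w u v" "g_lip \<gamma> \<tau> Q M L" "1 \<le> L" "0 < M"
    "0 < \<epsilon>" "\<epsilon> \<le> 1" "sqrt \<epsilon> * (56 * L * (M + 1)) \<le> 1/2"
    if \<epsilon>: "0 < \<epsilon> \<and> \<epsilon> < \<epsilon>0" for \<epsilon> v u w
  proof -
    have "sqrt \<epsilon> \<le> sqrt \<epsilon>0" using \<epsilon> by simp
    also have "\<dots> = 1 / (1 + 2 * K)" using K by (simp add: \<epsilon>0_def real_sqrt_divide)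
    finally have s: "sqrt \<epsilon> \<le> 1 / (1 + 2 * K)" .
    then have "sqrt \<epsilon> * K \<le> 1 / (1 + 2 * K) * K" using K by (intro mult_right_mono) auto
    also have "\<dots> \<le> 1/2" using K by (simp add: field_simps)
    finally show "sqrt \<epsilon> * (56 * L * (M + 1)) \<le> 1/2" by (simp only: K_def)
    have "1 / (1 + 2 * K) \<le> 1" using K by simp
    then have "sqrt \<epsilon> \<le> 1" using s by linarith
    then show "\<epsilon> \<le> 1" by simp
  qed (use \<epsilon> Qodd lip L \<open>M > 0\<close> in \<open>auto intro: Qsym\<close>)
  show ?thesis
  proof (rule exI[of _ \<epsilon>0], intro exI[of _ K] conjI allI impI \<epsilon>0 K)
    fix \<epsilon> and \<phi> :: "real \<Rightarrow>\<^sub>C (real^4)"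
    assume \<epsilon>: "0 < \<epsilon> \<and> \<epsilon> < \<epsilon>0" and \<phi>: "norm \<phi> \<le> M"
    show "\<exists>!\<psi>. solution \<gamma> \<tau> Q \<epsilon> \<phi> \<psi> \<and> norm \<psi> \<le> sqrt \<epsilon> * K"
      using solution_exists_unique[where Q = Q, OF setting[OF \<epsilon>] \<phi>] by (simp only: K_def)
  next
    fix \<epsilon> \<zeta> and \<phi> :: "real \<Rightarrow>\<^sub>C (real^4)" and \<psi>
    assume \<epsilon>: "0 < \<epsilon> \<and> \<epsilon> < \<epsilon>0" and \<phi>: "norm \<phi> \<le> M"
      and \<psi>: "solution \<gamma> \<tau> Q \<epsilon> \<phi> \<psi> \<and> norm \<psi> \<le> sqrt \<epsilon> * K"
      and rev: "\<forall>t. S0_rev (\<phi> (- t)) = - \<phi> t"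
    have "norm \<psi> \<le> 1"
      using conjunct2[OF \<psi>, unfolded K_def] by (rule le_1[where Q = Q, OF setting[OF \<epsilon>]])
    then show "S_rev (of_D (\<psi> (- \<zeta>))) = - of_D (\<psi> \<zeta>)"
      using solution_reversible[where Q = Q, OF setting[OF \<epsilon>] \<phi>] \<psi> rev by blast
  next
    fix \<epsilon> T and \<phi> P :: "real \<Rightarrow>\<^sub>C (real^4)" and \<psi>
    assume \<epsilon>: "0 < \<epsilon> \<and> \<epsilon> < \<epsilon>0" and \<phi>: "norm \<phi> \<le> M"
      and \<psi>: "solution \<gamma> \<tau> Q \<epsilon> \<phi> \<psi> \<and> norm \<psi> \<le> sqrt \<epsilon> * K"
      and P: "periodic T P \<and> (\<exists>\<theta>. tends_to_orbit at_top \<phi> P \<theta> \<or> tends_to_orbit at_bot \<phi> P \<theta>)"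
    note set = setting[OF \<epsilon>]
    have \<psi>1: "norm \<psi> \<le> 1"
      using conjunct2[OF \<psi>, unfolded K_def] by (rule le_1[where Q = Q, OF set])
    have PM: "norm P \<le> M" using norm_limit_orbit_le[OF \<phi>] P by blast
    \<comment> \<open>\<open>\<Psi>\<close> is determined by \<open>P\<close> alone, before any
      phase is chosen, so the same orbit serves both ends and every \<open>\<theta>\<close>.\<close>
    obtain \<Psi> where \<Psi>: "solution \<gamma> \<tau> Q \<epsilon> P \<Psi>" "norm \<Psi> \<le> sqrt \<epsilon> * (56 * L * (M + 1))"
      using solution_exists_unique[where Q = Q, OF set PM] by blast
    have \<Psi>1: "norm \<Psi> \<le> 1" by (rule le_1[where Q = Q, OF set \<Psi>(2)])
    have l: "lin_sol (rhs \<gamma> \<tau> Q \<epsilon> \<phi> \<psi>) \<psi>" "lin_sol (rhs \<gamma> \<tau> Q \<epsilon> P \<Psi>) \<Psi>"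
      using solution_iff[where Q = Q, OF set \<phi> \<psi>1] solution_iff[where Q = Q, OF set PM \<Psi>1] \<psi> \<Psi>(1) by simp_all
    have \<epsilon>': "0 < \<epsilon>" using \<epsilon> by simp
    show "\<exists>\<Psi>. solution \<gamma> \<tau> Q \<epsilon> P \<Psi> \<and> periodic (T / sqrt \<epsilon>) \<Psi> \<and>
            (\<forall>\<theta>. tends_to_orbit at_top \<phi> P \<theta> \<longrightarrow> tends_to_orbit at_top \<psi> \<Psi> (\<theta> / sqrt \<epsilon>)) \<and>
            (\<forall>\<theta>. tends_to_orbit at_bot \<phi> P \<theta> \<longrightarrow> tends_to_orbit at_bot \<psi> \<Psi> (\<theta> / sqrt \<epsilon>))"
    proof (intro exI[of _ \<Psi>] conjI allI impI)
      show "periodic (T / sqrt \<epsilon>) \<Psi>"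
        using solution_periodic[where Q = Q, OF set PM _ \<Psi>1 l(2)] P by blast
    next
      fix \<theta> assume "tends_to_orbit at_top \<phi> P \<theta>"
      then show "tends_to_orbit at_top \<psi> \<Psi> (\<theta> / sqrt \<epsilon>)"
        by (rule solution_asymptotic[where Q = Q, OF set \<phi> PM \<psi>1 \<Psi>1 l shift_stable_filters(2) compress_filters(1)[OF \<epsilon>']])
    next
      fix \<theta> assume "tends_to_orbit at_bot \<phi> P \<theta>"
      then show "tends_to_orbit at_bot \<psi> \<Psi> (\<theta> / sqrt \<epsilon>)"
        by (rule solution_asymptotic[where Q = Q, OF set \<phi> PM \<psi>1 \<Psi>1 l shift_stable_filters(3) compress_filters(2)[OF \<epsilon>']])
    qed (rule \<Psi>(1))
  qed
qed

end
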